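(* For any $m,n\geqslant1$ and $N\geqslant1$, the set of eigenvalues of $\mathscr{A}_{m,n}$ on $V^{m,n}$ is exactly the set of integers $$a=rN+c(\rho/\mu)+c(\sigma/\nu)$$ where $r\in\{0,1,\dots,\min(m,n)\}$, $(\rho,\sigma)\in\mathcal{P}_{m,n}(N)$ and $(\mu,\nu)\in\Lambda^{(r)}_{m,n}(N)$ range over all choices with $c^{\mu\nu}_{\rho\sigma}(N)\neq0$. Moreover, such an $a$ equals $0$ if and only if $r=0$.
   Context: $V$ is an $N$-dimensional complex vector space with basis $\{e_i\}$ and dual basis $\{e^i\}$; $V^{m,n}=V^{\otimes m}\otimes V^{*\otimes n}$. For $1\leqslant a\leqslant m$, $1\leqslant b'\leqslant n$, $\tau_{ab'}$ is the endomorphism of $V^{m,n}$ which contracts the $a$-th $V$-factor with the $b'$-th $V^*$-factor and then inserts $\sum_{k=1}^Ne_k\otimes e^k$ with $e_k$ in the $a$-th and $e^k$ in the $b'$-th position; $\mathscr{A}_{m,n}=\sum_{a,b'}\tau_{ab'}$. Partitions: $|\alpha|$ size, $\ell(\alpha)$ number of parts, content $c(\alpha)=\sum_{(i,j)\in\alpha}(j-i)$ over boxes (row $i$, column $j$); $c(\alpha/\beta):=c(\alpha)-c(\beta)$. $\mathcal{P}_{m,n}(N)$: pairs $(\rho,\sigma)$ with $\rho\vdash m$, $\sigma\vdash n$, each with at most $N$ parts. $\Lambda^{(r)}_{m,n}(N)$: pairs of partitions $(\mu,\nu)$ with $m-|\mu|=n-|\nu|=r$ and $\ell(\mu)+\ell(\nu)\leqslant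 N$. For $(\mu,\nu)$ with $\ell(\mu)+\ell(\nu)\leqslant N$, $U^{(\mu,\nu)}$ is the irreducible rational $GL(N)$-representation with highest weight $(\mu_1,\dots,\mu_{\ell(\mu)},0,\dots,0,-\nu_{\ell(\nu)},\dots,-\nu_1)$; $U^{(\rho,\varnothing)}$ is the polynomial irreducible of highest weight $\rho$ and $U^{(\varnothing,\sigma)}$ the dual of the polynomial irreducible of highest weight $\sigma$. $c^{\mu\nu}_{\rho\sigma}(N)$ denotes the multiplicity of $U^{(\mu,\nu)}$ in $U^{(\rho,\varnothing)}\otimes U^{(\varnothing,\sigma)}$ (diagonal $GL(N)$-action), equivalently the coefficient of the rational Schur function $s_{(\mu,\nu)}$ in $s_{(\rho,\varnothing)}s_{(\varnothing,\sigma)}$. *)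

theory Defs
  imports Complex_Main "HOL-Combinatorics.Permutations"
begin

definition idx :: "nat \<Rightarrow> nat \<Rightarrow> (nat \<Rightarrow> nat) set" where
  "idx N m = {f. (\<forall>k<m. f k < N) \<and> (\<forall>k\<ge>m. f k = 0)}"

text \<open>An element of V^{m,n} is given by its coefficient array T(i,j), i.e.
  T = sum T(i,j) e_{i_0} (x) ... (x) e_{i_{m-1}} (x) e^{j_0} (x) ... (x) e^{j_{n-1}}.\<close>
definition tensors :: "nat \<Rightarrow> nat \<Rightarrow> nat \<Rightarrow> ((nat \<Rightarrow> nat) \<times> (nat \<Rightarrow> nat) \<Rightarrow> complex) set" where
  "tensors N m n = {T. \<forall>i j. \<not> (i \<in> idx N m \<and> j \<in> idx N n) \<longrightarrow> T (i, j) = 0}"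

text \<open>tau_{ab'}: contract the a-th V-factor with the b'-th V*-factor, then insert
  sum_k e_k (x) e^k in those positions.\<close>
definition tau :: "nat \<Rightarrow> nat \<Rightarrow> nat \<Rightarrow> nat \<Rightarrow> nat \<Rightarrow>
    ((nat \<Rightarrow> nat) \<times> (nat \<Rightarrow> nat) \<Rightarrow> complex) \<Rightarrow> ((nat \<Rightarrow> nat) \<times> (nat \<Rightarrow> nat) \<Rightarrow> complex)" where
  "tau N m n a b T = (\<lambda>(i, j).
     if i \<in> idx N m \<and> j \<in> idx N n \<and> i a = j b
     then (\<Sum>k<N. T (i(a := k), j(b := k))) else 0)"

definition opA :: "nat \<Rightarrow> nat \<Rightarrow> nat \<Rightarrow>
    ((nat \<Rightarrow> nat) \<times> (nat \<Rightarrow> nat) \<Rightarrow> complex) \<Rightarrow> ((nat \<Rightarrow> nat) \<times> (nat \<Rightarrow> nat) \<Rightarrow> complex)" where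
  "opA N m n T = (\<lambda>p. \<Sum>a<m. \<Sum>b<n. tau N m n a b T p)"

definition eigenvalues_A :: "nat \<Rightarrow> nat \<Rightarrow> nat \<Rightarrow> complex set" where
  "eigenvalues_A N m n = {c. \<exists>T \<in> tensors N m n. T \<noteq> (\<lambda>_. 0) \<and> opA N m n T = (\<lambda>p. c * T p)}"

definition is_partition :: "nat list \<Rightarrow> bool" where
  "is_partition \<alpha> \<longleftrightarrow> sorted_wrt (\<ge>) \<alpha> \<and> (\<forall>x \<in> set \<alpha>. x > 0)"

definition content :: "nat list \<Rightarrow> int" where
  "content \<alpha> = (\<Sum>i<length \<alpha>. \<Sum>j<\<alpha> ! i. int j - int i)"

text \<open>Highest weight (mu_1,..,mu_l,0,..,0,-nu_l',..,-nu_1) as a function on {0..<N}.\<close>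
definition hweight :: "nat \<Rightarrow> nat list \<times> nat list \<Rightarrow> nat \<Rightarrow> int" where
  "hweight N p k =
     (if k < length (fst p) then int (fst p ! k)
      else if N - length (snd p) \<le> k \<and> k < N then - int (snd p ! (N - 1 - k))
      else 0)"

text \<open>Generalized alternant det (x_i ^ e_j)_{i,j<N} (integer exponents), Leibniz formula.\<close>
definition alternant :: "nat \<Rightarrow> (nat \<Rightarrow> int) \<Rightarrow> (nat \<Rightarrow> complex) \<Rightarrow> complex" where
  "alternant N e x = (\<Sum>p | p permutes {..<N}. of_int (sign p) * (\<Prod>j<N. x (p j) powi e j))"

definition rat_schur :: "nat \<Rightarrow> nat list \<times> nat list \<Rightarrow> (nat \<Rightarrow> complex) \<Rightarrow> complex" where
  "rat_schur N p x =
     alternant N (\<lambda>j. hweight N p j + int (N - 1 - j)) x / alternant N (\<lambda>j. int (N - 1 - j)) x"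

text \<open>Points of the torus with pairwise distinct coordinates (where the Weyl denominator is nonzero).\<close>
definition torus_reg :: "nat \<Rightarrow> (nat \<Rightarrow> complex) set" where
  "torus_reg N = {x. (\<forall>i<N. x i \<noteq> 0) \<and> (\<forall>i<N. \<forall>j<N. i \<noteq> j \<longrightarrow> x i \<noteq> x j)}"

definition valid_pair :: "nat \<Rightarrow> nat list \<times> nat list \<Rightarrow> bool" where
  "valid_pair N p \<longleftrightarrow> is_partition (fst p) \<and> is_partition (snd p) \<and> length (fst p) + length (snd p) \<le> N"

text \<open>c^{mu nu}_{rho sigma}(N): the coefficient of s_{(mu,nu)} in s_{(rho,0)} s_{(0,sigma)}.\<close>
definition LRc :: "nat \<Rightarrow> nat list \<Rightarrow> nat list \<Rightarrow> nat list \<Rightarrow> nat list \<Rightarrow> nat" where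
  "LRc N \<rho> \<sigma> \<mu> \<nu> =
     (THE c. finite {p. c p \<noteq> 0} \<and> (\<forall>p. c p \<noteq> 0 \<longrightarrow> valid_pair N p) \<and>
        (\<forall>x \<in> torus_reg N. rat_schur N (\<rho>, []) x * rat_schur N ([], \<sigma>) x =
            (\<Sum>p | c p \<noteq> 0. of_nat (c p) * rat_schur N p x))) (\<mu>, \<nu>)"

definition admissible :: "nat \<Rightarrow> nat \<Rightarrow> nat \<Rightarrow> nat \<Rightarrow> nat list \<Rightarrow> nat list \<Rightarrow> nat list \<Rightarrow> nat list \<Rightarrow> bool" where
  "admissible N m n r \<rho> \<sigma> \<mu> \<nu> \<longleftrightarrow>
     r \<le> min m n \<and>
     is_partition \<rho> \<and> sum_list \<rho> = m \<and> length \<rho> \<le> N \<and>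
     is_partition \<sigma> \<and> sum_list \<sigma> = n \<and> length \<sigma> \<le> N \<and>
     is_partition \<mu> \<and> is_partition \<nu> \<and> sum_list \<mu> + r = m \<and> sum_list \<nu> + r = n \<and>
     length \<mu> + length \<nu> \<le> N \<and>
     LRc N \<rho> \<sigma> \<mu> \<nu> \<noteq> 0"

definition eig_value :: "nat \<Rightarrow> nat \<Rightarrow> nat list \<Rightarrow> nat list \<Rightarrow> nat list \<Rightarrow> nat list \<Rightarrow> int" where
  "eig_value N r \<rho> \<sigma> \<mu> \<nu> = int r * int N + (content \<rho> - content \<mu>) + (content \<sigma> - content \<nu>)"

end

(* The operator A is the cross term of the Casimir element C of gl(N) on V^{m,n}:
   2 A = C' + C'' - C, where C' and C'' are the Casimir operators of the two tensor factors. On the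
   constituent U^{(mu,nu)} of U^{(rho,0)} (x) U^{(0,sigma)} each of these is a scalar
   |lambda + delta|^2 - |delta|^2, which gives the formula for the eigenvalues.

   Weyl's character formula is obtained without highest weight theory. If B is a matrix commuting
   with gl(N), cyclicity of the trace expresses tr (B C x), x in the torus, by derivatives of
   tr (B x); after multiplication with the Weyl denominator, C becomes a Laplacian. So the
   coefficient phi of x^kappa in (denominator * character) is multiplied by |kappa|^2 - |delta|^2.
   Together with the positivity of the trace form this diagonalises C, computes its spectrum on
   every invariant subspace, and shows that phi is nonnegative at strictly decreasing exponents.
   The irreducible subspaces of the tensor powers are split off one box at a time as Casimir
   eigenspaces (Pieri rule). The Littlewood-Richardson numbers are the values of phi on the tensor
   product of two such subspaces. *)
theory Submission
  imports Defs "HOL-Computational_Algebra.Polynomial"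
begin

section \<open>Finitely supported matrices\<close>

text \<open>The Littlewood-Richardson number is a definite description over quotients of alternants,
  so constituents have to be detected through characters: \<open>hw\<close> records an invariant
  projection together with its character, and \<open>phi\<close> links matrices to alternants.
  Matrices are real, since everything is real in the tensor basis and \<open>X * tp X\<close> then
  has a nonnegative diagonal; eigenvectors may be complex and enter as row vectors
  (\<open>rv\<close>). With \<open>dl\<close> = (N-1, ..., 1, 0) instead of the half sum of the
  positive roots all exponents are integers. The pair (\<mu>, \<nu>) has Casimir value 2c(\<mu>) +
  2c(\<nu>) + (2N-1)|\<mu>| + |\<nu>|, and r contractions change the last two terms by (2N-1)r + r =
  2Nr, the origin of rN. That a multiplicity is a natural number takes two arguments: nonnegativity
  comes from a spectral bound, integrality from a triangular recursion on weights. That a = 0 forces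
  r = 0 rests on writing 2a as a sum of three nonnegative terms.\<close>

typedef 'p fmat = "{A :: 'p \<Rightarrow> 'p \<Rightarrow> real. finite {p. \<exists>q. A p q \<noteq> 0 \<or> A q p \<noteq> 0}}"
  morphisms entry Abs_fmat
  by (rule exI[of _ "\<lambda>_ _. 0"]) simp

definition msupp :: "'p fmat \<Rightarrow> 'p set" where
  "msupp A = {p. \<exists>q. entry A p q \<noteq> 0 \<or> entry A q p \<noteq> 0}"

lemma finite_msupp [simp]: "finite (msupp A)"
  using entry[of A] by (simp add: msupp_def)

lemma entry_eq_0: "p \<notin> msupp A \<or> q \<notin> msupp A \<Longrightarrow> entry A p q = 0"
  by (auto simp: msupp_def)

lemma entry_neq_0: "entry A p q \<noteq> 0 \<Longrightarrow> p \<in> msupp A" "entry A p q \<noteq> 0 \<Longrightarrow> q \<in> msupp A"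
  by (auto simp: msupp_def)

lemma fmat_eqI: "(\<And>p q. entry A p q = entry B p q) \<Longrightarrow> A = B"
  by (meson entry_inject ext)

lemma msupp_subsetI: "(\<And>p q. entry A p q \<noteq> 0 \<Longrightarrow> p \<in> I \<and> q \<in> I) \<Longrightarrow> msupp A \<subseteq> I"
  by (auto simp: msupp_def)

lemma entry_Abs:
  assumes "finite I" "\<And>p q. f p q \<noteq> 0 \<Longrightarrow> p \<in> I \<and> q \<in> I"
  shows "entry (Abs_fmat f) p q = f p q"
proof -
  have "{p. \<exists>q. f p q \<noteq> 0 \<or> f q p \<noteq> 0} \<subseteq> I"
    using assms(2) by blast
  then have "finite {p. \<exists>q. f p q \<noteq> 0 \<or> f q p \<noteq> 0}"
    using assms(1) finite_subset by blast
  then show ?thesis by (simp add: Abs_fmat_inverse)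
qed

text \<open>The index sets depend on numbers such as m and N and cannot be types, so matrices of all
  finite sizes share one ring. Over an infinite index type it has no unit; \<open>one_on I\<close>
  acts as the identity of the block \<open>I\<close>.\<close>

instantiation fmat :: (type) "{zero, plus, uminus, minus, times}"
begin

definition "0 = Abs_fmat (\<lambda>_ _. 0)"
definition "A + B = Abs_fmat (\<lambda>p q. entry A p q + entry B p q)"
definition "- A = Abs_fmat (\<lambda>p q. - entry A p q)"
definition "A - B = Abs_fmat (\<lambda>p q. entry A p q - entry B p q)"
definition "A * B = Abs_fmat (\<lambda>p q. \<Sum>r\<in>msupp A. entry A p r * entry B r q)"

instance ..

end

lemma entry_zero [simp]: "entry 0 p q = 0"
  unfolding zero_fmat_def by (rule entry_Abs[of "{}"]) auto

lemma entry_plus [simp]: "entry (A + B) p q = entry A p q + entry B p q"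
  unfolding plus_fmat_def
  by (rule entry_Abs[of "msupp A \<union> msupp B"]) (simp, metis UnCI add_0 entry_eq_0)

lemma entry_uminus [simp]: "entry (- A) p q = - entry A p q"
  unfolding uminus_fmat_def
  by (rule entry_Abs[of "msupp A"]) (auto intro: entry_neq_0)

lemma entry_minus [simp]: "entry (A - B) p q = entry A p q - entry B p q"
  unfolding minus_fmat_def
  by (rule entry_Abs[of "msupp A \<union> msupp B"]) (simp, metis UnCI diff_0_right entry_eq_0)

lemma entry_times0: "entry (A * B) p q = (\<Sum>r\<in>msupp A. entry A p r * entry B r q)"
  unfolding times_fmat_def
proof (rule entry_Abs[of "msupp A \<union> msupp B"])
  fix p q assume "(\<Sum>r\<in>msupp A. entry A p r * entry B r q) \<noteq> 0"
  then obtain r where "entry A p r * entry B r q \<noteq> 0"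
    by (rule sum.not_neutral_contains_not_neutral)
  then have "entry A p r \<noteq> 0" "entry B r q \<noteq> 0" by auto
  then show "p \<in> msupp A \<union> msupp B \<and> q \<in> msupp A \<union> msupp B"
    by (auto intro: entry_neq_0)
qed simp

text \<open>Only indices in both supports contribute, so the sum may run over any finite set
  containing one of the supports. This lets products be expanded over one common index set.\<close>

lemma entry_times:
  assumes "finite S" "msupp A \<subseteq> S \<or> msupp B \<subseteq> S"
  shows "entry (A * B) p q = (\<Sum>r\<in>S. entry A p r * entry B r q)"
proof -
  have *: "(\<Sum>r\<in>T. entry A p r * entry B r q) = (\<Sum>r\<in>msupp A \<inter> msupp B. entry A p r * entry B r q)"
    if "finite T" "msupp A \<subseteq> T \<or> msupp B \<subseteq> T" for T
    using that by (intro sum.mono_neutral_right) (auto intro: entry_neq_0)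
  show ?thesis using *[OF assms] *[of "msupp A"] by (simp add: entry_times0)
qed

instance fmat :: (type) ring
proof
  fix A B C :: "'p fmat"
  \<comment> \<open>One finite set that is large enough for every product below, so that
    associativity is an interchange of two sums.\<close>
  let ?S = "msupp A \<union> msupp B \<union> msupp C \<union> msupp (A * B) \<union> msupp (A + B) \<union> msupp (B * C)"
  have S: "finite ?S" by simp
  have e: "entry (X * Y) p q = (\<Sum>r\<in>?S. entry X p r * entry Y r q)"
    if "X \<in> {A, B, C, A * B, A + B} \<or> Y \<in> {A, B, C}" for X Y p q
    by (rule entry_times[OF S]) (use that in blast)
  show "A * B * C = A * (B * C)"
  proof (rule fmat_eqI)
    fix p q
    have "entry (A * B * C) p q = (\<Sum>r\<in>?S. \<Sum>s\<in>?S. entry A p s * entry B s r * entry C r q)"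
      by (simp add: e sum_distrib_right)
    also have "\<dots> = (\<Sum>s\<in>?S. \<Sum>r\<in>?S. entry A p s * entry B s r * entry C r q)"
      by (rule sum.swap)
    also have "\<dots> = entry (A * (B * C)) p q"
      by (simp add: e sum_distrib_left mult.assoc)
    finally show "entry (A * B * C) p q = entry (A * (B * C)) p q" .
  qed
  show "(A + B) * C = A * C + B * C"
    by (rule fmat_eqI) (simp add: e algebra_simps sum.distrib)
  show "A * (B + C) = A * B + A * C"
    by (rule fmat_eqI) (simp add: e algebra_simps sum.distrib)
qed (auto intro!: fmat_eqI)

instantiation fmat :: (type) scaleR
begin

definition "c *\<^sub>R A = Abs_fmat (\<lambda>p q. c * entry A p q)"

instance ..

end

lemma entry_scaleR [simp]: "entry (c *\<^sub>R A) p q = c * entry A p q"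
  unfolding scaleR_fmat_def
  by (rule entry_Abs[of "msupp A"]) (auto intro: entry_neq_0)

lemma msupp_scaleR: "msupp (c *\<^sub>R A) \<subseteq> msupp A"
  by (rule msupp_subsetI) (auto intro: entry_neq_0)

instance fmat :: (type) real_algebra
proof
  fix a :: real and x y :: "'p fmat"
  show "a *\<^sub>R x * y = a *\<^sub>R (x * y)"
    by (rule fmat_eqI)
      (simp add: entry_times[of "msupp x" "a *\<^sub>R x" y] entry_times[of "msupp x" x y] msupp_scaleR sum_distrib_left mult.assoc)
  show "x * a *\<^sub>R y = a *\<^sub>R (x * y)"
    by (rule fmat_eqI)
      (simp add: entry_times[of "msupp x"] msupp_scaleR sum_distrib_left mult.left_commute)
qed (auto intro!: fmat_eqI simp: algebra_simps)

lemma entry_sum [simp]: "entry (\<Sum>i\<in>J. F i) p q = (\<Sum>i\<in>J. entry (F i) p q)"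
  by (induction J rule: infinite_finite_induct) auto

lemma msupp_subset_iff: "msupp A \<subseteq> I \<longleftrightarrow> (\<forall>p q. entry A p q \<noteq> 0 \<longrightarrow> p \<in> I \<and> q \<in> I)"
  by (auto simp: msupp_def)

lemma msupp_plus: "msupp A \<subseteq> I \<Longrightarrow> msupp B \<subseteq> I \<Longrightarrow> msupp (A + B) \<subseteq> I"
  by (simp add: msupp_subset_iff) (metis add.right_neutral add_0)

lemma msupp_uminus: "msupp A \<subseteq> I \<Longrightarrow> msupp (- A) \<subseteq> I"
  by (simp add: msupp_subset_iff)

lemma msupp_zero [simp]: "msupp 0 = {}"
  by (simp add: msupp_def)

lemma msupp_sum: "(\<And>i. i \<in> J \<Longrightarrow> msupp (F i) \<subseteq> I) \<Longrightarrow> msupp (\<Sum>i\<in>J. F i) \<subseteq> I"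
  by (induction J rule: infinite_finite_induct) (simp_all add: msupp_plus)

lemma msupp_times: "msupp A \<subseteq> I \<Longrightarrow> msupp B \<subseteq> I \<Longrightarrow> msupp (A * B) \<subseteq> I"
proof (rule msupp_subsetI)
  fix p q assume AB: "msupp A \<subseteq> I" "msupp B \<subseteq> I" and "entry (A * B) p q \<noteq> 0"
  then have "(\<Sum>r\<in>msupp A. entry A p r * entry B r q) \<noteq> 0" by (simp add: entry_times0)
  then obtain r where "entry A p r * entry B r q \<noteq> 0"
    by (rule sum.not_neutral_contains_not_neutral)
  then have "p \<in> msupp A" "q \<in> msupp B" by (auto intro: entry_neq_0)
  then show "p \<in> I \<and> q \<in> I" using AB by blast
qed

definition tp :: "'p fmat \<Rightarrow> 'p fmat" where
  "tp A = Abs_fmat (\<lambda>p q. entry A q p)"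

lemma entry_tp [simp]: "entry (tp A) p q = entry A q p"
  unfolding tp_def by (rule entry_Abs[of "msupp A"]) (use entry_eq_0 in force)+

lemma tp_simps [simp]: "tp (A + B) = tp A + tp B" "tp (A - B) = tp A - tp B" "tp (- A) = - tp A"
  "tp 0 = 0" "tp (tp A) = A"
  "tp (c *\<^sub>R A) = c *\<^sub>R tp A" "tp (\<Sum>i\<in>J. F i) = (\<Sum>i\<in>J. tp (F i))"
  by (rule fmat_eqI; simp)+

lemma msupp_tp [simp]: "msupp (tp A) = msupp A"
  by (auto simp: msupp_def)

lemma tp_times: "tp (A * B) = tp B * tp A"
  by (rule fmat_eqI) (simp add: entry_times[of "msupp A"] mult.commute)

text \<open>The trace of \<open>X * tp X\<close> is the sum of the squares of all entries, so a
  vanishing trace becomes a vanishing matrix.\<close>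

lemma fmat_eq_0_if_trace:
  assumes "finite I" "msupp X \<subseteq> I" "(\<Sum>p\<in>I. entry (X * tp X) p p) = 0"
  shows "X = 0"
proof -
  have e: "entry (X * tp X) p p = (\<Sum>r\<in>I. (entry X p r)\<^sup>2)" for p
    using entry_times[of I X "tp X" p p] assms(1,2) by (simp add: power2_eq_square)
  have "(\<Sum>r\<in>I. (entry X p r)\<^sup>2) = 0" if "p \<in> I" for p
    using sum_nonneg_eq_0_iff[of I "\<lambda>p. \<Sum>r\<in>I. (entry X p r)\<^sup>2"] assms that
    by (auto simp: e sum_nonneg)
  then have "entry X p r = 0" if "p \<in> I" "r \<in> I" for p r
    using sum_nonneg_eq_0_iff[of I "\<lambda>r. (entry X p r)\<^sup>2"] assms(1) that by auto
  then show ?thesis using assms(2) by (intro fmat_eqI) (auto intro: entry_eq_0)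
qed

section \<open>Diagonal matrices, Kronecker products and relabelling of the basis\<close>

definition dg :: "'p set \<Rightarrow> ('p \<Rightarrow> real) \<Rightarrow> 'p fmat" where
  "dg I g = Abs_fmat (\<lambda>p q. if p = q \<and> p \<in> I then g p else 0)"

lemma entry_dg: "finite I \<Longrightarrow> entry (dg I g) p q = (if p = q \<and> p \<in> I then g p else 0)"
  unfolding dg_def by (rule entry_Abs[of I]) (auto split: if_splits)

lemma msupp_dg: "finite I \<Longrightarrow> msupp (dg I g) \<subseteq> I"
  by (rule msupp_subsetI) (auto simp: entry_dg split: if_splits)

lemma tp_dg: "finite I \<Longrightarrow> tp (dg I g) = dg I g"
  by (rule fmat_eqI) (auto simp: entry_dg)

lemma entry_times_dg:
  assumes "finite I"
  shows "entry (A * dg I g) p q = (if q \<in> I then entry A p q * g q else 0)"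
  using assms by (simp add: entry_times[of I] msupp_dg entry_dg if_distrib cong: if_cong)

lemma entry_dg_times:
  assumes "finite I"
  shows "entry (dg I g * A) p q = (if p \<in> I then g p * entry A p q else 0)"
proof -
  have "entry (dg I g * A) p q = (\<Sum>r\<in>I. if r = p then g p * entry A p q else 0)"
    unfolding entry_times[OF assms disjI1[OF msupp_dg[OF assms]]]
    by (rule sum.cong) (auto simp: entry_dg assms)
  then show ?thesis using assms by simp
qed

abbreviation one_on :: "'p set \<Rightarrow> 'p fmat" where
  "one_on I \<equiv> dg I (\<lambda>_. 1)"

lemma one_on_times: "finite I \<Longrightarrow> msupp A \<subseteq> I \<Longrightarrow> one_on I * A = A"
  by (rule fmat_eqI) (use entry_eq_0[of _ A] in \<open>auto simp: entry_dg_times\<close>)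

lemma times_one_on: "finite I \<Longrightarrow> msupp A \<subseteq> I \<Longrightarrow> A * one_on I = A"
  by (rule fmat_eqI) (use entry_eq_0[of _ A] in \<open>auto simp: entry_times_dg\<close>)

definition tns :: "'p fmat \<Rightarrow> 'q fmat \<Rightarrow> ('p \<times> 'q) fmat" where
  "tns A B = Abs_fmat (\<lambda>x y. entry A (fst x) (fst y) * entry B (snd x) (snd y))"

lemma entry_tns [simp]: "entry (tns A B) x y = entry A (fst x) (fst y) * entry B (snd x) (snd y)"
  unfolding tns_def
  by (rule entry_Abs[of "msupp A \<times> msupp B"]) (auto simp: mem_Times_iff intro: entry_neq_0)

lemma msupp_tns: "msupp A \<subseteq> I \<Longrightarrow> msupp B \<subseteq> J \<Longrightarrow> msupp (tns A B) \<subseteq> I \<times> J"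
  by (auto simp: msupp_subset_iff)

lemma tns_times: "tns A B * tns C D = tns (A * C) (B * D)"
proof (rule fmat_eqI)
  fix x y
  have "entry (tns A B * tns C D) x y =
      (\<Sum>r\<in>msupp A \<times> msupp B. entry (tns A B) x r * entry (tns C D) r y)"
    by (rule entry_times) (simp_all add: msupp_tns)
  then show "entry (tns A B * tns C D) x y = entry (tns (A * C) (B * D)) x y"
    by (simp add: sum.cartesian_product' entry_times0 sum_product ac_simps)
qed

lemma tns_simps:
  "tns (A + A') B = tns A B + tns A' B" "tns A (B + B') = tns A B + tns A B'"
  "tns (A - A') B = tns A B - tns A' B" "tns A (B - B') = tns A B - tns A B'"
  "tns (- A) B = - tns A B" "tns A (- B) = - tns A B"
  "tns (c *\<^sub>R A) B = c *\<^sub>R tns A B" "tns A (c *\<^sub>R B) = c *\<^sub>R tns A B"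
  "tns 0 B = 0" "tns A 0 = 0"
  by (rule fmat_eqI; simp add: algebra_simps)+

lemma tns_sum:
  "tns (\<Sum>i\<in>S. F i) B = (\<Sum>i\<in>S. tns (F i) B)" "tns A (\<Sum>i\<in>S. G i) = (\<Sum>i\<in>S. tns A (G i))"
  by (rule fmat_eqI; simp add: sum_distrib_left sum_distrib_right)+

lemma tp_tns: "tp (tns A B) = tns (tp A) (tp B)"
  by (rule fmat_eqI) simp

definition pull :: "'q set \<Rightarrow> ('q \<Rightarrow> 'p) \<Rightarrow> 'p fmat \<Rightarrow> 'q fmat" where
  "pull J g A = Abs_fmat (\<lambda>x y. if x \<in> J \<and> y \<in> J then entry A (g x) (g y) else 0)"

lemma entry_pull:
  "finite J \<Longrightarrow> entry (pull J g A) x y = (if x \<in> J \<and> y \<in> J then entry A (g x) (g y) else 0)"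
  unfolding pull_def by (rule entry_Abs[of J]) (auto split: if_splits)

lemma msupp_pull: "finite J \<Longrightarrow> msupp (pull J g A) \<subseteq> J"
  by (auto simp: msupp_subset_iff entry_pull split: if_splits)

lemma pull_times:
  assumes "finite J" "bij_betw g J I" "msupp A \<subseteq> I \<or> msupp B \<subseteq> I"
  shows "pull J g (A * B) = pull J g A * pull J g B"
proof (rule fmat_eqI)
  fix x y
  have I: "finite I" using assms(1,2) bij_betw_finite by blast
  have "(\<Sum>r\<in>J. entry A (g x) (g r) * entry B (g r) (g y)) = (\<Sum>r\<in>I. entry A (g x) r * entry B r (g y))"
    by (rule sum.reindex_bij_betw[OF assms(2)])
  then show "entry (pull J g (A * B)) x y = entry (pull J g A * pull J g B) x y"
    by (auto simp add: entry_times[OF assms(1) disjI1[OF msupp_pull[OF assms(1)]]]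
        entry_times[OF I assms(3)] entry_pull assms(1))
qed

lemma pull_simps:
  assumes "finite J"
  shows "pull J g (A + B) = pull J g A + pull J g B" "pull J g (A - B) = pull J g A - pull J g B"
    "pull J g 0 = 0" "tp (pull J g A) = pull J g (tp A)"
  by (rule fmat_eqI; simp add: entry_pull assms)+

lemma pull_dg:
  "finite J \<Longrightarrow> bij_betw g J I \<Longrightarrow> pull J g (dg I f) = dg J (\<lambda>x. f (g x))"
  by (rule fmat_eqI) (auto simp: entry_pull entry_dg bij_betw_finite bij_betw_def inj_on_eq_iff)

section \<open>Complex row vectors and polynomials in one matrix\<close>

definition rv :: "('p \<Rightarrow> complex) \<Rightarrow> 'p fmat \<Rightarrow> 'p \<Rightarrow> complex" where
  "rv v A q = (\<Sum>p\<in>msupp A. v p * of_real (entry A p q))"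

lemma rv_eq: "finite S \<Longrightarrow> msupp A \<subseteq> S \<Longrightarrow> rv v A q = (\<Sum>p\<in>S. v p * of_real (entry A p q))"
  unfolding rv_def by (rule sum.mono_neutral_left) (auto simp: entry_eq_0)

lemma rv_times: "rv v (A * B) = rv (rv v A) B"
proof
  fix q
  let ?S = "msupp A \<union> msupp B"
  have S: "finite ?S" "msupp (A * B) \<subseteq> ?S" by (simp_all add: msupp_times)
  have "rv v (A * B) q = (\<Sum>p\<in>?S. \<Sum>r\<in>?S. v p * of_real (entry A p r) * of_real (entry B r q))"
    unfolding rv_eq[OF S] by (simp add: entry_times[of ?S] sum_distrib_left mult.assoc)
  also have "\<dots> = (\<Sum>r\<in>?S. \<Sum>p\<in>?S. v p * of_real (entry A p r) * of_real (entry B r q))"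
    by (rule sum.swap)
  also have "\<dots> = rv (rv v A) B q"
    by (simp add: rv_eq[of ?S] sum_distrib_right)
  finally show "rv v (A * B) q = rv (rv v A) B q" .
qed

lemma rv_plus: "rv v (A + B) q = rv v A q + rv v B q"
proof -
  have "msupp (A + B) \<subseteq> msupp A \<union> msupp B" by (rule msupp_plus) auto
  then show ?thesis
    by (simp add: rv_eq[of "msupp A \<union> msupp B"] sum.distrib algebra_simps)
qed

lemma rv_scaleR: "rv v (c *\<^sub>R A) q = of_real c * rv v A q"
  by (simp add: rv_eq[of "msupp A"] msupp_scaleR sum_distrib_left algebra_simps)

lemma rv_minus: "rv v (A - B) q = rv v A q - rv v B q"
  using rv_plus[of v A "(- 1) *\<^sub>R B" q] by (simp add: rv_scaleR[of v "- 1", simplified])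

lemma rv_zero [simp]: "rv v 0 q = 0"
  by (simp add: rv_def)

lemma rv_sum: "rv v (\<Sum>i\<in>J. F i) q = (\<Sum>i\<in>J. rv v (F i) q)"
  by (induction J rule: infinite_finite_induct) (auto simp: rv_plus)

lemma rv_vec_scale: "rv (\<lambda>p. c * v p) A q = c * rv v A q"
  by (simp add: rv_def sum_distrib_left mult.assoc)

lemma rv_one_on: "finite I \<Longrightarrow> q \<in> I \<Longrightarrow> rv v (one_on I) q = v q"
  by (simp add: rv_eq[of I] msupp_dg entry_dg if_distrib cong: if_cong)

text \<open>The ring of finitely supported matrices has no unit, so a polynomial in \<open>C\<close> only exists as an
  operator, acting on \<open>B\<close> by right multiplication.\<close>
definition pact :: "'p fmat \<Rightarrow> real poly \<Rightarrow> 'p fmat \<Rightarrow> 'p fmat" where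
  "pact C f B = fold_coeffs (\<lambda>a X. a *\<^sub>R B + X * C) f 0"

lemma pact_0 [simp]: "pact C 0 B = 0"
  by (simp add: pact_def)

lemma pact_pCons [simp]: "pact C (pCons a f) B = a *\<^sub>R B + pact C f B * C"
  by (cases "f = 0"; cases "a = 0") (simp_all add: pact_def)

lemma pact_add: "pact C (f + g) B = pact C f B + pact C g B"
proof (induction f arbitrary: g)
  case (pCons a f)
  show ?case by (cases g) (simp add: pCons.IH, simp add: algebra_simps)
qed simp

lemma pact_smult: "pact C (smult c f) B = c *\<^sub>R pact C f B"
  by (induction f) (simp_all add: algebra_simps)

lemma pact_left: "pact C f (A * B) = A * pact C f B"
  by (induction f) (simp_all add: algebra_simps)

lemma pact_mult: "pact C (f * g) B = pact C f (pact C g B)"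
  by (induction f) (simp_all add: pact_add pact_smult)

lemma pact_diff: "pact C (f - g) B = pact C f B - pact C g B"
  using pact_add[of C f "smult (- 1) g" B] by (simp add: pact_smult[of C "- 1", simplified])

lemma pact_1 [simp]: "pact C 1 B = B"
  by (simp add: one_pCons)

lemma pact_sum: "pact C (\<Sum>i\<in>J. F i) B = (\<Sum>i\<in>J. pact C (F i) B)"
  by (induction J rule: infinite_finite_induct) (auto simp: pact_add)

lemma pact_commutes:
  assumes "B * X = X * B" "C * X = X * C"
  shows "pact C f B * X = X * pact C f B"
proof (induction f)
  case (pCons a f)
  have "pact C f B * C * X = X * (pact C f B * C)"
    by (metis assms(2) mult.assoc pCons.IH)
  then show ?case by (simp add: algebra_simps assms(1))
qed simp

lemma tp_pact:
  assumes "tp B = B" "tp C = C" "B * C = C * B"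
  shows "tp (pact C f B) = pact C f B"
proof (induction f)
  case (pCons a f)
  have "C * pact C f B = pact C f B * C"
    using pact_commutes[of B C C f] assms(3) by simp
  then show ?case by (simp add: tp_times assms pCons)
qed simp

text \<open>A polynomial in \<open>C\<close> scales an eigenvector by its value at the eigenvalue.
  When the polynomial annihilates \<open>B\<close>, the eigenvalue must be one of its roots; this
  confines unknown eigenvalues to a known finite set.\<close>

lemma rv_pact_roots:
  assumes "finite Z" "rv v C = (\<lambda>q. c * v q)" "rv v B = v"
  shows "rv v (pact C (\<Prod>z\<in>Z. [:- z, 1:]) B) = (\<lambda>q. (\<Prod>z\<in>Z. c - of_real z) * v q)"
  using assms(1)
proof (induction Z rule: finite_induct)
  case (insert z Z)
  let ?X = "pact C (\<Prod>z\<in>Z. [:- z, 1:]) B" and ?k = "\<Prod>z\<in>Z. c - of_real z"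
  have "rv v (?X * C) q = ?k * (c * v q)" for q
    by (simp add: rv_times insert.IH rv_vec_scale assms(2))
  then have "rv v (pact C [:- z, 1:] ?X) q = (c - of_real z) * ?k * v q" for q
    by (simp add: rv_plus rv_minus rv_scaleR insert.IH algebra_simps)
  then show ?case
    unfolding prod.insert[OF insert.hyps] pact_mult by (rule ext)
qed (simp add: assms(3))

section \<open>Laurent monomials and alternants\<close>

definition lmono :: "nat \<Rightarrow> (nat \<Rightarrow> complex) \<Rightarrow> (nat \<Rightarrow> int) \<Rightarrow> complex" where
  "lmono N x \<kappa> = (\<Prod>k<N. x k powi \<kappa> k)"

text \<open>Exponents are functions on all naturals; the zeros from N on make distinct exponents
  belong to distinct monomials.\<close>

definition weights :: "nat \<Rightarrow> (nat \<Rightarrow> int) set" where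
  "weights N = {\<kappa>. \<forall>k\<ge>N. \<kappa> k = 0}"

definition perms :: "nat \<Rightarrow> (nat \<Rightarrow> nat) set" where
  "perms N = {p. p permutes {..<N}}"

lemma finite_perms [simp]: "finite (perms N)"
  by (simp add: perms_def finite_permutations)

lemma permsD: "p \<in> perms N \<Longrightarrow> p permutes {..<N}"
  by (simp add: perms_def)

lemma perms_less: "p \<in> perms N \<Longrightarrow> p k < N \<longleftrightarrow> k < N"
  using permutes_in_image[of p "{..<N}" k] by (simp add: perms_def)

lemma id_perms [simp]: "id \<in> perms N"
  by (simp add: perms_def permutes_id)

lemma perms_comp: "p \<in> perms N \<Longrightarrow> q \<in> perms N \<Longrightarrow> p \<circ> q \<in> perms N"
  by (simp add: perms_def permutes_compose)

lemma perms_inv: "p \<in> perms N \<Longrightarrow> inv p \<in> perms N"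
  by (simp add: perms_def permutes_inv)

lemma perms_inverses: "p \<in> perms N \<Longrightarrow> p \<circ> inv p = id" "p \<in> perms N \<Longrightarrow> inv p \<circ> p = id"
  by (simp_all add: perms_def permutes_inv_o)

lemma sign_perms_comp: "p \<in> perms N \<Longrightarrow> q \<in> perms N \<Longrightarrow> sign (p \<circ> q) = sign p * sign q"
  by (rule sign_compose; rule permutes_imp_permutation[of "{..<N}"]) (auto simp: perms_def)

lemma sign_perms_inv: "p \<in> perms N \<Longrightarrow> sign (inv p) = sign p"
  by (rule sign_inverse, rule permutes_imp_permutation[of "{..<N}"]) (auto simp: perms_def)

lemma transpose_perms: "k < N \<Longrightarrow> l < N \<Longrightarrow> Transposition.transpose k l \<in> perms N"
  by (simp add: perms_def permutes_swap_id)

lemma sum_perms: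
  assumes "p \<in> perms N"
  shows "(\<Sum>k<N. f (p k)) = (\<Sum>k<N. f k)"
  using sum.permute[OF permsD[OF assms], of f] by (simp add: o_def)

lemma weights_comp: "\<kappa> \<in> weights N \<Longrightarrow> p \<in> perms N \<Longrightarrow> \<kappa> \<circ> p \<in> weights N"
  by (auto simp: weights_def) (metis perms_less leD leI)

lemma lmono_add:
  assumes "x \<in> torus_reg N"
  shows "lmono N x (\<lambda>k. \<kappa> k + \<kappa>' k) = lmono N x \<kappa> * lmono N x \<kappa>'"
  using assms unfolding lmono_def prod.distrib[symmetric]
  by (intro prod.cong) (auto simp: torus_reg_def power_int_add)

lemma lmono_perm:
  assumes "p \<in> perms N"
  shows "lmono N (x \<circ> p) (\<kappa> \<circ> p) = lmono N x \<kappa>"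
  using prod.permute[OF permsD[OF assms], of "\<lambda>k. x k powi \<kappa> k"] by (simp add: lmono_def o_def)

lemma sum_perms_left:
  assumes "q \<in> perms N"
  shows "(\<Sum>p\<in>perms N. F (q \<circ> p)) = (\<Sum>p\<in>perms N. F p)"
  by (rule sum.reindex_bij_witness[where i = "\<lambda>p. inv q \<circ> p" and j = "\<lambda>p. q \<circ> p"])
    (use assms in \<open>auto simp: perms_comp perms_inv o_assoc perms_inverses\<close>)

lemma sum_perms_right:
  assumes "q \<in> perms N"
  shows "(\<Sum>p\<in>perms N. F (p \<circ> q)) = (\<Sum>p\<in>perms N. F p)"
  by (rule sum.reindex_bij_witness[where i = "\<lambda>p. p \<circ> inv q" and j = "\<lambda>p. p \<circ> q"])
    (use assms in \<open>auto simp: perms_comp perms_inv comp_assoc perms_inverses\<close>)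

lemma sum_perms_inv: "(\<Sum>p\<in>perms N. F (inv p)) = (\<Sum>p\<in>perms N. F p)"
  by (rule sum.reindex_bij_witness[where i = inv and j = inv])
    (auto simp: perms_def permutes_inv permutes_inv_inv)

text \<open>Passing to the inverse permutation moves it from the variables to the exponents and
  keeps the sign, so an alternant becomes a signed sum of monomials.\<close>

lemma alternant_eq: "alternant N e x = (\<Sum>p\<in>perms N. of_int (sign p) * lmono N x (e \<circ> p))"
proof -
  have "alternant N e x = (\<Sum>p\<in>perms N. of_int (sign p) * (\<Prod>j<N. x (p j) powi e j))"
    by (simp add: alternant_def perms_def)
  also have "\<dots> = (\<Sum>p\<in>perms N. of_int (sign (inv p)) * lmono N x (e \<circ> inv p))"
  proof (rule sum.cong)
    fix p assume p: "p \<in> perms N"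
    have "(\<Prod>j<N. x (p j) powi e j) = lmono N (x \<circ> p) ((e \<circ> inv p) \<circ> p)"
      using p by (simp add: lmono_def comp_assoc perms_inverses)
    then show "of_int (sign p) * (\<Prod>j<N. x (p j) powi e j) = of_int (sign (inv p)) * lmono N x (e \<circ> inv p)"
      using p by (simp add: lmono_perm sign_perms_inv)
  qed simp
  also have "\<dots> = (\<Sum>p\<in>perms N. of_int (sign p) * lmono N x (e \<circ> p))"
    by (rule sum_perms_inv)
  finally show ?thesis .
qed

lemma alternant_exp_perm:
  assumes "q \<in> perms N"
  shows "alternant N (e \<circ> q) x = of_int (sign q) * alternant N e x"
proof -
  have "alternant N (e \<circ> q) x = (\<Sum>p\<in>perms N. of_int (sign q) * (of_int (sign (q \<circ> p)) * lmono N x (e \<circ> (q \<circ> p))))"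
    unfolding alternant_eq
  proof (rule sum.cong)
    fix p assume p: "p \<in> perms N"
    then have "sign p = sign q * sign (q \<circ> p)"
      by (simp add: sign_perms_comp[OF assms p] flip: mult.assoc)
    then have "(of_int (sign p) :: complex) = of_int (sign q) * of_int (sign (q \<circ> p))"
      by (metis of_int_mult)
    then show "of_int (sign p) * lmono N x (e \<circ> q \<circ> p) =
        of_int (sign q) * (of_int (sign (q \<circ> p)) * lmono N x (e \<circ> (q \<circ> p)))"
      by (simp add: o_assoc)
  qed simp
  also have "\<dots> = (\<Sum>p\<in>perms N. of_int (sign q) * (of_int (sign p) * lmono N x (e \<circ> p)))"
    by (rule sum_perms_left[OF assms])
  finally show ?thesis by (simp add: alternant_eq sum_distrib_left)
qed

lemma alternant_var_perm:
  assumes "q \<in> perms N"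
  shows "alternant N e (x \<circ> q) = of_int (sign q) * alternant N e x"
proof -
  have "alternant N e (x \<circ> q) = (\<Sum>p\<in>perms N. of_int (sign (p \<circ> q)) * lmono N (x \<circ> q) (e \<circ> (p \<circ> q)))"
    unfolding alternant_eq by (rule sum_perms_right[OF assms, symmetric])
  also have "\<dots> = (\<Sum>p\<in>perms N. of_int (sign q) * (of_int (sign p) * lmono N x (e \<circ> p)))"
    by (rule sum.cong) (auto simp: assms sign_perms_comp o_assoc lmono_perm)
  finally show ?thesis by (simp add: alternant_eq sum_distrib_left)
qed

lemma alternant_exp_repeated:
  assumes "k < N" "l < N" "k \<noteq> l" "e k = e l"
  shows "alternant N e x = 0"
proof -
  have "e \<circ> Transposition.transpose k l = e"
    using assms(4) by (auto simp: fun_eq_iff transpose_def)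
  then have "alternant N e x = - alternant N e x"
    using alternant_exp_perm[OF transpose_perms[OF assms(1,2)], of e x] assms(3)
    by (simp add: sign_swap_id)
  then show ?thesis by simp
qed

lemma alternant_var_repeated:
  assumes "k < N" "l < N" "k \<noteq> l" "x k = x l"
  shows "alternant N e x = 0"
proof -
  have "x \<circ> Transposition.transpose k l = x"
    using assms(4) by (auto simp: fun_eq_iff transpose_def)
  then have "alternant N e x = - alternant N e x"
    using alternant_var_perm[OF transpose_perms[OF assms(1,2)], of e x] assms(3)
    by (simp add: sign_swap_id)
  then show ?thesis by simp
qed

text \<open>A Laurent polynomial is determined by its values on the regular torus: substituting
  \<open>x j = z ^ (t ^ j)\<close> for a sufficiently generic integer \<open>t\<close> separates the exponents.\<close>
lemma laurent_zero:
  assumes S: "finite S" "S \<subseteq> weights N"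
    and zero: "\<And>x. x \<in> torus_reg N \<Longrightarrow> (\<Sum>\<kappa>\<in>S. f \<kappa> * lmono N x \<kappa>) = 0"
    and \<kappa>: "\<kappa> \<in> S"
  shows "f \<kappa> = 0"
proof -
  define q where "q = (\<lambda>\<kappa>::nat \<Rightarrow> int. \<Sum>j<N. monom (\<kappa> j) j)"
  \<comment> \<open>The finitely many integers t at which two distinct exponents of \<open>S\<close>
    would become the same power of z.\<close>
  define R where "R = (\<Union>a\<in>S. \<Union>b\<in>S - {a}. {t. poly (q a - q b) t = 0})"
  have coeff_q: "coeff (q a) j = a j" if "j < N" for a j
    using that by (simp add: q_def coeff_sum if_distrib cong: if_cong)
  have "q a - q b \<noteq> 0" if "a \<in> S" "b \<in> S" "a \<noteq> b" for a b
  proof -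
    have "a \<in> weights N" "b \<in> weights N" using that S(2) by auto
    then have ab: "a = b" if "\<And>j. j < N \<Longrightarrow> a j = b j"
      using that by (intro ext) (metis (mono_tags, lifting) mem_Collect_eq not_less weights_def)
    then obtain j where "j < N" "a j \<noteq> b j" using \<open>a \<noteq> b\<close> by blast
    then have "coeff (q a - q b) j \<noteq> 0" by (simp add: coeff_q)
    then show ?thesis by auto
  qed
  then have "finite R"
    unfolding R_def using S(1) by (intro finite_UN_I poly_roots_finite) auto
  then obtain t where t: "t \<ge> 2" "t \<notin> R"
    using finite_subset[of "{2::int..}" R] infinite_Ici[of "2::int"] by auto
  define T where "T = nat t"
  have T: "T \<ge> 2" "t = int T" using t(1) by (auto simp: T_def)
  define ex where "ex = (\<lambda>a. poly (q a) t)"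
  have ex_eq: "ex a = (\<Sum>j<N. a j * int (T ^ j))" for a
    by (simp add: ex_def q_def poly_sum poly_monom T(2))
  have inj: "a = b" if "a \<in> S" "b \<in> S" "ex a = ex b" for a b
    using that t(2) by (auto simp: R_def ex_def)
  \<comment> \<open>Multiplication by z to the power \<open>K\<close> makes all exponents
    nonnegative, which turns the Laurent sum into an ordinary polynomial.\<close>
  define K where "K = (\<Sum>a\<in>S. \<bar>ex a\<bar>)"
  have K: "ex a + K \<ge> 0" if "a \<in> S" for a
  proof -
    have "\<bar>ex a\<bar> \<le> K" unfolding K_def using S(1) that by (intro member_le_sum) auto
    then show ?thesis by linarith
  qed
  define P where "P = (\<Sum>a\<in>S. monom (f a) (nat (ex a + K)))"
  have "poly P (of_real z) = 0" if z: "z > 1" for z :: real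
  proof -
    define x where "x = (\<lambda>j. (of_real z :: complex) ^ (T ^ j))"
    have xreg: "x \<in> torus_reg N"
    proof -
      have "x i \<noteq> x j" if "i \<noteq> j" for i j
      proof -
        have "T ^ i \<noteq> T ^ j" using T(1) that by (simp add: power_inject_exp)
        then have "z ^ (T ^ i) \<noteq> z ^ (T ^ j)" using z by (simp add: power_inject_exp)
        then show ?thesis unfolding x_def by (metis of_real_eq_iff of_real_power)
      qed
      then show ?thesis using z by (auto simp: torus_reg_def x_def)
    qed
    have m: "lmono N x a = of_real z powi ex a" for a
    proof -
      have "lmono N x a = (\<Prod>j<N. of_real z powi (a j * int (T ^ j)))"
        unfolding lmono_def x_def
      proof (rule prod.cong)
        fix j
        show "((of_real z :: complex) ^ T ^ j) powi a j = of_real z powi (a j * int (T ^ j))"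
          by (metis mult.commute power_int_mult power_int_of_nat)
      qed simp
      also have "\<dots> = of_real z powi (\<Sum>j<N. a j * int (T ^ j))"
      proof (induction N)
        case (Suc N)
        then show ?case using z by (simp add: power_int_add)
      qed simp
      finally show ?thesis by (simp add: ex_eq)
    qed
    have "poly P (of_real z) = (\<Sum>a\<in>S. f a * of_real z powi (ex a + K))"
      unfolding P_def poly_sum poly_monom
      by (intro sum.cong) (auto simp: power_int_def K)
    also have "\<dots> = (\<Sum>a\<in>S. f a * lmono N x a) * of_real z powi K"
      unfolding sum_distrib_right using z by (intro sum.cong) (auto simp: m power_int_add)
    finally show ?thesis using zero[OF xreg] by simp
  qed
  then have "of_real ` {1<..} \<subseteq> {z. poly P z = 0}" by auto
  moreover have "infinite (of_real ` {1::real<..} :: complex set)"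
    using infinite_Ioi by (subst finite_image_iff) (auto simp: inj_on_def)
  ultimately have "P = 0"
    using poly_roots_finite[of P] finite_subset by blast
  then have "0 = coeff P (nat (ex \<kappa> + K))" by simp
  also have "\<dots> = (\<Sum>a\<in>S. if a = \<kappa> then f a else 0)"
    unfolding P_def coeff_sum coeff_monom
  proof (rule sum.cong)
    fix a assume a: "a \<in> S"
    have "nat (ex a + K) = nat (ex \<kappa> + K) \<longleftrightarrow> ex a = ex \<kappa>"
      using K[OF a] K[OF \<kappa>] by (simp add: eq_nat_nat_iff)
    also have "\<dots> \<longleftrightarrow> a = \<kappa>" using inj[OF a \<kappa>] by blast
    finally show "(if nat (ex a + K) = nat (ex \<kappa> + K) then f a else 0) = (if a = \<kappa> then f a else 0)"
      by simp
  qed simp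
  also have "\<dots> = f \<kappa>" using S(1) \<kappa> by simp
  finally show ?thesis by simp
qed

text \<open>Coefficient of one monomial in a sum over an index set \<open>W\<close> along which
  exponents may repeat.\<close>

definition lcoeff :: "'w set \<Rightarrow> ('w \<Rightarrow> nat \<Rightarrow> int) \<Rightarrow> ('w \<Rightarrow> complex) \<Rightarrow> (nat \<Rightarrow> int) \<Rightarrow> complex" where
  "lcoeff W ex c \<kappa> = (\<Sum>w\<in>{w \<in> W. ex w = \<kappa>}. c w)"

lemma lcoeff_expand:
  assumes "finite W" "finite S" "ex ` W \<subseteq> S"
  shows "(\<Sum>w\<in>W. c w * lmono N x (ex w)) = (\<Sum>\<kappa>\<in>S. lcoeff W ex c \<kappa> * lmono N x \<kappa>)"
proof -
  have "(\<Sum>w\<in>W. c w * lmono N x (ex w)) = (\<Sum>\<kappa>\<in>S. \<Sum>w\<in>{w \<in> W. ex w = \<kappa>}. c w * lmono N x (ex w))"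
    using sum.group[OF assms, of "\<lambda>w. c w * lmono N x (ex w)"] by simp
  also have "\<dots> = (\<Sum>\<kappa>\<in>S. lcoeff W ex c \<kappa> * lmono N x \<kappa>)"
    unfolding lcoeff_def sum_distrib_right by (intro sum.cong) auto
  finally show ?thesis .
qed

text \<open>The difference of the two sums is a Laurent polynomial vanishing on the regular torus.
  This is how coefficients of different expansions of one function are compared.\<close>

lemma lcoeff_cong:
  assumes "finite W" "finite W'" "ex ` W \<subseteq> weights N" "ex' ` W' \<subseteq> weights N"
    and "\<And>x. x \<in> torus_reg N \<Longrightarrow>
      (\<Sum>w\<in>W. c w * lmono N x (ex w)) = (\<Sum>w\<in>W'. c' w * lmono N x (ex' w))"
  shows "lcoeff W ex c \<kappa> = lcoeff W' ex' c' \<kappa>"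
proof (cases "\<kappa> \<in> ex ` W \<union> ex' ` W'")
  case True
  have "lcoeff W ex c \<kappa> - lcoeff W' ex' c' \<kappa> = 0"
  proof (rule laurent_zero[OF _ _ _ True, of N])
    fix x assume "x \<in> torus_reg N"
    then show "(\<Sum>\<kappa>\<in>ex ` W \<union> ex' ` W'. (lcoeff W ex c \<kappa> - lcoeff W' ex' c' \<kappa>) * lmono N x \<kappa>) = 0"
      using assms(5)[of x] lcoeff_expand[OF assms(1), of "ex ` W \<union> ex' ` W'" ex c N x]
        lcoeff_expand[OF assms(2), of "ex ` W \<union> ex' ` W'" ex' c' N x] assms(1,2)
      by (simp add: left_diff_distrib sum_subtractf)
  qed (use assms in auto)
  then show ?thesis by simp
next
  case False
  then have "{w \<in> W. ex w = \<kappa>} = {}" "{w \<in> W'. ex' w = \<kappa>} = {}" by auto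
  then show ?thesis by (simp only: lcoeff_def sum.empty)
qed

section \<open>Strictly decreasing exponents and the rearrangement inequality\<close>

definition ip :: "nat \<Rightarrow> (nat \<Rightarrow> int) \<Rightarrow> (nat \<Rightarrow> int) \<Rightarrow> int" where
  "ip N a b = (\<Sum>k<N. a k * b k)"

definition nsq :: "nat \<Rightarrow> (nat \<Rightarrow> int) \<Rightarrow> int" where
  "nsq N a = ip N a a"

definition sdec :: "nat \<Rightarrow> (nat \<Rightarrow> int) \<Rightarrow> bool" where
  "sdec N a \<longleftrightarrow> (\<forall>i j. i < j \<longrightarrow> j < N \<longrightarrow> a j < a i)"

lemma nsq_nonneg: "nsq N a \<ge> 0"
  by (simp add: nsq_def ip_def sum_nonneg)

lemma nsq_eq_0: "nsq N a = 0 \<Longrightarrow> k < N \<Longrightarrow> a k = 0"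
  by (simp add: nsq_def ip_def sum_nonneg_eq_0_iff)

lemma nsq_perm: "p \<in> perms N \<Longrightarrow> nsq N (a \<circ> p) = nsq N a"
  unfolding nsq_def ip_def using sum_perms[of p N "\<lambda>k. a k * a k"] by simp

lemma nsq_add: "nsq N (\<lambda>k. a k + b k) = nsq N a + 2 * ip N a b + nsq N b"
  by (simp add: nsq_def ip_def sum.distrib sum_distrib_left algebra_simps)

lemma ip_commute: "ip N a b = ip N b a"
  by (simp add: ip_def mult.commute)

lemma ip_add: "ip N (\<lambda>k. a k + b k) c = ip N a c + ip N b c"
  by (simp add: ip_def sum.distrib algebra_simps)

lemma ip_diff: "ip N (\<lambda>k. a k - b k) c = ip N a c - ip N b c"
  by (simp add: ip_def sum_subtractf algebra_simps)

lemma ip_add_right: "ip N c (\<lambda>k. a k + b k) = ip N c a + ip N c b"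
  by (simp add: ip_def sum.distrib algebra_simps)

text \<open>Induction on N. If p moves the last index, one transposition puts it back and increases
  the inner product by (a_j - a_n)(b_(p n) - b_n) > 0; what remains permutes the first n
  indices.\<close>

lemma rearrangement:
  assumes "p \<in> perms N" "p \<noteq> id" "sdec N a" "sdec N b"
  shows "ip N a (b \<circ> p) < ip N a b"
  using assms
proof (induction N arbitrary: p)
  case 0
  then show ?case by (auto simp: perms_def)
next
  case (Suc n)
  have sd: "sdec n a" "sdec n b" using Suc.prems by (auto simp: sdec_def)
  have restrict: "q \<in> perms n" if "q \<in> perms (Suc n)" "q n = n" for q
    unfolding perms_def mem_Collect_eq
    by (rule permutes_superset[OF permsD[OF that(1)]]) (use that in \<open>auto simp: less_Suc_eq\<close>)
  have ipS: "ip (Suc n) a f = ip n a f + a n * f n" for f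
    by (simp add: ip_def)
  have fixed: "ip (Suc n) a (b \<circ> q) \<le> ip (Suc n) a b" if "q \<in> perms (Suc n)" "q n = n" for q
  proof (cases "q = id")
    case False
    then show ?thesis using Suc.IH[OF restrict[OF that] False sd] that(2) by (simp add: ipS o_def)
  qed simp
  show ?case
  proof (cases "p n = n")
    case True
    then show ?thesis
      using Suc.IH[OF restrict[OF Suc.prems(1) True] Suc.prems(2) sd] by (simp add: ipS)
  next
    case False
    define j where "j = inv p n"
    have bij: "bij p" using Suc.prems(1) permsD permutes_bij by blast
    have pj: "p j = n" unfolding j_def using bij by (simp add: bij_is_surj surj_f_inv_f)
    have jn: "j < n" using False pj perms_less[OF Suc.prems(1), of j] by (auto simp: less_Suc_eq)
    have pn: "p n < n" using False perms_less[OF Suc.prems(1), of n] by auto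
    define q where "q = p \<circ> Transposition.transpose j n"
    have q: "q \<in> perms (Suc n)" "q n = n" "q j = p n" "\<And>i. i \<noteq> j \<Longrightarrow> i \<noteq> n \<Longrightarrow> q i = p i"
      using jn pj by (auto simp: q_def perms_comp Suc.prems(1) transpose_perms transpose_def)
    have "ip (Suc n) a (b \<circ> q) - ip (Suc n) a (b \<circ> p) = (\<Sum>k\<in>{..<Suc n}. a k * (b (q k) - b (p k)))"
      by (simp add: ip_def sum_subtractf algebra_simps)
    also have "\<dots> = (\<Sum>k\<in>{j, n}. a k * (b (q k) - b (p k)))"
      by (rule sum.mono_neutral_right) (use jn q in auto)
    also have "\<dots> = (a j - a n) * (b (p n) - b n)"
      using jn q pj by (simp add: algebra_simps)
    also have "\<dots> > 0"
      using jn pn Suc.prems by (auto simp: sdec_def)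
    finally show ?thesis using fixed[OF q(1,2)] by linarith
  qed
qed

lemma rearrangement_le:
  "p \<in> perms N \<Longrightarrow> sdec N a \<Longrightarrow> sdec N b \<Longrightarrow> ip N a (b \<circ> p) \<le> ip N a b"
  by (cases "p = id") (auto dest: rearrangement)

text \<open>Otherwise rearrangement gives |b|^2 < <b, a> although |a| = |b|, and |a - b|^2 would be
  negative.\<close>

lemma sdec_perm_unique:
  assumes "p \<in> perms N" "sdec N a" "sdec N b" "a \<circ> p = b"
  shows "p = id"
proof (rule ccontr)
  assume "p \<noteq> id"
  then have "nsq N b < ip N b a"
    using rearrangement[OF assms(1) _ assms(3,2)] assms(4) by (simp add: nsq_def)
  moreover have "nsq N b = nsq N a" using nsq_perm[OF assms(1), of a] assms(4) by simp
  moreover have "nsq N (\<lambda>k. a k - b k) = nsq N a - 2 * ip N b a + nsq N b"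
    by (simp add: nsq_def ip_def sum_subtractf sum.distrib sum_distrib_left algebra_simps)
  ultimately show False using nsq_nonneg[of N "\<lambda>k. a k - b k"] by linarith
qed

text \<open>A permutation that maximises the pairing with the decreasing sequence -k sorts
  \<open>a\<close>: any remaining ascent could be exchanged for a larger value.\<close>

lemma exists_sorting_perm:
  assumes "inj_on a {..<N}"
  shows "\<exists>p\<in>perms N. sdec N (a \<circ> p)"
proof -
  define f where "f = (\<lambda>p. ip N (a \<circ> p) (\<lambda>k. - int k))"
  have "Max (f ` perms N) \<in> f ` perms N"
    using id_perms[of N] by (intro Max_in, simp) blast
  then obtain p where p: "p \<in> perms N" "f p = Max (f ` perms N)" by force
  then have max: "f q \<le> f p" if "q \<in> perms N" for q
    using that by simp
  have "(a \<circ> p) j < (a \<circ> p) i" if "i < j" "j < N" for i j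
  proof (rule ccontr)
    assume "\<not> ?thesis"
    moreover have "a (p i) \<noteq> a (p j)"
    proof -
      have "inj p" using p(1) permsD permutes_inj by blast
      then have "p i \<noteq> p j" using that(1) by (auto dest: injD)
      moreover have "p i \<in> {..<N}" "p j \<in> {..<N}"
        using that perms_less[OF p(1)] by simp_all
      ultimately show ?thesis using assms inj_onD by metis
    qed
    ultimately have less: "a (p i) < a (p j)" by simp
    let ?q = "p \<circ> Transposition.transpose i j"
    have q: "?q \<in> perms N" using p(1) that by (simp add: perms_comp transpose_perms)
    have "f ?q - f p = (\<Sum>k<N. (a (?q k) - a (p k)) * (- int k))"
      by (simp add: f_def ip_def sum_subtractf[symmetric] algebra_simps)
    also have "\<dots> = (\<Sum>k\<in>{i, j}. (a (?q k) - a (p k)) * (- int k))"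
      by (rule sum.mono_neutral_right) (use that in \<open>auto simp: transpose_def\<close>)
    also have "\<dots> = (a (p j) - a (p i)) * (int j - int i)"
      using that by (simp add: algebra_simps)
    also have "\<dots> > 0" using less that by simp
    finally show False using max[OF q] by simp
  qed
  then show ?thesis using p by (auto simp: sdec_def)
qed

text \<open>A strictly decreasing exponent occurs exactly once among all the monomials involved,
  namely as the identity term of its own alternant.\<close>

lemma alternants_independent:
  assumes D: "finite D" "D \<subseteq> weights N" "\<And>\<kappa>. \<kappa> \<in> D \<Longrightarrow> sdec N \<kappa>"
    and zero: "\<And>x. x \<in> torus_reg N \<Longrightarrow> (\<Sum>\<kappa>\<in>D. f \<kappa> * alternant N \<kappa> x) = 0"
    and \<kappa>: "\<kappa> \<in> D"
  shows "f \<kappa> = 0"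
proof -
  let ?W = "D \<times> perms N" and ?ex = "\<lambda>(a, p). a \<circ> p" and ?c = "\<lambda>(a, p). f a * of_int (sign p)"
  have "lcoeff ?W ?ex ?c \<kappa> = lcoeff {} ?ex ?c \<kappa>"
  proof (rule lcoeff_cong)
    fix x assume "x \<in> torus_reg N"
    from zero[OF this] have "(\<Sum>w\<in>?W. ?c w * lmono N x (?ex w)) = 0"
      by (simp add: alternant_eq sum_distrib_left sum.cartesian_product' mult.assoc)
    then show "(\<Sum>w\<in>?W. ?c w * lmono N x (?ex w)) = (\<Sum>w\<in>{}. ?c w * lmono N x (?ex w))"
      by simp
  qed (use D in \<open>auto simp: weights_comp subset_iff\<close>)
  moreover have "{w \<in> ?W. ?ex w = \<kappa>} = {(\<kappa>, id)}"
  proof -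
    have "a = \<kappa> \<and> p = id" if "a \<in> D" "p \<in> perms N" "a \<circ> p = \<kappa>" for a p
      using sdec_perm_unique[OF that(2) D(3)[OF that(1)] D(3)[OF \<kappa>] that(3)] that(3) by simp
    then show ?thesis using \<kappa> by auto
  qed
  ultimately show ?thesis by (simp add: lcoeff_def)
qed

section \<open>The Weyl denominator\<close>

text \<open>The half sum of the positive roots of gl(N), shifted by (N-1)/2 in each coordinate so as
  to be integral and end in 0. Truncated subtraction makes it vanish from N on.\<close>

definition dl :: "nat \<Rightarrow> nat \<Rightarrow> int" where
  "dl N = (\<lambda>j. int (N - 1 - j))"

lemma dl_weights [simp]: "dl N \<in> weights N"
  by (simp add: dl_def weights_def)

lemma sdec_dl [simp]: "sdec N (dl N)"
  by (auto simp: sdec_def dl_def)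

lemma lmono_cong: "(\<And>k. k < N \<Longrightarrow> x k = y k) \<Longrightarrow> (\<And>k. k < N \<Longrightarrow> a k = b k) \<Longrightarrow> lmono N x a = lmono N y b"
  by (simp add: lmono_def)

lemma alternant_cong:
  "(\<And>k. k < N \<Longrightarrow> x k = y k) \<Longrightarrow> (\<And>k. k < N \<Longrightarrow> a k = b k) \<Longrightarrow> alternant N a x = alternant N b y"
  unfolding alternant_eq
  by (intro sum.cong refl arg_cong2[of _ _ _ _ "(*)"] lmono_cong) (auto simp: perms_less)

lemma lmono_upd:
  assumes "k < N"
  shows "lmono N (x(k := y)) \<kappa> = y powi \<kappa> k * (\<Prod>l\<in>{..<N} - {k}. x l powi \<kappa> l)"
proof -
  have "lmono N (x(k := y)) \<kappa> = y powi \<kappa> k * (\<Prod>l\<in>{..<N} - {k}. (x(k := y)) l powi \<kappa> l)"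
    unfolding lmono_def using assms by (subst prod.remove[of _ k]) auto
  also have "(\<Prod>l\<in>{..<N} - {k}. (x(k := y)) l powi \<kappa> l) = (\<Prod>l\<in>{..<N} - {k}. x l powi \<kappa> l)"
    by (rule prod.cong) auto
  finally show ?thesis .
qed

text \<open>The Weyl denominator as a polynomial in the k-th variable alone. Its degree is below N
  and it vanishes at the other N - 1 coordinates, so it is determined up to a constant.\<close>

definition den_poly :: "nat \<Rightarrow> nat \<Rightarrow> (nat \<Rightarrow> complex) \<Rightarrow> complex poly" where
  "den_poly N k x = (\<Sum>p\<in>perms N. monom (of_int (sign p) * (\<Prod>l\<in>{..<N} - {k}. x l powi dl N (p l))) (N - 1 - p k))"

lemma poly_den_poly:
  assumes "k < N"
  shows "poly (den_poly N k x) y = alternant N (dl N) (x(k := y))"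
  unfolding den_poly_def poly_sum poly_monom alternant_eq lmono_upd[OF assms]
  by (rule sum.cong) (auto simp: dl_def)

text \<open>The Euler operator y d/dy multiplies each monomial by its exponent in the k-th
  variable.\<close>

lemma poly_pderiv_den_poly:
  assumes "k < N"
  shows "y * poly (pderiv (den_poly N k x)) y =
    (\<Sum>p\<in>perms N. of_int (sign p) * of_int (dl N (p k)) * lmono N (x(k := y)) (dl N \<circ> p))"
proof -
  have m: "y * poly (pderiv (monom c n)) y = of_nat n * (c * y ^ n)" for c y :: complex and n
    by (cases n) (auto simp: pderiv_monom poly_monom algebra_simps)
  have "pderiv (den_poly N k x) = (\<Sum>p\<in>perms N. pderiv
      (monom (of_int (sign p) * (\<Prod>l\<in>{..<N} - {k}. x l powi dl N (p l))) (N - 1 - p k)))"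
    unfolding den_poly_def by (simp only: higher_pderiv_sum[of 1, simplified])
  then show ?thesis
    unfolding lmono_upd[OF assms]
    by (simp add: poly_sum sum_distrib_left m dl_def) (rule sum.cong; simp)
qed

lemma degree_den_poly:
  assumes "k < N"
  shows "degree (den_poly N k x) < N"
proof -
  have "degree (den_poly N k x) \<le> N - 1"
    unfolding den_poly_def by (intro degree_sum_le) (auto intro: order_trans[OF degree_monom_le])
  then show ?thesis using assms by linarith
qed

lemma torus_reg_inj: "x \<in> torus_reg N \<Longrightarrow> inj_on x {..<N}"
  by (auto simp: torus_reg_def inj_on_def)

lemma den_poly_root:
  assumes "k < N" "l < N" "k \<noteq> l"
  shows "poly (den_poly N k x) (x l) = 0"
  unfolding poly_den_poly[OF assms(1)] by (rule alternant_var_repeated[OF assms]) (use assms(3) in simp)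

text \<open>As a polynomial in x_k the denominator is a constant times the product of the factors X
  - x_l; the right side is the logarithmic derivative of that product.\<close>

lemma log_derivative_den:
  assumes x: "x \<in> torus_reg N" and k: "k < N"
  shows "(\<Sum>p\<in>perms N. of_int (sign p) * of_int (dl N (p k)) * lmono N x (dl N \<circ> p)) =
    alternant N (dl N) x * (\<Sum>l\<in>{..<N} - {k}. x k / (x k - x l))"
proof -
  define L where "L = {..<N} - {k}"
  define Q where "Q = (\<Prod>l\<in>L. [:- x l, 1:])"
  define g where "g = den_poly N k x"
  define c where "c = poly g (x k) / poly Q (x k)"
  have ne: "x k - x l \<noteq> 0" if "l \<in> L" for l
    using x k that by (auto simp: torus_reg_def L_def)
  have Qk: "poly Q (x k) = (\<Prod>l\<in>L. x k - x l)" by (simp add: Q_def poly_prod)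
  then have Q0: "poly Q (x k) \<noteq> 0" using ne by (simp add: L_def)
  have card: "card (x ` {..<N}) = N"
    using torus_reg_inj[OF x] by (simp add: card_image)
  have "degree Q \<le> (\<Sum>l\<in>L. degree [:- x l, 1:])"
    unfolding Q_def by (rule order_trans[OF degree_prod_sum_le]) (auto simp: L_def)
  also have "\<dots> = N - 1" using k by (simp add: L_def)
  finally have degQ: "degree Q < N" using k by linarith
  \<comment> \<open>Both polynomials have degree below N and agree at the N distinct coordinates of
    x; \<open>c\<close> is chosen to give agreement at \<open>x k\<close>.\<close>
  have "g = smult c Q"
  proof (rule poly_eqI_degree[of "x ` {..<N}"])
    fix y assume "y \<in> x ` {..<N}"
    then obtain l where l: "l < N" "y = x l" by blast
    show "poly g y = poly (smult c Q) y"
    proof (cases "l = k")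
      case True
      then show ?thesis using Q0 l by (simp add: c_def)
    next
      case False
      then have "poly Q (x l) = 0" using l by (auto simp: Q_def poly_prod L_def intro!: prod_zero)
      then show ?thesis using den_poly_root[OF k l(1)] False l by (simp add: g_def)
    qed
  qed (use card degQ degree_den_poly[OF k] in \<open>auto simp: g_def intro: le_less_trans[OF degree_smult_le]\<close>)
  then have "poly (pderiv g) (x k) = c * (\<Sum>l\<in>L. \<Prod>j\<in>L - {l}. x k - x j)"
    by (simp add: pderiv_smult Q_def pderiv_prod poly_sum poly_prod pderiv_pCons)
  also have "(\<Sum>l\<in>L. \<Prod>j\<in>L - {l}. x k - x j) = (\<Sum>l\<in>L. poly Q (x k) / (x k - x l))"
  proof (rule sum.cong)
    fix l assume l: "l \<in> L"
    have "poly Q (x k) = (x k - x l) * (\<Prod>j\<in>L - {l}. x k - x j)"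
      unfolding Qk using l by (intro prod.remove) (auto simp: L_def)
    then show "(\<Prod>j\<in>L - {l}. x k - x j) = poly Q (x k) / (x k - x l)"
      using ne[OF l] by simp
  qed simp
  finally have "x k * poly (pderiv g) (x k) = c * poly Q (x k) * (\<Sum>l\<in>L. x k / (x k - x l))"
    by (simp add: sum_distrib_left algebra_simps)
  moreover have "c * poly Q (x k) = alternant N (dl N) x"
    using Q0 poly_den_poly[OF k, of x "x k"] by (simp add: c_def g_def)
  ultimately show ?thesis
    using poly_pderiv_den_poly[OF k, of "x k" x] by (simp add: g_def L_def)
qed

text \<open>With \<open>x k\<close> as a further root, \<open>den_poly\<close> has N distinct roots
  but degree below N, so it is zero.\<close>

lemma den_vanish_upd:
  assumes x: "x \<in> torus_reg N" and k: "k < N" and "alternant N (dl N) x = 0"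
  shows "alternant N (dl N) (x(k := y)) = 0"
proof -
  have "den_poly N k x = 0"
  proof (rule poly_eqI_degree[of "x ` {..<N}"])
    fix y assume "y \<in> x ` {..<N}"
    then obtain l where l: "l < N" "y = x l" by blast
    show "poly (den_poly N k x) y = poly 0 y"
      using l den_poly_root[OF k l(1), of x] poly_den_poly[OF k, of x "x k"] assms(3) by (cases "l = k") auto
  qed (use torus_reg_inj[OF x] degree_den_poly[OF k] k in \<open>auto simp: card_image\<close>)
  then show ?thesis using poly_den_poly[OF k, of x y] by simp
qed

text \<open>The coordinates of x are replaced one at a time by those of z; disjointness keeps every
  intermediate point regular.\<close>

lemma den_vanish_disjoint:
  assumes x: "x \<in> torus_reg N" and z: "z \<in> torus_reg N" and dis: "\<And>i j. i < N \<Longrightarrow> j < N \<Longrightarrow> z i \<noteq> x j"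
    and 0: "alternant N (dl N) x = 0"
  shows "alternant N (dl N) z = 0"
proof -
  define h where "h = (\<lambda>m i. if i < m then z i else x i)"
  have reg: "h m \<in> torus_reg N" for m
  proof -
    have "x j \<noteq> z i" if "i < N" "j < N" for i j using dis[OF that] by metis
    then show ?thesis using x z dis by (auto simp: torus_reg_def h_def)
  qed
  have "alternant N (dl N) (h m) = 0" if "m \<le> N" for m
    using that
  proof (induction m)
    case 0
    then show ?case using assms(4) by (simp add: h_def)
  next
    case (Suc m)
    have "h (Suc m) = (h m)(m := z m)" by (auto simp: h_def fun_eq_iff less_Suc_eq)
    then show ?case using den_vanish_upd[OF reg, of m m "z m"] Suc by (simp only: Suc_le_eq less_imp_le)
  qed
  from this[of N] show ?thesis
    using alternant_cong[of N "h N" z "dl N" "dl N"] by (simp add: h_def)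
qed

text \<open>A single zero on the regular torus would spread to every regular point, by way of a
  point disjoint from both, and contradict the independence of alternants.\<close>

lemma alternant_dl_nz:
  assumes x: "x \<in> torus_reg N"
  shows "alternant N (dl N) x \<noteq> 0"
proof
  assume 0: "alternant N (dl N) x = 0"
  have "alternant N (dl N) w = 0" if w: "w \<in> torus_reg N" for w
  proof -
    \<comment> \<open>\<open>M\<close> bounds the moduli of all coordinates of x and w, so the
      coordinates of z below have strictly larger modulus and meet neither.\<close>
    define M where "M = (\<Sum>i<N. norm (x i) + norm (w i))"
    define z where "z = (\<lambda>j. complex_of_real (M + real j + 1))"
    have M: "norm (x i) + norm (w i) \<le> M" if "i < N" for i
      unfolding M_def using that by (intro member_le_sum) auto
    have M0: "M \<ge> 0" by (simp add: M_def sum_nonneg)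
    have nz: "norm (z j) = M + real j + 1" for j
      unfolding z_def norm_of_real using M0 by simp
    have less: "norm (x i) < norm (z j)" "norm (w i) < norm (z j)" if "i < N" for i j
      using M[OF that] norm_ge_zero[of "x i"] norm_ge_zero[of "w i"] unfolding nz by linarith+
    have dis: "z j \<noteq> x i" "w i \<noteq> z j" if "i < N" for i j using less[OF that, of j] by auto
    have "z j \<noteq> 0" for j using nz[of j] M0 by auto
    moreover have "z i \<noteq> z j" if "i \<noteq> j" for i j using that by (simp add: z_def)
    ultimately have zreg: "z \<in> torus_reg N" by (simp add: torus_reg_def)
    show ?thesis
      by (rule den_vanish_disjoint[OF zreg w dis(2) den_vanish_disjoint[OF x zreg dis(1) 0]])
  qed
  then have "(1 :: complex) = 0"
    using alternants_independent[of "{dl N}" N "\<lambda>_. 1" "dl N"] by simp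
  then show False by simp
qed

section \<open>Representations of the general linear Lie algebra by matrices\<close>

text \<open>\<open>E i j\<close> is the matrix of the elementary matrix \<open>e\<^sub>i\<^sub>j\<close> in an orthonormal weight basis
  indexed by \<open>I\<close>; transposition is the contravariant form.\<close>
locale glrep =
  fixes N :: nat and I :: "'p set" and E :: "nat \<Rightarrow> nat \<Rightarrow> 'p fmat" and wt :: "'p \<Rightarrow> nat \<Rightarrow> int"
  assumes finI: "finite I"
    and wt_weights: "p \<in> I \<Longrightarrow> wt p \<in> weights N"
    and msupp_E: "i < N \<Longrightarrow> j < N \<Longrightarrow> msupp (E i j) \<subseteq> I"
    and E_diag: "i < N \<Longrightarrow> E i i = dg I (\<lambda>p. of_int (wt p i))"
    and tp_E: "i < N \<Longrightarrow> j < N \<Longrightarrow> tp (E i j) = E j i"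
    and comm_E: "i < N \<Longrightarrow> j < N \<Longrightarrow> k < N \<Longrightarrow> l < N \<Longrightarrow>
      E i j * E k l - E k l * E i j = (if j = k then E i l else 0) - (if i = l then E k j else 0)"

text \<open>The quadratic Casimir element plus a multiple of the central element. The linear term
  turns the half sum of the positive roots into \<open>dl\<close> in the eigenvalue |\<lambda> +
  \<delta>|^2 - |\<delta>|^2.\<close>

definition casimir :: "nat \<Rightarrow> (nat \<Rightarrow> nat \<Rightarrow> 'p fmat) \<Rightarrow> 'p fmat" where
  "casimir N E = (\<Sum>i<N. \<Sum>j<N. E i j * E j i) + real (N - 1) *\<^sub>R (\<Sum>i<N. E i i)"

text \<open>Trace of \<open>B\<close> times the torus element x, which is diagonal in the weight
  basis; for a projection it is the character of the image.\<close>

definition ch :: "nat \<Rightarrow> 'p set \<Rightarrow> ('p \<Rightarrow> nat \<Rightarrow> int) \<Rightarrow> 'p fmat \<Rightarrow> (nat \<Rightarrow> complex) \<Rightarrow> complex" where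
  "ch N I wt B x = (\<Sum>p\<in>I. of_real (entry B p p) * lmono N x (wt p))"

definition eps :: "nat \<Rightarrow> nat \<Rightarrow> int" where
  "eps k = (\<lambda>j. if j = k then 1 else 0)"

lemma lmono_eps: "k < N \<Longrightarrow> lmono N x (eps k) = x k"
  by (simp add: lmono_def eps_def if_distrib cong: if_cong)

lemma lmono_minus: "lmono N x (\<lambda>k. - a k) = inverse (lmono N x a)"
  by (simp add: lmono_def power_int_minus prod_inversef[symmetric] o_def)

context glrep
begin

abbreviation "Cas \<equiv> casimir N E"

lemma msupp_Cas: "msupp Cas \<subseteq> I"
  unfolding casimir_def
  by (intro msupp_plus msupp_sum msupp_times order_trans[OF msupp_scaleR] msupp_E) auto

lemma tp_Cas: "tp Cas = Cas"
  by (simp add: casimir_def tp_times tp_E)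

text \<open>Since \<open>E k k\<close> is diagonal, its commutator with \<open>E i j\<close>
  multiplies each entry by the difference of two weights; the commutation relations give the same
  factor.\<close>

lemma wt_shift:
  assumes "i < N" "j < N" "entry (E i j) p q \<noteq> 0"
  shows "wt p = (\<lambda>k. wt q k + eps i k - eps j k)"
proof
  fix k
  have pq: "p \<in> I" "q \<in> I" using entry_neq_0[OF assms(3)] msupp_E[OF assms(1,2)] by blast+
  show "wt p k = wt q k + eps i k - eps j k"
  proof (cases "k < N")
    case False
    then show ?thesis
      using assms(1,2) wt_weights[OF pq(1)] wt_weights[OF pq(2)] by (auto simp: weights_def eps_def)
  next
    case True
    have "entry (E k k * E i j - E i j * E k k) p q = (of_int (wt p k) - of_int (wt q k)) * entry (E i j) p q"
      using pq finI by (simp add: E_diag[OF True] entry_dg_times entry_times_dg algebra_simps)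
    moreover have "entry (E k k * E i j - E i j * E k k) p q = of_int (eps i k - eps j k) * entry (E i j) p q"
      unfolding comm_E[OF True True assms(1,2)] by (auto simp: eps_def)
    ultimately have "real_of_int (wt p k) - of_int (wt q k) = of_int (eps i k - eps j k)"
      using assms(3) by simp
    then have "real_of_int (wt p k) = real_of_int (wt q k + eps i k - eps j k)" by simp
    then show ?thesis by (simp only: of_int_eq_iff)
  qed
qed

definition invariant :: "'p fmat \<Rightarrow> bool" where
  "invariant B \<longleftrightarrow> msupp B \<subseteq> I \<and> (\<forall>i<N. \<forall>j<N. B * E i j = E i j * B)"

text \<open>The commutator is a derivation, so each product yields four terms with Kronecker deltas,
  which cancel in pairs after summation over i and j.\<close>

lemma Cas_commutes:
  assumes "k < N" "l < N"
  shows "Cas * E k l = E k l * Cas"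
proof -
  let ?X = "E k l"
  have 1: "E i j * E j i * ?X - ?X * (E i j * E j i) =
      (if i = k then E k j * E j l else 0) - (if j = l then E i l * E k i else 0)
      + (if j = k then E i l * E k i else 0) - (if i = l then E k j * E j l else 0)"
    if "i < N" "j < N" for i j
  proof -
    have "E i j * E j i * ?X - ?X * (E i j * E j i) =
        E i j * (E j i * ?X - ?X * E j i) + (E i j * ?X - ?X * E i j) * E j i"
      by (simp add: algebra_simps)
    then show ?thesis
      unfolding comm_E[OF that assms] comm_E[OF that(2,1) assms]
      by (auto simp: left_diff_distrib right_diff_distrib)
  qed
  have "(\<Sum>i<N. \<Sum>j<N. E i j * E j i) * ?X - ?X * (\<Sum>i<N. \<Sum>j<N. E i j * E j i) =
      (\<Sum>i<N. \<Sum>j<N. E i j * E j i * ?X - ?X * (E i j * E j i))"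
    by (simp add: sum_distrib_left sum_distrib_right sum_subtractf)
  also have "\<dots> = (\<Sum>i<N. \<Sum>j<N. (if i = k then E k j * E j l else 0)) - (\<Sum>i<N. \<Sum>j<N. (if j = l then E i l * E k i else 0))
      + (\<Sum>i<N. \<Sum>j<N. (if j = k then E i l * E k i else 0)) - (\<Sum>i<N. \<Sum>j<N. (if i = l then E k j * E j l else 0))"
    by (simp add: 1 sum.distrib sum_subtractf)
  also have "\<dots> = 0"
  proof -
    have row: "(\<Sum>i<N. \<Sum>j<N. if i = m then G j else 0) = (\<Sum>j<N. G j)"
      if "m < N" for m and G :: "nat \<Rightarrow> 'p fmat"
    proof -
      have "(\<Sum>j<N. if i = m then G j else 0) = (if i = m then \<Sum>j<N. G j else 0)" for i by simp
      then show ?thesis using that by simp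
    qed
    show ?thesis using assms by (simp add: row)
  qed
  finally have "(\<Sum>i<N. \<Sum>j<N. E i j * E j i) * ?X = ?X * (\<Sum>i<N. \<Sum>j<N. E i j * E j i)"
    by simp
  moreover have "(\<Sum>i<N. E i i) * ?X = ?X * (\<Sum>i<N. E i i)"
  proof -
    have "(\<Sum>i<N. E i i) * ?X - ?X * (\<Sum>i<N. E i i) = (\<Sum>i<N. (if i = k then E i l else 0) - (if i = l then E k i else 0))"
      using assms by (simp add: sum_distrib_left sum_distrib_right sum_subtractf[symmetric] comm_E)
    also have "\<dots> = 0" using assms by (simp add: sum_subtractf)
    finally show ?thesis by simp
  qed
  ultimately show ?thesis by (simp add: casimir_def algebra_simps)
qed

lemma invariant_commutes_Cas:
  assumes "invariant B"
  shows "B * Cas = Cas * B"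
proof -
  have c: "B * E i j = E i j * B" if "i < N" "j < N" for i j
    using assms that by (simp add: invariant_def)
  have "B * (E i j * E j i) = E i j * E j i * B" if "i < N" "j < N" for i j
  proof -
    have "B * (E i j * E j i) = E i j * (B * E j i)"
      by (simp only: mult.assoc[symmetric] c[OF that])
    then show ?thesis by (simp only: c[OF that(2,1)] mult.assoc)
  qed
  then have "B * (\<Sum>i<N. \<Sum>j<N. E i j * E j i) = (\<Sum>i<N. \<Sum>j<N. E i j * E j i) * B"
    unfolding sum_distrib_left sum_distrib_right by (intro sum.cong refl) simp
  moreover have "B * (\<Sum>i<N. E i i) = (\<Sum>i<N. E i i) * B"
    unfolding sum_distrib_left sum_distrib_right by (intro sum.cong refl) (simp add: c)
  ultimately show ?thesis by (simp add: casimir_def distrib_left distrib_right)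
qed

lemma invariant_times_Cas: "invariant B \<Longrightarrow> invariant (B * Cas)"
  unfolding invariant_def
proof (intro conjI allI impI; elim conjE)
  fix i j assume "\<forall>i<N. \<forall>j<N. B * E i j = E i j * B" and ij: "i < N" "j < N"
  then have "B * E i j = E i j * B" by blast
  then show "B * Cas * E i j = E i j * (B * Cas)"
    by (simp only: mult.assoc Cas_commutes[OF ij]) (simp only: mult.assoc[symmetric])
qed (intro msupp_times msupp_Cas)

text \<open>Cyclicity of the trace, twisted by the torus element \<open>x\<close>.\<close>
lemma ch_cyclic:
  assumes x: "x \<in> torus_reg N" and ij: "i < N" "j < N" and X: "msupp X \<subseteq> I"
  shows "ch N I wt (E i j * X) x * x j = x i * ch N I wt (X * E i j) x"
proof -
  have nz: "x i \<noteq> 0" "x j \<noteq> 0" using x ij by (auto simp: torus_reg_def)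
  have m: "entry (E i j) p q * lmono N x (wt p) * x j = entry (E i j) p q * lmono N x (wt q) * x i" for p q
  proof (cases "entry (E i j) p q = 0")
    case False
    have "lmono N x (wt p) = lmono N x (\<lambda>k. wt q k + (eps i k + - eps j k))"
      using wt_shift[OF ij False] by (simp add: add_diff_eq)
    also have "\<dots> = lmono N x (wt q) * (x i * inverse (x j))"
      using lmono_add[OF x, of "wt q" "\<lambda>k. eps i k + - eps j k"] lmono_add[OF x, of "eps i" "\<lambda>k. - eps j k"]
      by (simp add: lmono_minus lmono_eps ij)
    finally show ?thesis using nz by simp
  qed simp
  have "ch N I wt (E i j * X) x * x j =
      (\<Sum>p\<in>I. \<Sum>q\<in>I. of_real (entry X q p) * (entry (E i j) p q * lmono N x (wt p) * x j))"
    by (simp add: ch_def entry_times[OF finI] X sum_distrib_left sum_distrib_right ac_simps)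
  also have "\<dots> = (\<Sum>q\<in>I. \<Sum>p\<in>I. of_real (entry X q p) * (entry (E i j) p q * lmono N x (wt q) * x i))"
    unfolding m by (rule sum.swap)
  also have "\<dots> = x i * ch N I wt (X * E i j) x"
    by (simp add: ch_def entry_times[OF finI] X sum_distrib_left sum_distrib_right ac_simps)
  finally show ?thesis .
qed

lemma ch_plus: "ch N I wt (A + B) x = ch N I wt A x + ch N I wt B x"
  by (simp add: ch_def sum.distrib algebra_simps)

lemma ch_minus: "ch N I wt (A - B) x = ch N I wt A x - ch N I wt B x"
  by (simp add: ch_def sum_subtractf algebra_simps)

lemma ch_scaleR: "ch N I wt (c *\<^sub>R A) x = of_real c * ch N I wt A x"
  by (simp add: ch_def sum_distrib_left mult.assoc)

lemma ch_sum: "ch N I wt (\<Sum>i\<in>J. F i) x = (\<Sum>i\<in>J. ch N I wt (F i) x)"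
  by (induction J rule: infinite_finite_induct) (auto simp: ch_plus, simp_all add: ch_def)

text \<open>The radial part of the Casimir operator: multiplied by the Weyl denominator, the character of
  an invariant operator becomes a function on which the Casimir acts as a Laplacian.\<close>
lemma ch_times_Cas:
  assumes x: "x \<in> torus_reg N" and B: "invariant B"
  shows "alternant N (dl N) x * ch N I wt (B * Cas) x =
    (\<Sum>(s, p)\<in>perms N \<times> I. of_int (sign s) * of_real (entry B p p) *
       of_int (nsq N (\<lambda>k. dl N (s k) + wt p k) - nsq N (dl N)) * lmono N x (\<lambda>k. dl N (s k) + wt p k))"
proof -
  let ?a = "alternant N (dl N) x"
  let ?S = "\<lambda>F. \<Sum>(s, p)\<in>perms N \<times> I. of_int (sign s) * of_real (entry B p p) *
    of_int (F s p) * lmono N x (\<lambda>k. dl N (s k) + wt p k)"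
  define D where "D = (\<lambda>k. ch N I wt (B * E k k) x)"
  define T where "T = (\<lambda>k l. ch N I wt (B * (E k l * E l k)) x)"
  define r where "r = (\<lambda>k l. x k / (x k - x l))"
  have Bs: "msupp B \<subseteq> I" and Bc: "\<And>i j. i < N \<Longrightarrow> j < N \<Longrightarrow> B * E i j = E i j * B"
    using B by (auto simp: invariant_def)
  have D_eq: "D k = (\<Sum>p\<in>I. of_real (entry B p p) * of_int (wt p k) * lmono N x (wt p))" if "k < N" for k
    unfolding D_def ch_def by (rule sum.cong) (auto simp: E_diag that entry_times_dg finI)
  have Tkk: "T k k = (\<Sum>p\<in>I. of_real (entry B p p) * of_int (wt p k * wt p k) * lmono N x (wt p))" if "k < N" for k
    unfolding T_def ch_def mult.assoc[symmetric] E_diag[OF that]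
    by (rule sum.cong) (auto simp: that entry_times_dg finI)
  \<comment> \<open>Cyclicity gives T k l * x l = x k * T l k, and the commutator gives T k l - T l
    k. These two linear equations determine T k l because \<open>x k\<close> and \<open>x l\<close>
    differ.\<close>
  have T: "T k l = r k l * (D k - D l)" if kl: "k < N" "l < N" "k \<noteq> l" for k l
  proof -
    have ne: "x k - x l \<noteq> 0" using x kl by (auto simp: torus_reg_def)
    have "B * (E k l * E l k) = E k l * (B * E l k)"
      using Bc[OF kl(1,2)] by (metis mult.assoc)
    then have "T k l * x l = x k * ch N I wt (B * E l k * E k l) x"
      unfolding T_def using ch_cyclic[OF x kl(1,2), of "B * E l k"] msupp_times[OF Bs msupp_E[OF kl(2,1)]] by simp
    then have 1: "T k l * x l = x k * T l k" by (simp add: T_def mult.assoc)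
    have "B * (E k l * E l k) - B * (E l k * E k l) = B * E k k - B * E l l"
      using comm_E[OF kl(1,2) kl(2,1)] by (simp add: right_diff_distrib[symmetric])
    then have 2: "T k l - T l k = D k - D l"
      unfolding T_def D_def by (simp only: ch_minus[symmetric])
    have "T k l * (x k - x l) = x k * (T k l - T l k)"
      using 1 by (simp add: algebra_simps)
    then have "T k l * (x k - x l) = x k * (D k - D l)" by (simp only: 2)
    then show ?thesis using ne by (simp add: r_def field_simps)
  qed
  have r1: "r k l + r l k = 1" if "k < N" "l < N" "k \<noteq> l" for k l
  proof -
    have ne: "x k - x l \<noteq> 0" using x that by (auto simp: torus_reg_def)
    have "x l - x k = - (x k - x l)" by simp
    then have "r k l + r l k = (x k - x l) / (x k - x l)"
      by (simp only: r_def minus_divide_right[symmetric] diff_divide_distrib) simp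
    then show ?thesis using ne by simp
  qed
  let ?O = "\<lambda>F. \<Sum>k<N. \<Sum>l\<in>{..<N} - {k}. F k l"
  have Oswap: "?O F = ?O (\<lambda>k l. F l k)" for F :: "nat \<Rightarrow> nat \<Rightarrow> complex"
  proof -
    have "?O F = (\<Sum>k<N. \<Sum>l<N. if l \<noteq> k then F k l else 0)" for F :: "nat \<Rightarrow> nat \<Rightarrow> complex"
    proof (rule sum.cong[OF refl])
      show "(\<Sum>l\<in>{..<N} - {k}. F k l) = (\<Sum>l<N. if l \<noteq> k then F k l else 0)" for k
        by (rule sum.mono_neutral_cong_left) auto
    qed
    then show ?thesis
      using sum.swap[of "\<lambda>k l. if l \<noteq> k then F k l else 0" "{..<N}" "{..<N}"]
      by (simp add: eq_commute)
  qed
  \<comment> \<open>Since r k l + r l k = 1, the sum can be symmetrised at the cost of the term with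
    N - 1, which is exactly what the linear term of \<open>casimir\<close> cancels.\<close>
  have offdiag: "?O T = 2 * ?O (\<lambda>k l. r k l * D k) - of_nat (N - 1) * (\<Sum>k<N. D k)"
  proof -
    have "?O T = ?O (\<lambda>k l. r k l * D k - r k l * D l)"
      by (intro sum.cong refl) (auto simp: T algebra_simps)
    also have "\<dots> = ?O (\<lambda>k l. r k l * D k) - ?O (\<lambda>k l. r k l * D l)"
      by (simp add: sum_subtractf)
    also have "?O (\<lambda>k l. r k l * D l) = ?O (\<lambda>k l. r l k * D k)"
      by (rule Oswap)
    also have "\<dots> = ?O (\<lambda>k l. D k - r k l * D k)"
    proof (intro sum.cong refl)
      fix k l assume "k \<in> {..<N}" "l \<in> {..<N} - {k}"
      then have "r l k = 1 - r k l" using r1[of k l] by (auto simp: algebra_simps)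
      then show "r l k * D k = D k - r k l * D k" by (simp add: left_diff_distrib)
    qed
    also have "\<dots> = (\<Sum>k<N. of_nat (N - 1) * D k - (\<Sum>l\<in>{..<N} - {k}. r k l * D k))"
      by (rule sum.cong[OF refl]) (simp add: sum_subtractf card_Diff_singleton)
    also have "\<dots> = of_nat (N - 1) * (\<Sum>k<N. D k) - ?O (\<lambda>k l. r k l * D k)"
      by (simp only: sum_subtractf sum_distrib_left)
    finally show ?thesis by simp
  qed
  have "ch N I wt (B * Cas) x = (\<Sum>k<N. \<Sum>l<N. T k l) + of_nat (N - 1) * (\<Sum>k<N. D k)"
    by (simp add: casimir_def distrib_left sum_distrib_left ch_plus ch_sum ch_scaleR T_def D_def)
  also have "(\<Sum>k<N. \<Sum>l<N. T k l) = (\<Sum>k<N. T k k) + ?O T"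
    unfolding sum.distrib[symmetric] by (rule sum.cong[OF refl], rule sum.remove) auto
  finally have C: "ch N I wt (B * Cas) x = (\<Sum>k<N. T k k) + 2 * ?O (\<lambda>k l. r k l * D k)"
    by (simp add: offdiag)
  \<comment> \<open>The first-order coefficients are logarithmic derivatives of the denominator;
    multiplied by it they become the cross terms of |\<delta> s + wt|^2.\<close>
  have vd: "?a * (\<Sum>l\<in>{..<N} - {k}. r k l) =
      (\<Sum>s\<in>perms N. of_int (sign s) * of_int (dl N (s k)) * lmono N x (dl N \<circ> s))" if "k < N" for k
    using log_derivative_den[OF x that] by (simp add: r_def)
  have "?a * ch N I wt (B * Cas) x = ?a * (\<Sum>k<N. T k k) + 2 * (\<Sum>k<N. (?a * (\<Sum>l\<in>{..<N} - {k}. r k l)) * D k)"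
    by (simp add: C algebra_simps sum_distrib_left sum_distrib_right)
  also have "?a * (\<Sum>k<N. T k k) = ?S (\<lambda>s p. nsq N (wt p))"
  proof -
    have "(\<Sum>k<N. T k k) = (\<Sum>p\<in>I. of_real (entry B p p) * of_int (nsq N (wt p)) * lmono N x (wt p))"
      unfolding nsq_def ip_def of_int_sum sum_distrib_left sum_distrib_right
      by (subst sum.swap) (simp add: Tkk sum_distrib_left)
    then show ?thesis
      using lmono_add[OF x, of "\<lambda>k. dl N (_ k)"]
      by (simp add: alternant_eq sum_product sum.cartesian_product' lmono_add[OF x] o_def ac_simps)
  qed
  also have "(\<Sum>k<N. (?a * (\<Sum>l\<in>{..<N} - {k}. r k l)) * D k) =
      (\<Sum>k<N. \<Sum>(s, p)\<in>perms N \<times> I. of_int (sign s) * of_real (entry B p p) *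
       of_int (dl N (s k) * wt p k) * lmono N x (\<lambda>k. dl N (s k) + wt p k))"
  proof (rule sum.cong)
    fix k assume "k \<in> {..<N}"
    then have k: "k < N" by simp
    show "(?a * (\<Sum>l\<in>{..<N} - {k}. r k l)) * D k = ?S (\<lambda>s p. dl N (s k) * wt p k)"
      unfolding vd[OF k] D_eq[OF k] sum_product sum.cartesian_product' lmono_add[OF x]
      by (simp add: o_def ac_simps)
  qed simp
  also have "\<dots> = ?S (\<lambda>s p. ip N (dl N \<circ> s) (wt p))"
    unfolding ip_def of_int_sum by (subst sum.swap) (simp add: case_prod_unfold sum_distrib_left sum_distrib_right)
  finally have "?a * ch N I wt (B * Cas) x =
      ?S (\<lambda>s p. nsq N (wt p) + 2 * ip N (dl N \<circ> s) (wt p))"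
    by (simp add: case_prod_unfold sum.distrib[symmetric] sum_distrib_left algebra_simps)
  also have "\<dots> = ?S (\<lambda>s p. nsq N (\<lambda>k. dl N (s k) + wt p k) - nsq N (dl N))"
  proof (rule sum.cong)
    fix w assume "w \<in> perms N \<times> I"
    then obtain s p where w: "w = (s, p)" and s: "s \<in> perms N" by auto
    have "nsq N (\<lambda>k. (dl N \<circ> s) k + wt p k) = nsq N (dl N) + 2 * ip N (dl N \<circ> s) (wt p) + nsq N (wt p)"
      using nsq_add[of N "dl N \<circ> s" "wt p"] nsq_perm[OF s, of "dl N"] by (simp only:)
    then have "nsq N (wt p) + 2 * ip N (dl N \<circ> s) (wt p) = nsq N (\<lambda>k. dl N (s k) + wt p k) - nsq N (dl N)"
      by simp
    then show "(case w of (s, p) \<Rightarrow> of_int (sign s) * of_real (entry B p p) *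
       of_int (nsq N (wt p) + 2 * ip N (dl N \<circ> s) (wt p)) * lmono N x (\<lambda>k. dl N (s k) + wt p k)) =
      (case w of (s, p) \<Rightarrow> of_int (sign s) * of_real (entry B p p) *
       of_int (nsq N (\<lambda>k. dl N (s k) + wt p k) - nsq N (dl N)) * lmono N x (\<lambda>k. dl N (s k) + wt p k))"
      unfolding w by (simp only: prod.case)
  qed simp
  finally show ?thesis .
qed

text \<open>Trace of \<open>B\<close> on a weight space; for an invariant projection, the
  multiplicity of the weight in the image.\<close>

definition mult :: "'p fmat \<Rightarrow> (nat \<Rightarrow> int) \<Rightarrow> real" where
  "mult B \<xi> = (\<Sum>p\<in>{p \<in> I. wt p = \<xi>}. entry B p p)"

text \<open>The coefficient of \<open>x\<^sup>\<kappa>\<close> in the product of the Weyl denominator and the character of \<open>B\<close>.\<close>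
definition phi :: "'p fmat \<Rightarrow> (nat \<Rightarrow> int) \<Rightarrow> real" where
  "phi B \<kappa> = (\<Sum>s\<in>perms N. of_int (sign s) * mult B (\<lambda>k. \<kappa> k - dl N (s k)))"

abbreviation "shifts \<equiv> \<lambda>(s, p) k. dl N (s k) + wt p k"

lemma finite_W [simp]: "finite (perms N \<times> I)"
  using finI by simp

lemma shifts_weights: "shifts ` (perms N \<times> I) \<subseteq> weights N"
proof -
  have "(\<lambda>k. dl N (s k) + wt p k) \<in> weights N" if "s \<in> perms N" "p \<in> I" for s p
    using weights_comp[OF dl_weights that(1)] wt_weights[OF that(2)] by (simp add: weights_def)
  then show ?thesis by auto
qed

lemma lcoeff_shifted_ch:
  "lcoeff (perms N \<times> I) (\<lambda>(s, p) k. e (s k) + wt p k) (\<lambda>(s, p). of_int (sign s) * of_real (entry B p p)) \<kappa> =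
    of_real (\<Sum>s\<in>perms N. of_int (sign s) * mult B (\<lambda>k. \<kappa> k - e (s k)))"
proof -
  have "{w \<in> perms N \<times> I. (case w of (s, p) \<Rightarrow> \<lambda>k. e (s k) + wt p k) = \<kappa>} =
      (SIGMA s:perms N. {p \<in> I. wt p = (\<lambda>k. \<kappa> k - e (s k))})"
    by (auto simp: fun_eq_iff algebra_simps)
  then show ?thesis
    by (simp add: lcoeff_def mult_def sum.Sigma[symmetric] finI sum_distrib_left)
qed

lemma lcoeff_phi:
  "lcoeff (perms N \<times> I) shifts (\<lambda>(s, p). of_int (sign s) * of_real (entry B p p)) \<kappa> = of_real (phi B \<kappa>)"
  unfolding phi_def by (rule lcoeff_shifted_ch)

lemma den_ch_expand:
  assumes "x \<in> torus_reg N"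
  shows "alternant N (dl N) x * ch N I wt B x =
    (\<Sum>w\<in>perms N \<times> I. (case w of (s, p) \<Rightarrow> of_int (sign s) * of_real (entry B p p)) * lmono N x (shifts w))"
  unfolding alternant_eq ch_def sum_product sum.cartesian_product
  by (rule sum.cong) (auto simp: lmono_add[OF assms] o_def mult_ac)

text \<open>Uniqueness of Laurent coefficients: any expansion of denominator times character may be
  used to compute \<open>phi\<close>.\<close>

lemma phi_eqI:
  assumes "finite W" "ex ` W \<subseteq> weights N"
    and "\<And>x. x \<in> torus_reg N \<Longrightarrow>
      alternant N (dl N) x * ch N I wt B x = (\<Sum>w\<in>W. c w * lmono N x (ex w))"
  shows "of_real (phi B \<kappa>) = lcoeff W ex c \<kappa>"
  unfolding lcoeff_phi[symmetric]
  by (rule lcoeff_cong[of _ _ _ N]) (use assms shifts_weights den_ch_expand in auto)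

lemma phi_nonzero_shift: "phi B \<kappa> \<noteq> 0 \<Longrightarrow> \<kappa> \<in> shifts ` (perms N \<times> I)"
proof (rule ccontr)
  assume "phi B \<kappa> \<noteq> 0" "\<kappa> \<notin> shifts ` (perms N \<times> I)"
  then have "{w \<in> perms N \<times> I. shifts w = \<kappa>} = {}" by blast
  then have "complex_of_real (phi B \<kappa>) = 0"
    unfolding lcoeff_phi[symmetric] lcoeff_def by (simp only: sum.empty)
  then show False using \<open>phi B \<kappa> \<noteq> 0\<close> by simp
qed

lemma finite_phi: "finite {\<kappa>. phi B \<kappa> \<noteq> 0}"
  by (rule finite_subset[OF _ finite_imageI[OF finite_W]]) (use phi_nonzero_shift in blast)

lemma phi_weights: "phi B \<kappa> \<noteq> 0 \<Longrightarrow> \<kappa> \<in> weights N"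
  using phi_nonzero_shift shifts_weights by blast

lemma den_ch_phi:
  assumes "x \<in> torus_reg N"
  shows "alternant N (dl N) x * ch N I wt B x = (\<Sum>\<kappa> | phi B \<kappa> \<noteq> 0. of_real (phi B \<kappa>) * lmono N x \<kappa>)"
proof -
  have "alternant N (dl N) x * ch N I wt B x =
      (\<Sum>\<kappa>\<in>shifts ` (perms N \<times> I). of_real (phi B \<kappa>) * lmono N x \<kappa>)"
    unfolding den_ch_expand[OF assms] lcoeff_phi[symmetric]
    by (rule lcoeff_expand) simp_all
  also have "\<dots> = (\<Sum>\<kappa> | phi B \<kappa> \<noteq> 0. of_real (phi B \<kappa>) * lmono N x \<kappa>)"
    by (rule sum.mono_neutral_right) (use phi_nonzero_shift in auto)
  finally show ?thesis .
qed

lemma mult_linear: "mult (A + B) \<xi> = mult A \<xi> + mult B \<xi>" "mult (c *\<^sub>R A) \<xi> = c * mult A \<xi>" "mult 0 \<xi> = 0"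
  by (simp_all add: mult_def sum.distrib sum_distrib_left)

lemma phi_linear: "phi (A + B) \<kappa> = phi A \<kappa> + phi B \<kappa>" "phi (c *\<^sub>R A) \<kappa> = c * phi A \<kappa>" "phi 0 \<kappa> = 0"
  by (simp_all add: phi_def mult_linear algebra_simps sum.distrib sum_distrib_left)

text \<open>The Casimir eigenvalue that belongs to the shifted exponent \<kappa> = \<lambda> +
  \<delta>.\<close>

definition cval :: "(nat \<Rightarrow> int) \<Rightarrow> int" where
  "cval \<kappa> = nsq N \<kappa> - nsq N (dl N)"

lemma phi_times_Cas:
  assumes "invariant B"
  shows "phi (B * Cas) \<kappa> = of_int (cval \<kappa>) * phi B \<kappa>"
proof -
  let ?c = "\<lambda>(s, p). of_int (sign s) * of_real (entry B p p) :: complex"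
  let ?d = "\<lambda>(s, p). of_int (sign s) * of_real (entry B p p) * of_int (cval (\<lambda>k. dl N (s k) + wt p k)) :: complex"
  have "of_real (phi (B * Cas) \<kappa>) = lcoeff (perms N \<times> I) shifts ?d \<kappa>"
    by (rule phi_eqI[OF _ shifts_weights]) (simp_all add: ch_times_Cas[OF _ assms] cval_def case_prod_unfold)
  also have "\<dots> = of_int (cval \<kappa>) * lcoeff (perms N \<times> I) shifts ?c \<kappa>"
    unfolding lcoeff_def sum_distrib_left by (rule sum.cong) auto
  finally have "complex_of_real (phi (B * Cas) \<kappa>) = of_real (of_int (cval \<kappa>) * phi B \<kappa>)"
    unfolding lcoeff_phi by simp
  then show ?thesis by (simp only: of_real_eq_iff)
qed

lemma invariant_add: "invariant A \<Longrightarrow> invariant B \<Longrightarrow> invariant (A + B)"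
  by (simp add: invariant_def msupp_plus algebra_simps)

lemma invariant_scaleR: "invariant A \<Longrightarrow> invariant (c *\<^sub>R A)"
  by (auto simp: invariant_def dest: msupp_scaleR[THEN subsetD])

lemma invariant_zero: "invariant 0"
  by (simp add: invariant_def)

lemma invariant_pact: "invariant B \<Longrightarrow> invariant (pact Cas f B)"
  by (induction f) (simp_all add: invariant_zero invariant_add invariant_scaleR invariant_times_Cas)

lemma phi_pact:
  assumes "invariant B"
  shows "phi (pact Cas f B) \<kappa> = poly f (of_int (cval \<kappa>)) * phi B \<kappa>"
proof (induction f)
  case (pCons a f)
  then show ?case
    by (simp add: phi_linear phi_times_Cas[OF invariant_pact[OF assms]] algebra_simps)
qed (simp add: phi_linear)

text \<open>The denominator has no zero on the regular torus, so the character vanishes there and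
  with it the trace on each weight space.\<close>

lemma trace_zero_if_phi_zero:
  assumes "\<And>\<kappa>. phi B \<kappa> = 0"
  shows "(\<Sum>p\<in>I. entry B p p) = 0"
proof -
  have "ch N I wt B x = 0" if "x \<in> torus_reg N" for x
    using den_ch_phi[OF that, of B] alternant_dl_nz[OF that] assms by simp
  then have l: "lcoeff I wt (\<lambda>p. of_real (entry B p p)) \<xi> = lcoeff {} wt (\<lambda>p. of_real (entry B p p)) \<xi>" for \<xi>
    by (intro lcoeff_cong[of _ _ _ N]) (auto simp: ch_def finI wt_weights)
  have m: "mult B \<xi> = 0" for \<xi>
  proof -
    have "complex_of_real (mult B \<xi>) = 0" using l[of \<xi>] by (simp add: lcoeff_def mult_def)
    then show ?thesis by simp
  qed
  have "(\<Sum>p\<in>I. entry B p p) = (\<Sum>\<xi>\<in>wt ` I. mult B \<xi>)"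
    unfolding mult_def by (rule sum.image_gen[OF finI])
  then show ?thesis by (simp add: m)
qed

text \<open>Subrepresentations are encoded by their orthogonal projections; symmetry is what makes
  the trace form applicable.\<close>

definition invproj :: "'p fmat \<Rightarrow> bool" where
  "invproj B \<longleftrightarrow> invariant B \<and> B * B = B \<and> tp B = B"

lemma pact_square:
  assumes "invproj B"
  shows "pact Cas f B * pact Cas g B = pact Cas (f * g) B"
proof -
  have B: "B * B = B" "B * Cas = Cas * B"
    using assms invariant_commutes_Cas by (auto simp: invproj_def)
  have "pact Cas g B * B = B * pact Cas g B"
    using pact_commutes[of B B Cas g] B by simp
  also have "\<dots> = pact Cas g B" by (simp add: pact_left[symmetric] B)
  finally have g: "pact Cas g B * B = pact Cas g B" .
  have "pact Cas f B * pact Cas g B = pact Cas g (pact Cas f B * B)"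
    by (simp add: pact_left)
  also have "pact Cas f B * B = pact Cas f B"
    using pact_commutes[of B B Cas f] B by (simp add: pact_left[symmetric])
  also have "pact Cas g (pact Cas f B) = pact Cas (f * g) B"
    by (simp only: pact_mult[symmetric] mult.commute)
  finally show ?thesis .
qed

lemma tp_pact_Cas: "invproj B \<Longrightarrow> tp (pact Cas f B) = pact Cas f B"
  by (rule tp_pact) (auto simp: invproj_def tp_Cas invariant_commutes_Cas)

text \<open>The matrix is symmetric and its square belongs to the polynomial f^2, whose
  \<open>phi\<close> vanishes everywhere; the trace form then kills the matrix. Hence on the image
  of \<open>B\<close> the Casimir is diagonalisable, with eigenvalues among the \<open>cval\<close>
  of exponents where \<open>phi B\<close> is nonzero.\<close>

lemma pact_eq_0:
  assumes B: "invproj B" and f: "\<And>\<kappa>. phi B \<kappa> \<noteq> 0 \<Longrightarrow> poly f (of_int (cval \<kappa>)) = 0"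
  shows "pact Cas f B = 0"
proof (rule fmat_eq_0_if_trace[OF finI])
  have iB: "invariant B" using B by (simp add: invproj_def)
  then show "msupp (pact Cas f B) \<subseteq> I" using invariant_pact invariant_def by blast
  have "pact Cas f B * tp (pact Cas f B) = pact Cas (f * f) B"
    by (simp add: tp_pact_Cas[OF B] pact_square[OF B])
  moreover have "phi (pact Cas (f * f) B) \<kappa> = 0" for \<kappa>
    unfolding phi_pact[OF iB] using f[of \<kappa>] by (cases "phi B \<kappa> = 0") auto
  ultimately show "(\<Sum>p\<in>I. entry (pact Cas f B * tp (pact Cas f B)) p p) = 0"
    using trace_zero_if_phi_zero by simp
qed

lemma invproj_zero_if_phi_zero: "invproj B \<Longrightarrow> (\<And>\<kappa>. phi B \<kappa> = 0) \<Longrightarrow> B = 0"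
  using pact_eq_0[of B 1] by simp

end

section \<open>Spectral projections and a lower bound for Casimir eigenvalues\<close>

definition lagrange :: "'j set \<Rightarrow> ('j \<Rightarrow> real) \<Rightarrow> 'j \<Rightarrow> real poly" where
  "lagrange J c j = (\<Prod>i\<in>J - {j}. smult (1 / (c j - c i)) [:- c i, 1:])"

lemma poly_lagrange:
  assumes "finite J" "inj_on c J" "i \<in> J" "j \<in> J"
  shows "poly (lagrange J c j) (c i) = (if i = j then 1 else 0)"
proof (cases "i = j")
  case True
  have "poly (smult (1 / (c j - c i)) [:- c i, 1:]) (c j) = 1" if "i \<in> J - {j}" for i
  proof -
    have "c j \<noteq> c i" using that assms(2,4) by (auto dest: inj_onD)
    moreover have "poly (smult (1 / (c j - c i)) [:- c i, 1:]) (c j) = 1 / (c j - c i) * (c j - c i)"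
      by (simp only: poly_smult poly_pCons poly_0) simp
    ultimately show ?thesis by simp
  qed
  then show ?thesis using True unfolding lagrange_def poly_prod by (simp del: poly_smult)
next
  case False
  then show ?thesis using assms by (auto simp: lagrange_def poly_prod intro!: prod_zero)
qed

context glrep
begin

text \<open>By \<open>pact_eq_0\<close> an identity between polynomials in the Casimir need only be
  checked at the values \<open>cval \<kappa>\<close> with \<open>phi B \<kappa> \<noteq> 0\<close>,
  where the Lagrange polynomials are 0 or 1.\<close>

lemma casimir_eigenprojections:
  assumes B: "invproj B" and J: "finite J" "inj_on c J"
    and spec: "\<And>\<kappa>. phi B \<kappa> \<noteq> 0 \<Longrightarrow> of_int (cval \<kappa>) \<in> c ` J"
  defines "Q \<equiv> \<lambda>j. pact Cas (lagrange J c j) B"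
  shows "(\<Sum>j\<in>J. Q j) = B"
    and "j \<in> J \<Longrightarrow> invproj (Q j)"
    and "j \<in> J \<Longrightarrow> Q j * Cas = c j *\<^sub>R Q j"
    and "j \<in> J \<Longrightarrow> Q j * B = Q j"
    and "j \<in> J \<Longrightarrow> phi (Q j) \<kappa> = (if of_int (cval \<kappa>) = c j then phi B \<kappa> else 0)"
proof -
  have iB: "invariant B" using B by (simp add: invproj_def)
  have L: "poly (lagrange J c j) (of_int (cval \<kappa>)) = (if of_int (cval \<kappa>) = c j then 1 else 0)"
    if ph: "phi B \<kappa> \<noteq> 0" and j: "j \<in> J" for \<kappa> j
  proof -
    obtain i where i: "i \<in> J" "of_int (cval \<kappa>) = c i" using spec[OF ph] by blast
    then show ?thesis using poly_lagrange[OF J i(1) j] J(2) j by (auto dest: inj_onD)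
  qed
  have "pact Cas ((\<Sum>j\<in>J. lagrange J c j) - 1) B = 0"
  proof (rule pact_eq_0[OF B])
    fix \<kappa> assume ph: "phi B \<kappa> \<noteq> 0"
    obtain i where i: "i \<in> J" "of_int (cval \<kappa>) = c i" using spec[OF ph] by blast
    have "(\<Sum>j\<in>J. poly (lagrange J c j) (c i)) = (\<Sum>j\<in>J. if i = j then 1 else 0)"
      by (rule sum.cong) (simp_all add: poly_lagrange[OF J i(1)])
    then show "poly ((\<Sum>j\<in>J. lagrange J c j) - 1) (of_int (cval \<kappa>)) = 0"
      using i J(1) by (simp add: poly_sum)
  qed
  then show "(\<Sum>j\<in>J. Q j) = B" by (simp add: pact_diff pact_sum Q_def)
  show "invproj (Q j)" if j: "j \<in> J"
  proof -
    have "pact Cas (lagrange J c j * lagrange J c j - lagrange J c j) B = 0"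
      by (rule pact_eq_0[OF B]) (simp add: L j)
    then have "Q j * Q j = Q j" by (simp add: Q_def pact_square[OF B] pact_diff)
    then show ?thesis
      using invariant_pact[OF iB] tp_pact_Cas[OF B] by (simp add: invproj_def Q_def)
  qed
  show "Q j * Cas = c j *\<^sub>R Q j" if j: "j \<in> J"
  proof -
    have "pact Cas (pCons 0 (lagrange J c j) - smult (c j) (lagrange J c j)) B = 0"
      by (rule pact_eq_0[OF B]) (simp add: L j)
    then show ?thesis by (simp add: Q_def pact_diff pact_smult)
  qed
  show "Q j * B = Q j"
    using pact_square[OF B, of "lagrange J c j" 1] by (simp add: Q_def)
  show "phi (Q j) \<kappa> = (if of_int (cval \<kappa>) = c j then phi B \<kappa> else 0)" if "j \<in> J"
    using phi_pact[OF iB, of "lagrange J c j" \<kappa>] L[of \<kappa> j] that by (cases "phi B \<kappa> = 0") (auto simp: Q_def)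
qed

lemma psd_entry:
  assumes "msupp X \<subseteq> I"
  shows "entry (X * tp X) p p = (\<Sum>r\<in>I. (entry X p r)\<^sup>2)"
  using entry_times[of I X "tp X" p p] assms finI by (simp add: power2_eq_square)

lemma psd_entry_nonneg: "msupp X \<subseteq> I \<Longrightarrow> entry (X * tp X) p p \<ge> 0"
  by (simp add: psd_entry sum_nonneg)

lemma invproj_entry_nonneg:
  assumes "invproj B"
  shows "entry B p p \<ge> 0"
  using psd_entry_nonneg[of B p] assms by (simp add: invproj_def invariant_def)

text \<open>A diagonal entry of an orthogonal projection is the sum of the squares of its
  row.\<close>

lemma invproj_entry_zero_row:
  assumes "invproj B" "entry B p p = 0"
  shows "entry B p r = 0"
proof (cases "r \<in> I")
  case True
  have "(\<Sum>r\<in>I. (entry B p r)\<^sup>2) = 0"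
    using psd_entry[of B p] assms by (simp add: invproj_def invariant_def)
  then show ?thesis using True finI by (simp add: sum_nonneg_eq_0_iff)
next
  case False
  then show ?thesis using assms(1) by (auto simp: invproj_def invariant_def intro: entry_eq_0)
qed

end

text \<open>Each a_i is counted N - 1 - i times with a plus and i times with a minus sign. The right
  side is twice the pairing with the half sum of the positive roots.\<close>

lemma sum_ordered_differences:
  fixes a :: "nat \<Rightarrow> real"
  shows "(\<Sum>i<N. \<Sum>j<N. if i < j then a i - a j else 0) = (\<Sum>i<N. a i * (real N - 1 - 2 * real i))"
proof (induction N)
  case (Suc N)
  have "(\<Sum>i<Suc N. \<Sum>j<Suc N. if i < j then a i - a j else 0) =
      (\<Sum>i<N. (\<Sum>j<N. if i < j then a i - a j else 0) + (a i - a N)) + 0"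
    by (simp add: sum.neutral)
  also have "\<dots> = (\<Sum>i<N. a i * (real N - 1 - 2 * real i)) + (\<Sum>i<N. a i) - real N * a N"
    by (simp add: sum.distrib Suc sum_subtractf)
  also have "\<dots> = (\<Sum>i<Suc N. a i * (real (Suc N) - 1 - 2 * real i))"
    by (simp add: sum.distrib[symmetric] algebra_simps)
  finally show ?case .
qed simp

context glrep
begin

text \<open>The Casimir operator is \<open>\<bar>wt + \<delta>\<bar>\<^sup>2 - \<bar>\<delta>\<bar>\<^sup>2\<close> plus the positive operators \<open>2 E\<^sub>j\<^sub>i E\<^sub>i\<^sub>j\<close>, \<open>i < j\<close>.\<close>
lemma casimir_eigenvalue_ge:
  assumes Q: "invproj Q" and c: "Q * Cas = c *\<^sub>R Q" and p: "p \<in> I" and nz: "entry Q p p \<noteq> 0"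
  shows "of_int (cval (\<lambda>k. wt p k + dl N k)) \<le> c"
proof -
  define q where "q = entry Q p p"
  define a where "a = (\<lambda>i. real_of_int (wt p i))"
  have q: "q > 0" using invproj_entry_nonneg[OF Q, of p] nz by (simp add: q_def)
  have QI: "msupp Q \<subseteq> I" and QQ: "Q * Q = Q" and tQ: "tp Q = Q"
    and QE: "\<And>i j. i < N \<Longrightarrow> j < N \<Longrightarrow> Q * E i j = E i j * Q"
    using Q by (auto simp: invproj_def invariant_def)
  have diag: "entry (Q * E i i) p p = q * a i" if "i < N" for i
    using p finI by (simp add: E_diag[OF that] entry_times_dg q_def a_def)
  \<comment> \<open>Since Q commutes with the action, Q E_ij E_ji equals (Q E_ij) times its own
    transpose.\<close>
  have pos: "entry (Q * (E i j * E j i)) p p \<ge> 0" if "i < N" "j < N" for i j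
  proof -
    have "Q * (E i j * E j i) = Q * (Q * E i j) * E j i" by (simp add: QQ mult.assoc[symmetric])
    also have "\<dots> = Q * (E i j * Q) * E j i" by (simp only: QE[OF that])
    also have "\<dots> = Q * E i j * (E j i * Q)" by (simp only: QE[OF that(2,1), symmetric] mult.assoc)
    also have "\<dots> = Q * E i j * tp (Q * E i j)" by (simp add: tp_times tQ tp_E that)
    finally show ?thesis using psd_entry_nonneg[OF msupp_times[OF QI msupp_E[OF that]]] by metis
  qed
  \<comment> \<open>For i < j the product is first reordered by the commutator, which contributes
    a_i - a_j; in both off-diagonal cases a positive operator is then dropped.\<close>
  have bound: "entry (Q * (E i j * E j i)) p p \<ge> q * ((if i = j then (a i)\<^sup>2 else 0) + (if i < j then a i - a j else 0))"
    if ij: "i < N" "j < N" for i j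
  proof -
    consider "i = j" | "i < j" | "j < i" by linarith
    then show ?thesis
    proof cases
      case 1
      have "entry (Q * (E i i * E i i)) p p = entry (Q * E i i * E i i) p p" by (simp only: mult.assoc)
      also have "\<dots> = q * a i * a i"
        using p finI by (simp add: E_diag[OF ij(1)] entry_times_dg q_def a_def)
      finally show ?thesis using 1 by (simp add: power2_eq_square)
    next
      case 2
      have "E i j * E j i = E j i * E i j + (E i i - E j j)"
        using comm_E[OF ij ij(2,1)] 2 by (simp add: algebra_simps)
      then have "entry (Q * (E i j * E j i)) p p = entry (Q * (E j i * E i j)) p p + (q * a i - q * a j)"
        by (simp add: distrib_left right_diff_distrib diag ij)
      then show ?thesis using 2 pos[OF ij(2,1)] by (simp add: algebra_simps)
    next
      case 3
      then show ?thesis using pos[OF ij] by simp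
    qed
  qed
  have "c * q = entry (Q * Cas) p p" by (simp add: c q_def)
  also have "\<dots> = (\<Sum>i<N. \<Sum>j<N. entry (Q * (E i j * E j i)) p p) + real (N - 1) * (\<Sum>i<N. q * a i)"
    by (simp add: casimir_def distrib_left sum_distrib_left diag)
  also have "\<dots> \<ge> (\<Sum>i<N. \<Sum>j<N. q * ((if i = j then (a i)\<^sup>2 else 0) + (if i < j then a i - a j else 0)))
      + real (N - 1) * (\<Sum>i<N. q * a i)"
    by (intro add_right_mono sum_mono bound) auto
  also have "(\<Sum>i<N. \<Sum>j<N. q * ((if i = j then (a i)\<^sup>2 else 0) + (if i < j then a i - a j else 0)))
      = q * ((\<Sum>i<N. (a i)\<^sup>2) + (\<Sum>i<N. a i * (real N - 1 - 2 * real i)))"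
    by (simp add: sum_distrib_left[symmetric] sum.distrib sum_ordered_differences)
  also have "\<dots> + real (N - 1) * (\<Sum>i<N. q * a i) =
      q * (\<Sum>i<N. (a i)\<^sup>2 + a i * (real N - 1 - 2 * real i) + real (N - 1) * a i)"
    by (simp only: sum.distrib sum_distrib_left[symmetric]) (simp add: algebra_simps)
  also have "(\<Sum>i<N. (a i)\<^sup>2 + a i * (real N - 1 - 2 * real i) + real (N - 1) * a i) =
      of_int (cval (\<lambda>k. wt p k + dl N k))"
  proof -
    have "cval (\<lambda>k. wt p k + dl N k) = nsq N (wt p) + 2 * ip N (wt p) (dl N)"
      by (simp add: cval_def nsq_add)
    also have "\<dots> = (\<Sum>i<N. wt p i * wt p i + 2 * (wt p i * dl N i))"
      by (simp add: nsq_def ip_def sum.distrib sum_distrib_left)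
    finally have cv: "cval (\<lambda>k. wt p k + dl N k) = (\<Sum>i<N. wt p i * wt p i + 2 * (wt p i * dl N i))" .
    show ?thesis
      unfolding cv of_int_sum
      by (rule sum.cong) (auto simp: a_def dl_def of_nat_diff power2_eq_square algebra_simps)
  qed
  finally show ?thesis using q by (simp add: mult.commute)
qed

section \<open>Weight multiplicities and the coefficients of the character\<close>

lemma mult_nonzero: "mult B \<xi> \<noteq> 0 \<Longrightarrow> \<exists>p\<in>I. wt p = \<xi> \<and> entry B p p \<noteq> 0"
  unfolding mult_def by (metis (mono_tags, lifting) mem_Collect_eq sum.neutral)

lemma mult_pos:
  assumes "invproj B" "p \<in> I" "entry B p p \<noteq> 0"
  shows "mult B (wt p) > 0"
proof -
  have "entry B p p \<le> mult B (wt p)"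
    unfolding mult_def by (rule member_le_sum) (use assms finI invproj_entry_nonneg in auto)
  moreover have "entry B p p > 0" using invproj_entry_nonneg[OF assms(1), of p] assms(3) by simp
  ultimately show ?thesis by simp
qed

text \<open>With the identity split off, the other permutations involve only weights \<xi> +
  \<delta> - \<delta> s. By rearrangement these are strictly larger than \<xi> in every strictly
  decreasing direction, so the relation is triangular.\<close>

lemma phi_eq_mult_plus:
  "phi B (\<lambda>k. \<xi> k + dl N k) = mult B \<xi> +
    (\<Sum>s\<in>perms N - {id}. of_int (sign s) * mult B (\<lambda>k. \<xi> k + (dl N k - dl N (s k))))"
  unfolding phi_def
  by (subst sum.remove[of _ id]) (simp_all add: add_diff_eq)

lemma phi_eq_mult:
  assumes "\<And>s. s \<in> perms N \<Longrightarrow> s \<noteq> id \<Longrightarrow> mult B (\<lambda>k. \<xi> k + (dl N k - dl N (s k))) = 0"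
  shows "phi B (\<lambda>k. \<xi> k + dl N k) = mult B \<xi>"
  unfolding phi_eq_mult_plus using assms by simp

text \<open>For a strictly decreasing exponent only the identity permutation contributes to \<open>phi\<close>, since
  all other weights involved violate the lower bound on the Casimir eigenvalue.\<close>
lemma phi_sdec:
  assumes B: "invproj B" and \<kappa>: "sdec N \<kappa>"
  shows "phi B \<kappa> \<ge> 0"
    and "phi B \<kappa> \<noteq> 0 \<Longrightarrow> \<exists>Q. invproj Q \<and> Q * B = Q \<and> Q * Cas = of_int (cval \<kappa>) *\<^sub>R Q \<and>
      (\<exists>p\<in>I. entry Q p p \<noteq> 0 \<and> wt p = (\<lambda>k. \<kappa> k - dl N k))"
proof -
  let ?Z = "cval ` {\<kappa>. phi B \<kappa> \<noteq> 0}" and ?\<xi> = "\<lambda>k. \<kappa> k - dl N k"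
  define Q where "Q = pact Cas (lagrange ?Z real_of_int (cval \<kappa>)) B"
  have main: "phi B \<kappa> \<ge> 0 \<and> (invproj Q \<and> Q * B = Q \<and> Q * Cas = of_int (cval \<kappa>) *\<^sub>R Q \<and>
      (\<exists>p\<in>I. entry Q p p \<noteq> 0 \<and> wt p = ?\<xi>))" if nz: "phi B \<kappa> \<noteq> 0"
  proof -
    have Z: "cval \<kappa> \<in> ?Z" using nz by blast
    have fin: "finite ?Z" by (rule finite_imageI[OF finite_phi])
    have Q: "invproj Q" "Q * B = Q" "Q * Cas = of_int (cval \<kappa>) *\<^sub>R Q" "phi Q \<kappa> = phi B \<kappa>"
      unfolding Q_def
      by (rule casimir_eigenprojections(2)[OF B fin _ _ Z] casimir_eigenprojections(4)[OF B fin _ _ Z]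
          casimir_eigenprojections(3)[OF B fin _ _ Z]; auto simp: inj_on_def)+
        (subst casimir_eigenprojections(5)[OF B fin _ _ Z]; auto simp: inj_on_def)
    have "phi Q (\<lambda>k. ?\<xi> k + dl N k) = mult Q ?\<xi>"
    proof (rule phi_eq_mult, rule ccontr)
      fix s assume s: "s \<in> perms N" "s \<noteq> id"
      assume "mult Q (\<lambda>k. ?\<xi> k + (dl N k - dl N (s k))) \<noteq> 0"
      then obtain p where p: "p \<in> I" "wt p = (\<lambda>k. ?\<xi> k + (dl N k - dl N (s k)))" "entry Q p p \<noteq> 0"
        using mult_nonzero by blast
      \<comment> \<open>The weight \<kappa> - \<delta> s would give |\<kappa> + \<delta> - \<delta>
        s|^2 <= |\<kappa>|^2, hence <\<kappa>, \<delta>> <= <\<kappa>, \<delta> s>, against the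
        rearrangement inequality.\<close>
      have "real_of_int (cval (\<lambda>k. wt p k + dl N k)) \<le> of_int (cval \<kappa>)"
        by (rule casimir_eigenvalue_ge[OF Q(1,3) p(1,3)])
      then have "nsq N (\<lambda>k. wt p k + dl N k) \<le> nsq N \<kappa>" by (simp add: cval_def)
      moreover have "(\<lambda>k. wt p k + dl N k) = (\<lambda>k. \<kappa> k + (dl N k - (dl N \<circ> s) k))"
        by (simp add: p(2) fun_eq_iff)
      ultimately have "2 * ip N \<kappa> (\<lambda>k. dl N k - (dl N \<circ> s) k) \<le> 0"
        using nsq_add[of N \<kappa> "\<lambda>k. dl N k - (dl N \<circ> s) k"] nsq_nonneg[of N "\<lambda>k. dl N k - (dl N \<circ> s) k"]
        by simp
      then have "ip N \<kappa> (dl N) \<le> ip N \<kappa> (dl N \<circ> s)"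
        using ip_diff[of N "dl N" "dl N \<circ> s" \<kappa>] by (simp only: ip_commute[of N \<kappa>]) simp
      then show False using rearrangement[OF s \<kappa> sdec_dl] by simp
    qed
    then have m: "phi B \<kappa> = mult Q ?\<xi>" using Q(4) by simp
    moreover have "mult Q ?\<xi> \<ge> 0"
      unfolding mult_def using invproj_entry_nonneg[OF Q(1)] by (simp add: sum_nonneg)
    moreover have "\<exists>p\<in>I. entry Q p p \<noteq> 0 \<and> wt p = ?\<xi>"
      using mult_nonzero[of Q ?\<xi>] m nz by auto
    ultimately show ?thesis using Q by simp
  qed
  show "phi B \<kappa> \<ge> 0" using main by (cases "phi B \<kappa> = 0") simp_all
  show "\<exists>Q. invproj Q \<and> Q * B = Q \<and> Q * Cas = of_int (cval \<kappa>) *\<^sub>R Q \<and>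
      (\<exists>p\<in>I. entry Q p p \<noteq> 0 \<and> wt p = ?\<xi>)" if "phi B \<kappa> \<noteq> 0"
    using main[OF that] by (intro exI[of _ Q] conjI) (elim conjE; assumption)+
qed

text \<open>\<open>phi_eq_mult_plus\<close> expresses the multiplicity of \<xi> by an integer and
  the multiplicities of weights with larger pairing with \<open>dl\<close>. That pairing is at most
  \<open>K\<close> on weights of nonzero multiplicity, so the recursion ends.\<close>

lemma mult_integral:
  assumes "\<And>\<kappa>. phi B \<kappa> \<in> \<int>"
  shows "mult B \<xi> \<in> \<int>"
proof -
  define K where "K = (\<Sum>p\<in>I. \<bar>ip N (wt p) (dl N)\<bar>)"
  have K: "ip N \<xi> (dl N) \<le> K" if "mult B \<xi> \<noteq> 0" for \<xi>
  proof -
    obtain p where "p \<in> I" "wt p = \<xi>" using mult_nonzero[OF \<open>mult B \<xi> \<noteq> 0\<close>] by blast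
    moreover have "\<bar>ip N (wt p) (dl N)\<bar> \<le> K" if "p \<in> I" for p
      unfolding K_def using finI that by (intro member_le_sum[where f = "\<lambda>p. \<bar>ip N (wt p) (dl N)\<bar>"]) auto
    ultimately show ?thesis by fastforce
  qed
  show ?thesis
  proof (induction "nat (K + 1 - ip N \<xi> (dl N))" arbitrary: \<xi> rule: less_induct)
    case less
    show ?case
    proof (cases "mult B \<xi> = 0")
      case False
      have "mult B (\<lambda>k. \<xi> k + (dl N k - dl N (s k))) \<in> \<int>" if s: "s \<in> perms N - {id}" for s
      proof (rule less)
        have "ip N (dl N \<circ> s) (dl N) < ip N (dl N) (dl N)"
          using rearrangement[of s N "dl N" "dl N"] s by (simp add: ip_commute[of N "dl N \<circ> s"])
        then have "ip N (\<lambda>k. \<xi> k + (dl N k - (dl N \<circ> s) k)) (dl N) > ip N \<xi> (dl N)"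
          by (simp only: ip_add ip_diff)
        then show "nat (K + 1 - ip N (\<lambda>k. \<xi> k + (dl N k - dl N (s k))) (dl N)) < nat (K + 1 - ip N \<xi> (dl N))"
          using K[OF False] by simp
      qed
      then have "(\<Sum>s\<in>perms N - {id}. of_int (sign s) * mult B (\<lambda>k. \<xi> k + (dl N k - dl N (s k)))) \<in> \<int>"
        by (intro Ints_sum) auto
      then have "phi B (\<lambda>k. \<xi> k + dl N k) - (\<Sum>s\<in>perms N - {id}. of_int (sign s) * mult B (\<lambda>k. \<xi> k + (dl N k - dl N (s k)))) \<in> \<int>"
        using assms by (intro Ints_diff)
      then show ?thesis unfolding phi_eq_mult_plus by simp
    qed simp
  qed
qed

text \<open>At a weight of \<open>B\<close> that is maximal in the direction \<theta> all other
  terms of \<open>phi\<close> drop out, so this weight plus \<delta> is a rearrangement of \<mu>.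
  This is the dominance of weights by the highest one, tested against a strictly decreasing
  direction.\<close>

lemma weight_bound:
  assumes B: "invproj B" and \<mu>: "sdec N \<mu>" and \<theta>: "sdec N \<theta>"
    and phi: "\<And>\<kappa>. phi B \<kappa> \<noteq> 0 \<Longrightarrow> \<exists>s\<in>perms N. \<kappa> = \<mu> \<circ> s"
    and p: "p \<in> I" "entry B p p \<noteq> 0"
  shows "ip N \<theta> (wt p) \<le> ip N \<theta> \<mu> - ip N \<theta> (dl N)"
proof -
  let ?S = "{p \<in> I. entry B p p \<noteq> 0}" and ?f = "\<lambda>p. ip N \<theta> (wt p)"
  have fin: "finite (?f ` ?S)" using finI by simp
  have "?f p \<in> ?f ` ?S" using p by blast
  then have "Max (?f ` ?S) \<in> ?f ` ?S" using Max_in[OF fin] by blast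
  then obtain r where r: "r \<in> I" "entry B r r \<noteq> 0" "?f r = Max (?f ` ?S)" by force
  have max: "?f q \<le> ?f r" if "q \<in> I" "entry B q q \<noteq> 0" for q
    unfolding r(3) by (rule Max_ge[OF fin]) (use that in blast)
  have "phi B (\<lambda>k. wt r k + dl N k) = mult B (wt r)"
  proof (rule phi_eq_mult, rule ccontr)
    fix s assume s: "s \<in> perms N" "s \<noteq> id"
    assume "mult B (\<lambda>k. wt r k + (dl N k - dl N (s k))) \<noteq> 0"
    then obtain q where q: "q \<in> I" "wt q = (\<lambda>k. wt r k + (dl N k - (dl N \<circ> s) k))" "entry B q q \<noteq> 0"
      using mult_nonzero by fastforce
    have "?f q = ?f r + (ip N \<theta> (dl N) - ip N \<theta> (dl N \<circ> s))"
      by (simp only: q(2) ip_commute[of N \<theta>] ip_add ip_diff)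
    then show False using max[OF q(1,3)] rearrangement[OF s \<theta> sdec_dl] by simp
  qed
  then have "phi B (\<lambda>k. wt r k + dl N k) \<noteq> 0"
    using mult_pos[OF B r(1,2)] by simp
  then obtain s where s: "s \<in> perms N" "(\<lambda>k. wt r k + dl N k) = \<mu> \<circ> s" using phi by blast
  have "?f r + ip N \<theta> (dl N) = ip N \<theta> (\<mu> \<circ> s)"
    using ip_add_right[of N \<theta> "wt r" "dl N"] s(2) by simp
  also have "\<dots> \<le> ip N \<theta> \<mu>" by (rule rearrangement_le[OF s(1) \<theta> \<mu>])
  finally show ?thesis using max[OF p] by simp
qed

text \<open>\<open>hw \<alpha> B\<close>: the image of the projection \<open>B\<close> is a representation with the Weyl character of
  highest weight \<open>\<alpha>\<close>.\<close>
definition hw :: "(nat \<Rightarrow> int) \<Rightarrow> 'p fmat \<Rightarrow> bool" where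
  "hw \<alpha> B \<longleftrightarrow> invproj B \<and> \<alpha> \<in> weights N \<and> sdec N (\<lambda>k. \<alpha> k + dl N k) \<and>
    (\<forall>x\<in>torus_reg N. alternant N (dl N) x * ch N I wt B x = alternant N (\<lambda>k. \<alpha> k + dl N k) x)"

lemma phi_alternant:
  assumes "\<mu> \<in> weights N" "\<And>x. x \<in> torus_reg N \<Longrightarrow> alternant N (dl N) x * ch N I wt B x = alternant N \<mu> x"
  shows "phi B \<kappa> = of_int (\<Sum>s\<in>{s \<in> perms N. \<mu> \<circ> s = \<kappa>}. sign s)"
proof -
  have "complex_of_real (phi B \<kappa>) = lcoeff (perms N) (\<lambda>s. \<mu> \<circ> s) (\<lambda>s. of_int (sign s)) \<kappa>"
    by (rule phi_eqI) (use assms in \<open>auto simp: weights_comp alternant_eq\<close>)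
  also have "\<dots> = of_real (of_int (\<Sum>s\<in>{s \<in> perms N. \<mu> \<circ> s = \<kappa>}. sign s))"
    by (simp add: lcoeff_def)
  finally show ?thesis by (simp only: of_real_eq_iff)
qed

lemma hw_phi:
  assumes "hw \<alpha> B"
  shows "phi B \<kappa> \<in> \<int>" and "phi B \<kappa> \<noteq> 0 \<Longrightarrow> \<exists>s\<in>perms N. \<kappa> = (\<lambda>k. \<alpha> k + dl N k) \<circ> s"
proof -
  have w: "(\<lambda>k. \<alpha> k + dl N k) \<in> weights N"
    using assms by (auto simp: hw_def weights_def dl_def)
  have ph: "phi B \<kappa> = of_int (\<Sum>s\<in>{s \<in> perms N. (\<lambda>k. \<alpha> k + dl N k) \<circ> s = \<kappa>}. sign s)"
    by (rule phi_alternant[OF w]) (use assms in \<open>auto simp: hw_def\<close>)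
  show "phi B \<kappa> \<in> \<int>" unfolding ph by (rule Ints_of_int)
  assume nz: "phi B \<kappa> \<noteq> 0"
  show "\<exists>s\<in>perms N. \<kappa> = (\<lambda>k. \<alpha> k + dl N k) \<circ> s"
  proof (rule ccontr)
    assume "\<not> ?thesis"
    then have "{s \<in> perms N. (\<lambda>k. \<alpha> k + dl N k) \<circ> s = \<kappa>} = {}" by blast
    then show False using nz unfolding ph by (simp only: sum.empty of_int_0)
  qed
qed

text \<open>All exponents of one alternant have the same norm, so a single linear polynomial
  vanishes at every \<open>cval\<close> that occurs.\<close>

lemma hw_Cas:
  assumes "hw \<alpha> B"
  shows "B * Cas = of_int (cval (\<lambda>k. \<alpha> k + dl N k)) *\<^sub>R B"
proof -
  have "pact Cas [:- of_int (cval (\<lambda>k. \<alpha> k + dl N k)), 1:] B = 0"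
  proof (rule pact_eq_0)
    fix \<kappa> assume "phi B \<kappa> \<noteq> 0"
    then obtain s where "s \<in> perms N" "\<kappa> = (\<lambda>k. \<alpha> k + dl N k) \<circ> s" using hw_phi(2)[OF assms] by blast
    then have "cval \<kappa> = cval (\<lambda>k. \<alpha> k + dl N k)"
      unfolding cval_def using nsq_perm[of s N "\<lambda>k. \<alpha> k + dl N k"] by simp
    then show "poly [:- of_int (cval (\<lambda>k. \<alpha> k + dl N k)), 1:] (of_int (cval \<kappa>)) = (0::real)" by simp
  qed (use assms in \<open>simp add: hw_def\<close>)
  then show ?thesis by simp
qed

end

section \<open>Duals, tensor products and tensor powers of the vector representation\<close>

lemma glrep_dual:
  assumes "glrep N I E wt"
  shows "glrep N I (\<lambda>i j. - E j i) (\<lambda>p k. - wt p k)"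
proof -
  interpret glrep N I E wt by fact
  show ?thesis
  proof
    show "(\<lambda>k. - wt p k) \<in> weights N" if "p \<in> I" for p
      using wt_weights[OF that] by (simp add: weights_def)
    show "- E i i = dg I (\<lambda>p. of_int (- wt p i))" if "i < N" for i
      by (rule fmat_eqI) (auto simp: E_diag[OF that] entry_dg finI)
    show "- E j i * - E l k - - E l k * - E j i =
        (if j = k then - E l i else 0) - (if i = l then - E j k else 0)"
      if "i < N" "j < N" "k < N" "l < N" for i j k l
      using comm_E[OF that(2,1,4,3)] by auto
  qed (simp_all add: finI msupp_uminus msupp_E tp_E)
qed

abbreviation tensor_E where
  "tensor_E I J E E' i j \<equiv> tns (E i j) (one_on J) + tns (one_on I) (E' i j)"

abbreviation tensor_wt :: "('p \<Rightarrow> nat \<Rightarrow> int) \<Rightarrow> ('q \<Rightarrow> nat \<Rightarrow> int) \<Rightarrow> 'p \<times> 'q \<Rightarrow> nat \<Rightarrow> int" where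
  "tensor_wt wt wt' x k \<equiv> wt (fst x) k + wt' (snd x) k"

lemma glrep_tensor:
  assumes "glrep N I E wt" "glrep N J E' wt'"
  shows "glrep N (I \<times> J) (tensor_E I J E E') (tensor_wt wt wt')"
proof -
  interpret V: glrep N I E wt by fact
  interpret W: glrep N J E' wt' by fact
  note fin = V.finI W.finI
  show ?thesis
  proof
    show "finite (I \<times> J)" using fin by simp
    show "(\<lambda>k. wt (fst x) k + wt' (snd x) k) \<in> weights N" if "x \<in> I \<times> J" for x
      using V.wt_weights[of "fst x"] W.wt_weights[of "snd x"] that by (auto simp: weights_def)
    show "msupp (tensor_E I J E E' i j) \<subseteq> I \<times> J" if "i < N" "j < N" for i j
      using that by (intro msupp_plus msupp_tns msupp_dg V.msupp_E W.msupp_E fin)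
    show "tensor_E I J E E' i i =
        dg (I \<times> J) (\<lambda>x. of_int (wt (fst x) i + wt' (snd x) i))" if "i < N" for i
      by (rule fmat_eqI) (auto simp: V.E_diag W.E_diag that entry_dg fin)
    show "tp (tensor_E I J E E' i j) = tensor_E I J E E' j i"
      if "i < N" "j < N" for i j
      using that by (simp add: tp_tns tp_dg fin V.tp_E W.tp_E)
    fix i j k l assume b: "i < N" "j < N" "k < N" "l < N"
    note ones = one_on_times[OF fin(1) V.msupp_E] times_one_on[OF fin(1) V.msupp_E]
      one_on_times[OF fin(2) W.msupp_E] times_one_on[OF fin(2) W.msupp_E]
      one_on_times[OF fin(1) msupp_dg[OF fin(1)]] one_on_times[OF fin(2) msupp_dg[OF fin(2)]]
    have "tensor_E I J E E' i j * tensor_E I J E E' k l -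
        tensor_E I J E E' k l * tensor_E I J E E' i j =
      tns (E i j * E k l - E k l * E i j) (one_on J) + tns (one_on I) (E' i j * E' k l - E' k l * E' i j)"
      by (simp add: distrib_left distrib_right tns_times ones b tns_simps)
    also have "\<dots> = (if j = k then tensor_E I J E E' i l else 0) -
        (if i = l then tensor_E I J E E' k j else 0)"
      unfolding V.comm_E[OF b] W.comm_E[OF b] by (auto simp: tns_simps)
    finally show "tensor_E I J E E' i j * tensor_E I J E E' k l -
        tensor_E I J E E' k l * tensor_E I J E E' i j =
      (if j = k then tensor_E I J E E' i l else 0) -
        (if i = l then tensor_E I J E E' k j else 0)" .
  qed
qed

text \<open>Relabelling of the basis; it lets pairs of a letter and a word be read as words that are
  one letter longer.\<close>

lemma glrep_pull:
  assumes "glrep N I E wt" "finite J" "bij_betw g J I"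
  shows "glrep N J (\<lambda>i j. pull J g (E i j)) (\<lambda>x. wt (g x))"
proof -
  interpret glrep N I E wt by fact
  show ?thesis
  proof
    show "wt (g x) \<in> weights N" if "x \<in> J" for x
      using wt_weights assms(3) that by (auto dest: bij_betwE)
    fix i j k l assume b: "i < N" "j < N" "k < N" "l < N"
    show "pull J g (E i j) * pull J g (E k l) - pull J g (E k l) * pull J g (E i j) =
      (if j = k then pull J g (E i l) else 0) - (if i = l then pull J g (E k j) else 0)"
      using arg_cong[OF comm_E[OF b], of "pull J g"] b
      by (auto simp: pull_simps assms(2) pull_times[OF assms(2,3) disjI1[OF msupp_E]] split: if_splits)
  qed (use assms(2) in \<open>simp_all add: msupp_pull E_diag pull_dg[OF assms(2,3)] pull_simps tp_E\<close>)
qed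

section \<open>The vector representation; invariant projections under tensor products and
  relabelling\<close>

definition munit :: "'p \<Rightarrow> 'p \<Rightarrow> 'p fmat" where
  "munit i j = Abs_fmat (\<lambda>p q. if p = i \<and> q = j then 1 else 0)"

lemma entry_munit: "entry (munit i j) p q = (if p = i \<and> q = j then 1 else 0)"
  unfolding munit_def by (rule entry_Abs[of "{i, j}"]) (auto split: if_splits)

lemma munit_times: "munit i j * munit k l = (if j = k then munit i l else 0)"
proof (rule fmat_eqI)
  fix p q
  have "entry (munit i j * munit k l) p q = (\<Sum>r\<in>{i, j}. entry (munit i j) p r * entry (munit k l) r q)"
    by (rule entry_times) (auto simp: msupp_subset_iff entry_munit split: if_splits)
  also have "\<dots> = (\<Sum>r\<in>{i, j}. if r = j then (if p = i then entry (munit k l) j q else 0) else 0)"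
    by (rule sum.cong) (auto simp: entry_munit)
  also have "\<dots> = (if p = i then entry (munit k l) j q else 0)"
    by (subst sum.delta) auto
  finally show "entry (munit i j * munit k l) p q = entry (if j = k then munit i l else 0) p q"
    by (auto simp: entry_munit)
qed

lemma glrep_vector: "glrep N {..<N} munit eps"
proof
  show "munit i j * munit k l - munit k l * munit i j =
      (if j = k then munit i l else 0) - (if i = l then munit k j else 0)" for i j k l :: nat
    by (auto simp: munit_times)
qed (auto simp: weights_def eps_def msupp_subset_iff entry_munit entry_dg intro!: fmat_eqI split: if_splits)

lemma invproj_one_on:
  assumes "glrep N I E wt"
  shows "glrep.invproj N I E (one_on I)"
proof -
  interpret glrep N I E wt by fact
  show ?thesis
    using finI by (auto simp: invproj_def invariant_def msupp_dg tp_dg one_on_times times_one_on msupp_E)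
qed

lemma invproj_tensor:
  assumes "glrep N I E wt" "glrep N J E' wt'" "glrep.invproj N I E P" "glrep.invproj N J E' Q"
  shows "glrep.invproj N (I \<times> J) (tensor_E I J E E') (tns P Q)"
proof -
  interpret V: glrep N I E wt by fact
  interpret W: glrep N J E' wt' by fact
  interpret T: glrep N "I \<times> J" "tensor_E I J E E'"
    "tensor_wt wt wt'"
    by (rule glrep_tensor) fact+
  have P: "msupp P \<subseteq> I" "P * P = P" "tp P = P" "\<And>i j. i < N \<Longrightarrow> j < N \<Longrightarrow> P * E i j = E i j * P"
    using assms(3) by (auto simp: V.invproj_def V.invariant_def)
  have Q: "msupp Q \<subseteq> J" "Q * Q = Q" "tp Q = Q" "\<And>i j. i < N \<Longrightarrow> j < N \<Longrightarrow> Q * E' i j = E' i j * Q"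
    using assms(4) by (auto simp: W.invproj_def W.invariant_def)
  show ?thesis
    unfolding T.invproj_def T.invariant_def using msupp_tns[OF P(1) Q(1)]
    by (simp add: tns_times tp_tns P Q distrib_left distrib_right one_on_times times_one_on V.finI W.finI)
qed

lemma ch_tensor:
  assumes "x \<in> torus_reg N"
  shows "ch N (I \<times> J) (tensor_wt wt wt') (tns P Q) x = ch N I wt P x * ch N J wt' Q x"
  unfolding ch_def sum_product sum.cartesian_product
  by (rule sum.cong) (auto simp: lmono_add[OF assms])

lemma invproj_pull:
  assumes "glrep N I E wt" "finite J" "bij_betw g J I" "glrep.invproj N I E P"
  shows "glrep.invproj N J (\<lambda>i j. pull J g (E i j)) (pull J g P)"
proof -
  interpret V: glrep N I E wt by fact
  interpret T: glrep N J "\<lambda>i j. pull J g (E i j)" "\<lambda>x. wt (g x)"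
    by (rule glrep_pull) fact+
  have P: "msupp P \<subseteq> I" "P * P = P" "tp P = P" "\<And>i j. i < N \<Longrightarrow> j < N \<Longrightarrow> P * E i j = E i j * P"
    using assms(4) by (auto simp: V.invproj_def V.invariant_def)
  note pt = pull_times[OF assms(2,3), symmetric]
  have "pull J g P * pull J g (E i j) = pull J g (E i j) * pull J g P" if "i < N" "j < N" for i j
    using P(1) P(4)[OF that] by (simp add: pt)
  then show ?thesis
    using P assms(2) by (simp add: T.invproj_def T.invariant_def msupp_pull pull_simps pt)
qed

lemma ch_pull:
  assumes "finite J" "bij_betw g J I"
  shows "ch N J (\<lambda>x. wt (g x)) (pull J g P) x = ch N I wt P x"
  unfolding ch_def
  by (subst sum.reindex_bij_betw[OF assms(2), symmetric]) (simp add: entry_pull assms(1))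

lemma hw_pull:
  assumes "glrep N I E wt" "finite J" "bij_betw g J I" "glrep.hw N I E wt \<alpha> P"
  shows "glrep.hw N J (\<lambda>i j. pull J g (E i j)) (\<lambda>x. wt (g x)) \<alpha> (pull J g P)"
  using assms(4) invproj_pull[OF assms(1-3)] ch_pull[OF assms(2,3)]
  by (simp add: glrep.hw_def[OF assms(1)] glrep.hw_def[OF glrep_pull[OF assms(1-3)]])

text \<open>The highest weight of the dual: minus the longest permutation applied to
  \<alpha>.\<close>

definition dual_weight :: "nat \<Rightarrow> (nat \<Rightarrow> int) \<Rightarrow> nat \<Rightarrow> int" where
  "dual_weight N \<alpha> = (\<lambda>k. if k < N then - \<alpha> (N - 1 - k) else 0)"

lemma rev_perm: "(\<lambda>k. if k < N then N - 1 - k else k) \<in> perms N"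
proof -
  have "bij_betw (\<lambda>k. if k < N then N - 1 - k else k) {..<N} {..<N}"
    by (rule bij_betw_byWitness[where f' = "\<lambda>k. if k < N then N - 1 - k else k"]) auto
  then show ?thesis
    unfolding perms_def mem_Collect_eq by (rule bij_imp_permutes) auto
qed

text \<open>Reversal of the indices turns \<delta> into N - 1 - \<delta>, so inverting the variables
  costs a sign and a monomial. Both are independent of \<alpha> and cancel in quotients of
  alternants.\<close>

lemma alternant_dual:
  assumes x: "x \<in> torus_reg N"
  shows "alternant N (\<lambda>k. dual_weight N \<alpha> k + dl N k) x =
    of_int (sign (\<lambda>k. if k < N then N - 1 - k else k)) * lmono N x (\<lambda>k. int (N - 1)) *
      alternant N (\<lambda>k. \<alpha> k + dl N k) (\<lambda>k. inverse (x k))"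
proof -
  let ?r = "\<lambda>k. if k < N then N - 1 - k else k"
  let ?e = "\<lambda>k. \<alpha> k + dl N k"
  let ?f = "\<lambda>k. int (N - 1) - ?e k"
  have "alternant N (\<lambda>k. dual_weight N \<alpha> k + dl N k) x = alternant N (?f \<circ> ?r) x"
    by (rule alternant_cong) (auto simp: dual_weight_def dl_def of_nat_diff)
  also have "\<dots> = of_int (sign ?r) * alternant N ?f x"
    by (rule alternant_exp_perm[OF rev_perm])
  also have "alternant N ?f x = lmono N x (\<lambda>k. int (N - 1)) * alternant N ?e (\<lambda>k. inverse (x k))"
  proof -
    have "lmono N x (?f \<circ> p) = lmono N x (\<lambda>k. int (N - 1)) * lmono N (\<lambda>k. inverse (x k)) (?e \<circ> p)" for p
    proof -
      have "?f \<circ> p = (\<lambda>k. int (N - 1) + - ?e (p k))" by (simp add: fun_eq_iff)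
      moreover have "lmono N (\<lambda>k. inverse (x k)) (?e \<circ> p) = lmono N x (\<lambda>k. - ?e (p k))"
        unfolding lmono_def power_int_minus power_int_inverse by simp
      ultimately show ?thesis by (simp only: lmono_add[OF x])
    qed
    then show ?thesis by (simp add: alternant_eq sum_distrib_left mult.left_commute)
  qed
  finally show ?thesis by simp
qed

lemma hw_dual:
  assumes "glrep N I E wt" "glrep.hw N I E wt \<alpha> P"
  shows "glrep.hw N I (\<lambda>i j. - E j i) (\<lambda>p k. - wt p k) (dual_weight N \<alpha>) P"
proof -
  interpret V: glrep N I E wt by fact
  interpret D: glrep N I "\<lambda>i j. - E j i" "\<lambda>p k. - wt p k" by (rule glrep_dual) fact
  have P: "V.invproj P" "\<alpha> \<in> weights N" "sdec N (\<lambda>k. \<alpha> k + dl N k)"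
    "\<And>x. x \<in> torus_reg N \<Longrightarrow> alternant N (dl N) x * ch N I wt P x = alternant N (\<lambda>k. \<alpha> k + dl N k) x"
    using assms(2) by (auto simp: V.hw_def)
  have "D.invproj P" using P(1) by (auto simp: V.invproj_def V.invariant_def D.invproj_def D.invariant_def)
  moreover have "dual_weight N \<alpha> \<in> weights N" by (simp add: dual_weight_def weights_def)
  moreover have "sdec N (\<lambda>k. dual_weight N \<alpha> k + dl N k)"
    unfolding sdec_def
  proof (intro allI impI)
    fix i j assume ij: "i < j" "j < N"
    then have "\<alpha> (N - 1 - i) + dl N (N - 1 - i) < \<alpha> (N - 1 - j) + dl N (N - 1 - j)"
      using P(3) unfolding sdec_def by simp
    then show "dual_weight N \<alpha> j + dl N j < dual_weight N \<alpha> i + dl N i"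
      using ij by (simp add: dual_weight_def dl_def of_nat_diff)
  qed
  moreover have "alternant N (dl N) x * ch N I (\<lambda>p k. - wt p k) P x =
      alternant N (\<lambda>k. dual_weight N \<alpha> k + dl N k) x" if x: "x \<in> torus_reg N" for x
  proof -
    let ?y = "\<lambda>k. inverse (x k)"
    have y: "?y \<in> torus_reg N" using x by (auto simp: torus_reg_def)
    have "ch N I (\<lambda>p k. - wt p k) P x = ch N I wt P ?y"
      by (simp add: ch_def lmono_def power_int_minus power_int_inverse)
    \<comment> \<open>The denominator is the case \<alpha> = 0, so it picks up the same sign and
      monomial as the numerator.\<close>
    moreover have "alternant N (dl N) x = alternant N (\<lambda>k. dual_weight N (\<lambda>_. 0) k + dl N k) x"
      by (rule alternant_cong) (auto simp: dual_weight_def)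
    ultimately show ?thesis
      using P(4)[OF y] alternant_dual[OF x, of "\<lambda>_. 0"] alternant_dual[OF x, of \<alpha>]
      by simp
  qed
  ultimately show ?thesis by (simp add: D.hw_def)
qed

text \<open>In the term of p, multiplication by x_k raises the exponent e at the index p k;
  reindexing the sum over k by p makes the result uniform in p.\<close>

lemma alternant_times_power_sum:
  assumes x: "x \<in> torus_reg N"
  shows "(\<Sum>k<N. x k) * alternant N e x = (\<Sum>j<N. alternant N (\<lambda>k. e k + eps j k) x)"
proof -
  have "(\<Sum>k<N. x k) * lmono N x (e \<circ> p) = (\<Sum>j<N. lmono N x ((\<lambda>k. e k + eps j k) \<circ> p))"
    if p: "p \<in> perms N" for p
  proof -
    have "(\<Sum>j<N. lmono N x ((\<lambda>k. e k + eps j k) \<circ> p)) = (\<Sum>k<N. lmono N x ((\<lambda>i. e i + eps (p k) i) \<circ> p))"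
      by (rule sum_perms[OF p, symmetric])
    also have "\<dots> = (\<Sum>k<N. lmono N x (e \<circ> p) * x k)"
    proof (rule sum.cong)
      fix k assume "k \<in> {..<N}"
      then have k: "k < N" by simp
      have "inj p" using p permsD permutes_inj by blast
      then have "(\<lambda>i. e i + eps (p k) i) \<circ> p = (\<lambda>i. (e \<circ> p) i + eps k i)"
        by (auto simp: eps_def fun_eq_iff dest: injD)
      then show "lmono N x ((\<lambda>i. e i + eps (p k) i) \<circ> p) = lmono N x (e \<circ> p) * x k"
        by (simp only: lmono_add[OF x] lmono_eps[OF k])
    qed simp
    finally show ?thesis by (simp add: sum_distrib_right mult.commute)
  qed
  then have "(\<Sum>k<N. x k) * alternant N e x =
      (\<Sum>p\<in>perms N. \<Sum>j<N. of_int (sign p) * lmono N x ((\<lambda>k. e k + eps j k) \<circ> p))"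
    unfolding alternant_eq sum_distrib_left[of "\<Sum>k<N. x k"]
    by (intro sum.cong) (auto simp: mult.left_commute sum_distrib_left[symmetric])
  also have "\<dots> = (\<Sum>j<N. alternant N (\<lambda>k. e k + eps j k) x)"
    unfolding alternant_eq by (rule sum.swap)
  finally show ?thesis .
qed

text \<open>A unit vector at l changes the squared norm by 2 e_l + 1, and the e_l are pairwise
  distinct.\<close>

lemma cval_add_eps:
  assumes "sdec N e" "i < N" "j < N" "nsq N (\<lambda>k. e k + eps i k) = nsq N (\<lambda>k. e k + eps j k)"
  shows "i = j"
proof -
  have "nsq N (\<lambda>k. e k + eps l k) = nsq N e + 2 * e l + 1" if "l < N" for l
    using that unfolding nsq_add by (simp add: nsq_def ip_def eps_def if_distrib cong: if_cong)
  then have "e i = e j" using assms by simp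
  then show ?thesis using assms(1-3) unfolding sdec_def by (metis less_irrefl linorder_neqE_nat)
qed

text \<open>Tensoring with the vector representation adds one box; the resulting constituents have
  pairwise distinct Casimir eigenvalues, so they are separated by eigenprojections.\<close>
lemma pieri:
  assumes R: "glrep N I E wt" and P: "glrep.hw N I E wt \<alpha> P"
  defines "F \<equiv> \<lambda>i j. tns (munit i j) (one_on I) + tns (one_on {..<N}) (E i j)"
  defines "wt' \<equiv> \<lambda>x k. eps (fst x) k + wt (snd x) k"
  shows "\<exists>Q. (\<Sum>j<N. Q j) = tns (one_on {..<N}) P \<and>
    (\<forall>j<N. if sdec N (\<lambda>k. \<alpha> k + eps j k + dl N k)
       then glrep.hw N ({..<N} \<times> I) F wt' (\<lambda>k. \<alpha> k + eps j k) (Q j) else Q j = 0)"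
proof -
  interpret V: glrep N I E wt by fact
  interpret T: glrep N "{..<N} \<times> I" F wt'
    unfolding F_def wt'_def by (rule glrep_tensor[OF glrep_vector R])
  let ?P = "tns (one_on {..<N}) P" and ?e = "\<lambda>j k. (\<alpha> k + dl N k) + eps j k"
  have PP: "V.invproj P" "\<alpha> \<in> weights N" "sdec N (\<lambda>k. \<alpha> k + dl N k)"
    "\<And>x. x \<in> torus_reg N \<Longrightarrow> alternant N (dl N) x * ch N I wt P x = alternant N (\<lambda>k. \<alpha> k + dl N k) x"
    using P by (auto simp: V.hw_def)
  have e_w: "?e j \<in> weights N" if "j < N" for j
    using PP(2) that by (auto simp: weights_def dl_def eps_def)
  have inv: "T.invproj ?P"
    unfolding F_def by (rule invproj_tensor[OF glrep_vector R invproj_one_on[OF glrep_vector] PP(1)])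
  have ch: "alternant N (dl N) x * ch N ({..<N} \<times> I) wt' ?P x = (\<Sum>j<N. alternant N (?e j) x)"
    if x: "x \<in> torus_reg N" for x
  proof -
    have "ch N {..<N} eps (one_on {..<N}) x = (\<Sum>k<N. x k)"
      by (simp add: ch_def entry_dg lmono_eps)
    then show ?thesis
      using alternant_times_power_sum[OF x, of "\<lambda>k. \<alpha> k + dl N k"] PP(4)[OF x]
      unfolding wt'_def ch_tensor[OF x] by (simp add: mult.left_commute)
  qed
  let ?n = "\<lambda>j \<kappa>. \<Sum>s\<in>{s \<in> perms N. ?e j \<circ> s = \<kappa>}. sign s"
  have phi: "T.phi ?P \<kappa> = (\<Sum>j<N. of_int (?n j \<kappa>))" for \<kappa>
  proof -
    have "complex_of_real (T.phi ?P \<kappa>) =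
        lcoeff ({..<N} \<times> perms N) (\<lambda>(j, s). ?e j \<circ> s) (\<lambda>(j, s). of_int (sign s)) \<kappa>"
    proof (rule T.phi_eqI)
      show "(\<lambda>(j, s). ?e j \<circ> s) ` ({..<N} \<times> perms N) \<subseteq> weights N"
        using e_w weights_comp by auto
      fix x assume x: "x \<in> torus_reg N"
      show "alternant N (dl N) x * ch N ({..<N} \<times> I) wt' ?P x =
          (\<Sum>w\<in>{..<N} \<times> perms N. (case w of (j, s) \<Rightarrow> of_int (sign s)) * lmono N x (case w of (j, s) \<Rightarrow> ?e j \<circ> s))"
        unfolding ch[OF x] unfolding alternant_eq sum.cartesian_product by (intro sum.cong) auto
    qed simp
    also have "{w \<in> {..<N} \<times> perms N. (case w of (j, s) \<Rightarrow> ?e j \<circ> s) = \<kappa>} =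
        (SIGMA j:{..<N}. {s \<in> perms N. ?e j \<circ> s = \<kappa>})" by auto
    then have "lcoeff ({..<N} \<times> perms N) (\<lambda>(j, s). ?e j \<circ> s) (\<lambda>(j, s). of_int (sign s)) \<kappa> =
        complex_of_real (\<Sum>j<N. of_int (?n j \<kappa>))"
      by (simp add: lcoeff_def sum.Sigma[symmetric])
    finally show ?thesis by (simp only: of_real_eq_iff)
  qed
  define c where "c = (\<lambda>j. real_of_int (T.cval (?e j)))"
  have c_inj: "inj_on c {..<N}"
    using cval_add_eps[OF PP(3)] by (auto simp: inj_on_def c_def T.cval_def)
  have n: "of_int (T.cval \<kappa>) = c j" if "?n j \<kappa> \<noteq> 0" for j \<kappa>
  proof -
    have "\<exists>s\<in>perms N. ?e j \<circ> s = \<kappa>" using that by (metis (mono_tags, lifting) mem_Collect_eq sum.neutral)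
    then show ?thesis using nsq_perm by (auto simp: c_def T.cval_def)
  qed
  have spec: "of_int (T.cval \<kappa>) \<in> c ` {..<N}" if "T.phi ?P \<kappa> \<noteq> 0" for \<kappa>
  proof -
    have "\<exists>j<N. ?n j \<kappa> \<noteq> 0" using that unfolding phi by (metis (mono_tags, lifting) lessThan_iff of_int_0 sum.neutral)
    then show ?thesis using n by blast
  qed
  define Q where "Q = (\<lambda>j. pact T.Cas (lagrange {..<N} c j) ?P)"
  have Qsum: "(\<Sum>j<N. Q j) = ?P"
    unfolding Q_def by (rule T.casimir_eigenprojections(1)[OF inv _ c_inj spec]) simp_all
  have Qinv: "T.invproj (Q j)" if "j < N" for j
    unfolding Q_def by (rule T.casimir_eigenprojections(2)[OF inv _ c_inj spec]) (use that in simp_all)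
  \<comment> \<open>The eigenprojection keeps the exponents with Casimir value \<open>c j\<close>.
    Since the values \<open>c i\<close> are distinct, only the j-th alternant contributes.\<close>
  have Qphi: "T.phi (Q j) \<kappa> = of_int (?n j \<kappa>)" if j: "j < N" for j \<kappa>
  proof -
    have "T.phi (Q j) \<kappa> = (if of_int (T.cval \<kappa>) = c j then T.phi ?P \<kappa> else 0)"
      unfolding Q_def by (rule T.casimir_eigenprojections(5)[OF inv _ c_inj spec]) (use j in simp_all)
    also have "\<dots> = of_int (?n j \<kappa>)"
    proof (cases "of_int (T.cval \<kappa>) = c j")
      case True
      then have "?n i \<kappa> = 0" if "i < N" "i \<noteq> j" for i
        using n[of i \<kappa>] c_inj that j by (auto dest: inj_onD)
      then have "(\<Sum>i<N. real_of_int (?n i \<kappa>)) = (\<Sum>i<N. if i = j then of_int (?n j \<kappa>) else 0)"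
        by (intro sum.cong) (auto simp del: of_int_sum)
      then show ?thesis using True j by (simp add: phi del: of_int_sum)
    next
      case False
      then show ?thesis using n[of j \<kappa>] by (auto simp del: of_int_sum)
    qed
    finally show ?thesis .
  qed
  have Qch: "alternant N (dl N) x * ch N ({..<N} \<times> I) wt' (Q j) x = alternant N (?e j) x"
    if j: "j < N" and x: "x \<in> torus_reg N" for j x
  proof -
    let ?S = "{\<kappa>. T.phi (Q j) \<kappa> \<noteq> 0} \<union> (\<lambda>s. ?e j \<circ> s) ` perms N"
    have fin: "finite ?S" using T.finite_phi by simp
    have l: "lcoeff (perms N) (\<lambda>s. ?e j \<circ> s) (\<lambda>s. of_int (sign s)) \<kappa> = complex_of_real (T.phi (Q j) \<kappa>)" for \<kappa>
      by (simp add: lcoeff_def Qphi[OF j])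
    have "alternant N (?e j) x = (\<Sum>\<kappa>\<in>?S. of_real (T.phi (Q j) \<kappa>) * lmono N x \<kappa>)"
      unfolding alternant_eq l[symmetric] by (rule lcoeff_expand) (use fin in auto)
    also have "\<dots> = (\<Sum>\<kappa> | T.phi (Q j) \<kappa> \<noteq> 0. of_real (T.phi (Q j) \<kappa>) * lmono N x \<kappa>)"
      by (rule sum.mono_neutral_right) (use fin in auto)
    finally show ?thesis using T.den_ch_phi[OF x] by simp
  qed
  have "Q j = 0" if j: "j < N" and nd: "\<not> sdec N (?e j)" for j
  proof (rule T.invproj_zero_if_phi_zero[OF Qinv[OF j]])
    \<comment> \<open>One unit added to a strictly decreasing integer sequence can at worst make two
      entries equal, and then the alternant is zero.\<close>
    obtain a b where ab: "a < b" "b < N" "?e j a \<le> ?e j b" using nd unfolding sdec_def by force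
    have "\<alpha> b + dl N b < \<alpha> a + dl N a" using PP(3) ab unfolding sdec_def by blast
    then have "?e j a = ?e j b" using ab by (auto simp: eps_def split: if_splits)
    then have z: "alternant N (?e j) x = 0" for x
      using ab by (intro alternant_exp_repeated[of a N b]) auto
    fix \<kappa>
    have "complex_of_real (T.phi (Q j) \<kappa>) = lcoeff {} (\<lambda>s. ?e j \<circ> s) (\<lambda>s. 0) \<kappa>"
      by (rule T.phi_eqI) (use Qch[OF j] z in auto)
    then show "T.phi (Q j) \<kappa> = 0" by (simp add: lcoeff_def)
  qed
  moreover have e_eq: "?e j = (\<lambda>k. \<alpha> k + eps j k + dl N k)" for j by (simp add: fun_eq_iff)
  moreover have "T.hw (\<lambda>k. \<alpha> k + eps j k) (Q j)" if j: "j < N" and "sdec N (?e j)" for j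
    using Qinv[OF j] Qch[OF j] that PP(2) e_eq unfolding T.hw_def by (auto simp: weights_def eps_def)
  ultimately show ?thesis using Qsum by (intro exI[of _ Q]) simp
qed

section \<open>Words as a basis of the tensor powers\<close>

definition word_split :: "nat \<Rightarrow> (nat \<Rightarrow> nat) \<Rightarrow> nat \<times> (nat \<Rightarrow> nat)" where
  "word_split m f = (f m, f(m := 0))"

lemma bij_word_split: "bij_betw (word_split m) (idx N (Suc m)) ({..<N} \<times> idx N m)"
  by (rule bij_betw_byWitness[where f' = "\<lambda>(a, f). f(m := a)"])
    (auto simp: word_split_def idx_def less_Suc_eq fun_eq_iff)

lemma idx_0: "idx N 0 = {\<lambda>_. 0}"
  by (auto simp: idx_def)

lemma finite_idx [simp]: "finite (idx N m)"
proof (induction m)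
  case (Suc m)
  then show ?case using bij_betw_finite[OF bij_word_split] by blast
qed (simp add: idx_0)

text \<open>The Leibniz action on the tensor power, built one letter at a time so that it inherits
  its properties from \<open>glrep_tensor\<close>. The reset position in \<open>word_split\<close>
  matches the padding zeros of \<open>idx\<close>.\<close>

primrec word_E :: "nat \<Rightarrow> nat \<Rightarrow> nat \<Rightarrow> nat \<Rightarrow> (nat \<Rightarrow> nat) fmat" where
  "word_E N 0 = (\<lambda>i j. 0)"
| "word_E N (Suc m) = (\<lambda>i j. pull (idx N (Suc m)) (word_split m)
     (tns (munit i j) (one_on (idx N m)) + tns (one_on {..<N}) (word_E N m i j)))"

definition word_wt :: "nat \<Rightarrow> (nat \<Rightarrow> nat) \<Rightarrow> nat \<Rightarrow> int" where
  "word_wt m f k = (\<Sum>a<m. eps (f a) k)"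

lemma word_wt_0: "word_wt 0 = (\<lambda>_ _. 0)"
  by (simp add: word_wt_def fun_eq_iff)

lemma word_wt_Suc:
  "word_wt (Suc m) = (\<lambda>f k. eps (fst (word_split m f)) k + word_wt m (snd (word_split m f)) k)"
  by (simp add: word_wt_def word_split_def fun_eq_iff add.commute)

lemma glrep_words: "glrep N (idx N m) (word_E N m) (word_wt m)"
proof (induction m)
  case 0
  show ?case
    by standard (auto simp: idx_0 word_wt_0 weights_def entry_dg intro!: fmat_eqI)
next
  case (Suc m)
  show ?case
    unfolding word_E.simps word_wt_Suc
    by (rule glrep_pull[OF glrep_tensor[OF glrep_vector Suc] finite_idx bij_word_split])
qed

definition word_hw :: "nat \<Rightarrow> nat \<Rightarrow> (nat \<Rightarrow> int) \<Rightarrow> (nat \<Rightarrow> nat) fmat \<Rightarrow> bool" where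
  "word_hw N m = glrep.hw N (idx N m) (word_E N m) (word_wt m)"

text \<open>Partitions of m with at most N parts, padded by zeros; strict decrease after adding
  \<open>dl\<close> encodes weak decrease of \<alpha>.\<close>

definition poly_weight :: "nat \<Rightarrow> nat \<Rightarrow> (nat \<Rightarrow> int) \<Rightarrow> bool" where
  "poly_weight N m \<alpha> \<longleftrightarrow> \<alpha> \<in> weights N \<and> (\<forall>k. \<alpha> k \<ge> 0) \<and> (\<Sum>k<N. \<alpha> k) = int m \<and>
     sdec N (\<lambda>k. \<alpha> k + dl N k)"

lemma pull_sum: "finite J \<Longrightarrow> pull J g (\<Sum>i\<in>S. F i) = (\<Sum>i\<in>S. pull J g (F i))"
  by (rule fmat_eqI) (auto simp: entry_pull intro!: sum.neutral)

abbreviation extend :: "nat \<Rightarrow> nat \<Rightarrow> (nat \<Rightarrow> nat) fmat \<Rightarrow> (nat \<Rightarrow> nat) fmat" where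
  "extend N m P \<equiv> pull (idx N (Suc m)) (word_split m) (tns (one_on {..<N}) P)"

lemma word_pieri:
  assumes "word_hw N m \<alpha> P"
  shows "\<exists>Q. (\<Sum>j<N. Q j) = extend N m P \<and>
    (\<forall>j<N. if sdec N (\<lambda>k. \<alpha> k + eps j k + dl N k)
       then word_hw N (Suc m) (\<lambda>k. \<alpha> k + eps j k) (Q j) else Q j = 0)"
proof -
  note R = glrep_words[of N m]
  obtain Q where Q: "(\<Sum>j<N. Q j) = tns (one_on {..<N}) P"
    "\<forall>j<N. if sdec N (\<lambda>k. \<alpha> k + eps j k + dl N k)
       then glrep.hw N ({..<N} \<times> idx N m) (\<lambda>i j. tns (munit i j) (one_on (idx N m)) + tns (one_on {..<N}) (word_E N m i j))
         (\<lambda>x k. eps (fst x) k + word_wt m (snd x) k) (\<lambda>k. \<alpha> k + eps j k) (Q j) else Q j = 0"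
    using pieri[OF R assms[unfolded word_hw_def]] by blast
  let ?Q = "\<lambda>j. pull (idx N (Suc m)) (word_split m) (Q j)"
  have "(\<Sum>j<N. ?Q j) = extend N m P"
    by (simp only: pull_sum[OF finite_idx, symmetric] Q(1))
  moreover have "if sdec N (\<lambda>k. \<alpha> k + eps j k + dl N k)
       then word_hw N (Suc m) (\<lambda>k. \<alpha> k + eps j k) (?Q j) else ?Q j = 0" if "j < N" for j
    using Q(2) that hw_pull[OF glrep_tensor[OF glrep_vector R] finite_idx bij_word_split]
    unfolding word_hw_def word_E.simps word_wt_Suc
    by (auto simp: pull_simps split: if_splits)
  ultimately show ?thesis by (intro exI[of _ ?Q]) simp
qed

lemma word_hw_0: "word_hw N 0 (\<lambda>_. 0) (one_on (idx N 0))"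
proof -
  interpret glrep N "idx N 0" "word_E N 0" "word_wt 0" by (rule glrep_words)
  have "ch N (idx N 0) (word_wt 0) (one_on (idx N 0)) x = 1" for x
    by (simp add: ch_def idx_0 entry_dg word_wt_0 lmono_def)
  then show ?thesis
    unfolding word_hw_def hw_def
    using invproj_one_on[OF glrep_words[of N 0]] by (simp add: weights_def)
qed

lemma poly_weight_0: "poly_weight N 0 \<alpha> \<longleftrightarrow> \<alpha> = (\<lambda>_. 0)"
proof
  assume a: "poly_weight N 0 \<alpha>"
  then have "\<forall>k\<in>{..<N}. \<alpha> k = 0"
    by (subst sum_nonneg_eq_0_iff[symmetric]) (auto simp: poly_weight_def)
  then have "\<alpha> k = 0" for k
    using a by (cases "k < N") (simp_all add: poly_weight_def weights_def)
  then show "\<alpha> = (\<lambda>_. 0)" by blast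
qed (simp add: poly_weight_def weights_def)

lemma poly_weight_add:
  assumes "poly_weight N m \<alpha>" "j < N" "sdec N (\<lambda>k. \<alpha> k + eps j k + dl N k)"
  shows "poly_weight N (Suc m) (\<lambda>k. \<alpha> k + eps j k)"
proof -
  have "(\<Sum>k<N. eps j k) = 1" using assms(2) by (simp add: eps_def)
  then show ?thesis
    using assms by (auto simp: poly_weight_def weights_def sum.distrib) (auto simp: eps_def)
qed

text \<open>The last nonzero row always has a removable box.\<close>

lemma poly_weight_remove:
  assumes "poly_weight N (Suc m) \<alpha>"
  shows "\<exists>j<N. poly_weight N m (\<lambda>k. \<alpha> k - eps j k)"
proof -
  have \<alpha>: "\<alpha> \<in> weights N" "\<And>k. \<alpha> k \<ge> 0" "(\<Sum>k<N. \<alpha> k) = int (Suc m)" "sdec N (\<lambda>k. \<alpha> k + dl N k)"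
    using assms by (auto simp: poly_weight_def)
  let ?S = "{k. k < N \<and> \<alpha> k > 0}"
  have "?S \<noteq> {}"
  proof
    assume "?S = {}"
    then have "(\<Sum>k<N. \<alpha> k) = 0" using \<alpha>(2) by (intro sum.neutral) (auto simp: order.order_iff_strict)
    then show False using \<alpha>(3) by simp
  qed
  define j where "j = Max ?S"
  have j: "j < N" "\<alpha> j > 0" using Max_in[of ?S] \<open>?S \<noteq> {}\<close> by (auto simp: j_def)
  have above: "\<alpha> k = 0" if "j < k" "k < N" for k
  proof (rule ccontr)
    assume "\<alpha> k \<noteq> 0"
    then have "k \<in> ?S" using \<alpha>(2)[of k] that by auto
    then have "k \<le> j" unfolding j_def by (intro Max_ge) auto
    then show False using that by simp
  qed
  have "sdec N (\<lambda>k. \<alpha> k - eps j k + dl N k)"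
    unfolding sdec_def
  proof (intro allI impI)
    fix a b assume ab: "a < b" "b < N"
    have "dl N b < dl N a" using ab by (auto simp: dl_def)
    moreover have "\<alpha> b + dl N b < \<alpha> a + dl N a" using \<alpha>(4) ab unfolding sdec_def by blast
    ultimately show "\<alpha> b - eps j b + dl N b < \<alpha> a - eps j a + dl N a"
      using above[of b] ab j by (auto simp: eps_def)
  qed
  moreover have "(\<Sum>k<N. eps j k) = 1" using j by (simp add: eps_def)
  ultimately have "poly_weight N m (\<lambda>k. \<alpha> k - eps j k)"
    using \<alpha> j by (auto simp: poly_weight_def weights_def sum_subtractf) (auto simp: eps_def)
  then show ?thesis using j by blast
qed

text \<open>A box is removed, the smaller weight is realised by induction, and the Pieri rule
  restores the box.\<close>

lemma word_hw_exists: "poly_weight N m \<alpha> \<Longrightarrow> \<exists>P. word_hw N m \<alpha> P"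
proof (induction m arbitrary: \<alpha>)
  case 0
  then show ?case using word_hw_0 by (auto simp: poly_weight_0)
next
  case (Suc m)
  obtain j where j: "j < N" "poly_weight N m (\<lambda>k. \<alpha> k - eps j k)" using poly_weight_remove[OF Suc.prems] by blast
  obtain P where P: "word_hw N m (\<lambda>k. \<alpha> k - eps j k) P" using Suc.IH[OF j(2)] by blast
  have "sdec N (\<lambda>k. \<alpha> k - eps j k + eps j k + dl N k)" using Suc.prems by (simp add: poly_weight_def)
  then show ?case using word_pieri[OF P] j(1) by force
qed

text \<open>The extension is the identity on the new letter, so it acts on each slice with fixed
  last letter separately.\<close>

lemma rv_extend:
  assumes "msupp P \<subseteq> idx N m" "b < N" "f \<in> idx N m"
  shows "rv v (extend N m P) (f(m := b)) = rv (\<lambda>g. v (g(m := b))) P f"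
proof -
  have s: "word_split m (g(m := a)) = (a, g)" if "g \<in> idx N m" for a g
    using that by (auto simp: word_split_def idx_def fun_eq_iff)
  have in_idx: "g(m := a) \<in> idx N (Suc m)" if "g \<in> idx N m" "a < N" for a g
    using that by (auto simp: idx_def less_Suc_eq)
  have bij: "bij_betw (\<lambda>(a, g). g(m := a)) ({..<N} \<times> idx N m) (idx N (Suc m))"
    by (rule bij_betw_byWitness[where f' = "word_split m"])
      (auto simp: word_split_def idx_def less_Suc_eq fun_eq_iff)
  have "rv v (extend N m P) (f(m := b)) =
      (\<Sum>h\<in>idx N (Suc m). v h * of_real (entry (extend N m P) h (f(m := b))))"
    by (rule rv_eq[OF finite_idx msupp_pull[OF finite_idx]])
  also have "\<dots> = (\<Sum>(a, g)\<in>{..<N} \<times> idx N m. v (g(m := a)) * of_real (entry (extend N m P) (g(m := a)) (f(m := b))))"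
    by (subst sum.reindex_bij_betw[OF bij, symmetric]) (simp add: case_prod_unfold)
  also have "\<dots> = (\<Sum>(a, g)\<in>{..<N} \<times> idx N m. if a = b then v (g(m := b)) * of_real (entry P g f) else 0)"
    by (rule sum.cong) (use assms in \<open>auto simp: entry_pull in_idx s entry_dg\<close>)
  also have "\<dots> = (\<Sum>a<N. if a = b then (\<Sum>g\<in>idx N m. v (g(m := b)) * of_real (entry P g f)) else 0)"
    unfolding sum.cartesian_product[symmetric] by (intro sum.cong) auto
  also have "\<dots> = (\<Sum>g\<in>idx N m. v (g(m := b)) * of_real (entry P g f))"
    using assms(2) by simp
  also have "\<dots> = rv (\<lambda>g. v (g(m := b))) P f"
    by (rule rv_eq[OF finite_idx assms(1), symmetric])
  finally show ?thesis .
qed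

lemma word_hw_msupp: "word_hw N m \<alpha> P \<Longrightarrow> msupp P \<subseteq> idx N m"
  unfolding word_hw_def
  by (simp add: glrep.hw_def[OF glrep_words] glrep.invproj_def[OF glrep_words] glrep.invariant_def[OF glrep_words])

text \<open>Each \<open>extend N m P\<close> is a sum of highest weight projections on longer words,
  so a vector killed by all of these has all its slices killed by \<open>P\<close>. The statement
  serves as completeness of the decomposition of the tensor power.\<close>

lemma word_hw_span:
  assumes "\<And>\<alpha> P q. poly_weight N m \<alpha> \<Longrightarrow> word_hw N m \<alpha> P \<Longrightarrow> rv v P q = 0" and "p \<in> idx N m"
  shows "v p = 0"
  using assms
proof (induction m arbitrary: v p)
  case 0
  have "rv v (one_on (idx N 0)) p = v p" by (rule rv_one_on[OF finite_idx 0(2)])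
  then show ?case using 0(1)[OF _ word_hw_0] by (simp add: poly_weight_0)
next
  case (Suc m)
  have "rv v (extend N m P) q = 0" if P: "poly_weight N m \<alpha>" "word_hw N m \<alpha> P" for \<alpha> P q
  proof -
    obtain Q where Q: "(\<Sum>j<N. Q j) = extend N m P"
      "\<forall>j<N. if sdec N (\<lambda>k. \<alpha> k + eps j k + dl N k)
         then word_hw N (Suc m) (\<lambda>k. \<alpha> k + eps j k) (Q j) else Q j = 0"
      using word_pieri[OF P(2)] by blast
    have "rv v (Q j) q = 0" if j: "j < N" for j
      using Q(2) j Suc.prems(1)[OF poly_weight_add[OF P(1) j], of "Q j" q] by (auto split: if_splits)
    then show ?thesis unfolding Q(1)[symmetric] rv_sum by simp
  qed
  then have slice: "rv (\<lambda>g. v (g(m := b))) P f = 0"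
    if "poly_weight N m \<alpha>" "word_hw N m \<alpha> P" "b < N" for \<alpha> P b f
  proof (cases "f \<in> idx N m")
    case True
    show ?thesis using rv_extend[OF word_hw_msupp[OF that(2)] that(3) True, of v]
      \<open>\<And>q P \<alpha>. poly_weight N m \<alpha> \<Longrightarrow> word_hw N m \<alpha> P \<Longrightarrow> rv v (extend N m P) q = 0\<close>[OF that(1,2)] by simp
  next
    case False
    then have "entry P g f = 0" for g using word_hw_msupp[OF that(2)] by (auto intro: entry_eq_0)
    then show ?thesis by (simp add: rv_def)
  qed
  have "p m < N" "p(m := 0) \<in> idx N m" using Suc.prems(2) by (auto simp: idx_def)
  then have "(\<lambda>g. v (g(m := p m))) (p(m := 0)) = 0"
    using Suc.IH[of "\<lambda>g. v (g(m := p m))" "p(m := 0)"] slice by blast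
  then show ?case by simp
qed

text \<open>The recursion unfolded: the last letter gives the summand a = m, and an unchanged last
  letter gives the others. This form can be compared with \<open>tau\<close>.\<close>

lemma entry_word_E:
  assumes "f \<in> idx N m" "g \<in> idx N m" "i < N"
  shows "entry (word_E N m i j) f g = (\<Sum>a<m. if g a = j \<and> f = g(a := i) then 1 else 0)"
  using assms
proof (induction m arbitrary: f g)
  case (Suc m)
  have fg: "f(m := 0) \<in> idx N m" "g(m := 0) \<in> idx N m" "f m < N" "g m < N"
    using Suc.prems by (auto simp: idx_def)
  have "entry (word_E N (Suc m) i j) f g =
      entry (munit i j) (f m) (g m) * entry (one_on (idx N m)) (f(m := 0)) (g(m := 0)) +
      entry (one_on {..<N}) (f m) (g m) * entry (word_E N m i j) (f(m := 0)) (g(m := 0))"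
    using Suc.prems by (simp only: word_E.simps entry_pull[OF finite_idx] word_split_def entry_plus
        entry_tns fst_conv snd_conv simp_thms if_True)
  also have "\<dots> =
      (if f m = i \<and> g m = j \<and> f(m := 0) = g(m := 0) then 1 else 0) +
      (if f m = g m then (\<Sum>a<m. if (g(m := 0)) a = j \<and> f(m := 0) = (g(m := 0))(a := i) then 1 else 0) else 0)"
    unfolding Suc.IH[OF fg(1,2) Suc.prems(3)] entry_munit entry_dg[OF finite_idx] entry_dg[OF finite_lessThan]
    using fg by (simp only: lessThan_iff) simp
  also have "f m = i \<and> g m = j \<and> f(m := 0) = g(m := 0) \<longleftrightarrow> g m = j \<and> f = g(m := i)"
    by (metis fun_upd_same fun_upd_triv fun_upd_upd)
  also have "(if f m = g m then (\<Sum>a<m. if (g(m := 0)) a = j \<and> f(m := 0) = (g(m := 0))(a := i) then 1 else 0) else 0) =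
      (\<Sum>a<m. if g a = j \<and> f = g(a := i) then 1 else (0::real))"
  proof (cases "f m = g m")
    case True
    have "f(m := 0) = (g(m := 0))(a := i) \<longleftrightarrow> f = g(a := i)" if "a < m" for a
      using True that by (auto simp: fun_eq_iff split: if_splits)
    then show ?thesis using True by (auto intro!: sum.cong)
  next
    case False
    then have "f \<noteq> g(a := i)" if "a < m" for a using that by auto
    then show ?thesis using False by (auto intro!: sum.neutral[symmetric])
  qed
  finally show ?case by (simp only: sum.lessThan_Suc add.commute)
qed simp

section \<open>Highest weights and contents of pairs of partitions\<close>

definition plus_dl :: "nat \<Rightarrow> (nat \<Rightarrow> int) \<Rightarrow> nat \<Rightarrow> int" where
  "plus_dl N \<alpha> = (\<lambda>k. \<alpha> k + dl N k)"

lemma is_partition_mono: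
  assumes "is_partition \<mu>" "i \<le> j" "j < length \<mu>"
  shows "\<mu> ! j \<le> \<mu> ! i"
proof (cases "i = j")
  case False
  then show ?thesis
    using assms sorted_wrt_nth_less[of "(\<ge>)" \<mu> i j] by (simp add: is_partition_def)
qed simp

lemma is_partition_pos: "is_partition \<mu> \<Longrightarrow> j < length \<mu> \<Longrightarrow> 0 < \<mu> ! j"
  by (simp add: is_partition_def)

lemma hweight_pos: "k < length \<mu> \<Longrightarrow> hweight N (\<mu>, \<nu>) k = int (\<mu> ! k)"
  by (simp add: hweight_def)

lemma hweight_neg:
  assumes "length \<mu> + length \<nu> \<le> N" "j < length \<nu>"
  shows "hweight N (\<mu>, \<nu>) (N - 1 - j) = - int (\<nu> ! j)"
proof -
  have "\<not> N - 1 - j < length \<mu>" "N - length \<nu> \<le> N - 1 - j" "N - 1 - j < N" "N - 1 - (N - 1 - j) = j"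
    using assms by auto
  then show ?thesis unfolding hweight_def by (simp only: fst_conv snd_conv if_False if_True simp_thms)
qed

lemma hweight_zero:
  "length \<mu> \<le> k \<Longrightarrow> k < N - length \<nu> \<or> N \<le> k \<Longrightarrow> hweight N (\<mu>, \<nu>) k = 0"
  by (auto simp: hweight_def)

lemma hweight_cases [consumes 2, case_names pos neg zero]:
  assumes "length \<mu> + length \<nu> \<le> N" "k < N"
  obtains "k < length \<mu>" "hweight N (\<mu>, \<nu>) k = int (\<mu> ! k)"
  | j where "j < length \<nu>" "k = N - 1 - j" "hweight N (\<mu>, \<nu>) k = - int (\<nu> ! j)"
  | "length \<mu> \<le> k" "k < N - length \<nu>" "hweight N (\<mu>, \<nu>) k = 0"
proof -
  consider "k < length \<mu>" | "length \<mu> \<le> k" "k < N - length \<nu>" | "N - length \<nu> \<le> k" by linarith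
  then show ?thesis
  proof cases
    case 1
    then show ?thesis using that(1) hweight_pos by blast
  next
    case 2
    then show ?thesis using that(3) hweight_zero by blast
  next
    case 3
    then have "N - 1 - k < length \<nu>" "k = N - 1 - (N - 1 - k)" using assms by auto
    then show ?thesis using that(2) hweight_neg[OF assms(1)] by metis
  qed
qed

text \<open>The middle block of zeros contributes nothing, and the last block is reversed because
  \<nu> is read from the end.\<close>

lemma sum_hweight:
  fixes f :: "nat \<Rightarrow> int \<Rightarrow> 'a::ab_group_add"
  assumes len: "length \<mu> + length \<nu> \<le> N" and f: "\<And>k. f k 0 = 0"
  shows "(\<Sum>k<N. f k (hweight N (\<mu>, \<nu>) k)) =
    (\<Sum>i<length \<mu>. f i (int (\<mu> ! i))) + (\<Sum>j<length \<nu>. f (N - 1 - j) (- int (\<nu> ! j)))"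
proof -
  let ?g = "\<lambda>k. f k (hweight N (\<mu>, \<nu>) k)" and ?l = "length \<mu>" and ?r = "N - length \<nu>"
  have "{..<N} = {..<?l} \<union> ({?l..<?r} \<union> {?r..<N})" using len by auto
  then have "sum ?g {..<N} = sum ?g {..<?l} + (sum ?g {?l..<?r} + sum ?g {?r..<N})"
  proof -
    have "sum ?g ({..<?l} \<union> ({?l..<?r} \<union> {?r..<N})) = sum ?g {..<?l} + sum ?g ({?l..<?r} \<union> {?r..<N})"
      by (rule sum.union_disjoint) (use len in auto)
    moreover have "sum ?g ({?l..<?r} \<union> {?r..<N}) = sum ?g {?l..<?r} + sum ?g {?r..<N}"
      by (rule sum.union_disjoint) auto
    ultimately show ?thesis using \<open>{..<N} = _\<close> by simp
  qed
  also have "sum ?g {?l..<?r} = 0"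
    by (rule sum.neutral) (auto simp: hweight_zero f)
  also have "sum ?g {?r..<N} = (\<Sum>j<length \<nu>. ?g (N - 1 - j))"
    by (rule sum.reindex_bij_witness[where i = "\<lambda>j. N - 1 - j" and j = "\<lambda>k. N - 1 - k"])
      (use len in auto)
  also have "(\<Sum>j<length \<nu>. ?g (N - 1 - j)) = (\<Sum>j<length \<nu>. f (N - 1 - j) (- int (\<nu> ! j)))"
    by (rule sum.cong) (simp_all only: lessThan_iff hweight_neg[OF len])
  finally show ?thesis by (simp add: hweight_pos)
qed

lemma hweight_weights: "valid_pair N p \<Longrightarrow> hweight N p \<in> weights N"
  by (auto simp: weights_def hweight_def valid_pair_def)

lemma hweight_dominant:
  assumes "valid_pair N p"
  shows "sdec N (plus_dl N (hweight N p))"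
proof -
  obtain \<mu> \<nu> where p: "p = (\<mu>, \<nu>)" by (cases p)
  have v: "is_partition \<mu>" "is_partition \<nu>" "length \<mu> + length \<nu> \<le> N"
    using assms by (auto simp: valid_pair_def p)
  have "hweight N (\<mu>, \<nu>) j \<le> hweight N (\<mu>, \<nu>) i" if ij: "i < j" "j < N" for i j
  proof -
    have iN: "i < N" using ij by simp
    show ?thesis
      using v(3) ij(2)
    proof (cases rule: hweight_cases)
      case pos
      then show ?thesis using is_partition_mono[OF v(1), of i j] ij by (simp add: hweight_pos)
    next
      case (neg b)
      show ?thesis using v(3) iN
      proof (cases rule: hweight_cases)
        case (neg a)
        then have "b \<le> a" using ij \<open>j = N - 1 - b\<close> by auto
        then show ?thesis using is_partition_mono[OF v(2), of b a] neg \<open>hweight N (\<mu>, \<nu>) j = - int (\<nu> ! b)\<close> by simp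
      qed (use neg in auto)
    next
      case zero
      show ?thesis using v(3) iN
        by (cases rule: hweight_cases) (use zero ij in auto)
    qed
  qed
  moreover have "dl N j < dl N i" if "i < j" "j < N" for i j using that by (simp add: dl_def)
  ultimately show ?thesis
    unfolding sdec_def plus_dl_def p by (intro allI impI add_le_less_mono)
qed

text \<open>The entries decrease weakly, so the positive ones form an initial segment, which is
  \<mu>, and the negative ones a final segment, which read backwards gives \<nu>.\<close>

lemma hweight_surj:
  assumes w: "\<alpha> \<in> weights N" and d: "sdec N (plus_dl N \<alpha>)"
  shows "\<exists>p. valid_pair N p \<and> hweight N p = \<alpha>"
proof -
  have dec: "\<alpha> j \<le> \<alpha> i" if "i \<le> j" "j < N" for i j
    using that(2,1)
  proof (induction j)
    case (Suc j)
    have "\<alpha> (Suc j) + dl N (Suc j) < \<alpha> j + dl N j"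
      using d Suc.prems unfolding sdec_def plus_dl_def by blast
    then have "\<alpha> (Suc j) \<le> \<alpha> j" using Suc.prems by (simp add: dl_def of_nat_diff)
    then show ?case using Suc by (cases "i = Suc j") auto
  qed simp
  define l where "l = card {k. k < N \<and> \<alpha> k > 0}"
  define r where "r = card {k. k < N \<and> \<alpha> k < 0}"
  have initial: "S = {..<card S}" if S: "S \<subseteq> {..<N}" "\<And>i j. j \<in> S \<Longrightarrow> i \<le> j \<Longrightarrow> i \<in> S" for S :: "nat set"
  proof -
    have fin: "finite S" using S(1) finite_subset by blast
    show ?thesis
    proof (cases "S = {}")
      case False
      have "S = {..Max S}"
        using Max_in[OF fin False] Max_ge[OF fin] S(2) by auto
      then show ?thesis by (metis card_atMost lessThan_Suc_atMost)
    qed simp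
  qed
  have l: "{k. k < N \<and> \<alpha> k > 0} = {..<l}"
    unfolding l_def by (rule initial) (use dec in \<open>auto intro: less_le_trans\<close>)
  have rr: "{j. j < N \<and> \<alpha> (N - 1 - j) < 0} = {..<card {j. j < N \<and> \<alpha> (N - 1 - j) < 0}}"
  proof (rule initial)
    fix i j assume j: "j \<in> {j. j < N \<and> \<alpha> (N - 1 - j) < 0}" and ij: "i \<le> j"
    then have "N - 1 - i < N" "i < N" by auto
    then show "i \<in> {j. j < N \<and> \<alpha> (N - 1 - j) < 0}"
      using dec[OF diff_le_mono2[OF ij, of "N - 1"]] j by simp
  qed auto
  have "card {j. j < N \<and> \<alpha> (N - 1 - j) < 0} = r"
    unfolding r_def
    by (rule bij_betw_same_card[of "\<lambda>j. N - 1 - j"], rule bij_betw_byWitness[where f' = "\<lambda>j. N - 1 - j"]) auto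
  with rr have r: "{j. j < N \<and> \<alpha> (N - 1 - j) < 0} = {..<r}" by simp
  define \<mu> where "\<mu> = map (\<lambda>k. nat (\<alpha> k)) [0..<l]"
  define \<nu> where "\<nu> = map (\<lambda>j. nat (- \<alpha> (N - 1 - j))) [0..<r]"
  have l': "k < l \<longleftrightarrow> \<alpha> k > 0 \<and> k < N" for k
    using l by (simp only: set_eq_iff mem_Collect_eq lessThan_iff) metis
  have r': "j < r \<longleftrightarrow> \<alpha> (N - 1 - j) < 0 \<and> j < N" for j
    using r by (simp only: set_eq_iff mem_Collect_eq lessThan_iff) metis
  have lpos: "\<alpha> k > 0 \<and> k < N" if "k < l" for k using l' that by blast
  have rneg: "\<alpha> (N - 1 - j) < 0 \<and> j < N" if "j < r" for j using r' that by blast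
  have "l + r \<le> N"
  proof -
    have "{k. k < N \<and> \<alpha> k > 0} \<inter> {k. k < N \<and> \<alpha> k < 0} = {}" by auto
    then have "l + r = card ({k. k < N \<and> \<alpha> k > 0} \<union> {k. k < N \<and> \<alpha> k < 0})"
      unfolding l_def r_def by (subst card_Un_disjoint) auto
    also have "\<dots> \<le> card {..<N}" by (rule card_mono) auto
    finally show ?thesis by simp
  qed
  then have len: "length \<mu> + length \<nu> \<le> N" by (simp add: \<mu>_def \<nu>_def)
  have "is_partition \<mu>"
    using lpos dec unfolding is_partition_def \<mu>_def
    by (auto simp: sorted_wrt_iff_nth_less intro!: nat_mono)
  moreover have "is_partition \<nu>"
    using rneg dec unfolding is_partition_def \<nu>_def
    by (auto simp: sorted_wrt_iff_nth_less intro!: nat_mono)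
  ultimately have v: "valid_pair N (\<mu>, \<nu>)" using len by (simp add: valid_pair_def)
  have "hweight N (\<mu>, \<nu>) k = \<alpha> k" for k
  proof (cases "k < N")
    case True
    show ?thesis
      using len True
    proof (cases rule: hweight_cases)
      case pos
      then show ?thesis using lpos[of k] by (simp add: \<mu>_def)
    next
      case (neg j)
      then show ?thesis using rneg[of j] by (simp add: \<nu>_def)
    next
      case zero
      have "\<not> k < l" using zero(1) by (simp add: \<mu>_def)
      then have "\<not> \<alpha> k > 0" using l'[of k] True by blast
      moreover have "\<not> \<alpha> k < 0"
      proof
        assume "\<alpha> k < 0"
        then have "N - 1 - k < r" using True r'[of "N - 1 - k"] by simp
        then show False using zero(2) True by (simp add: \<nu>_def)
      qed
      ultimately show ?thesis using zero(3) by simp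
    qed
  next
    case False
    then show ?thesis using w len by (simp add: weights_def hweight_zero)
  qed
  then show ?thesis using v by blast
qed

lemma hweight_inj:
  assumes "valid_pair N p" "valid_pair N q" "hweight N p = hweight N q"
  shows "p = q"
proof -
  obtain \<mu> \<nu> \<mu>' \<nu>' where p: "p = (\<mu>, \<nu>)" and q: "q = (\<mu>', \<nu>')" by (metis surj_pair)
  have v: "is_partition \<mu>" "is_partition \<nu>" "length \<mu> + length \<nu> \<le> N"
    "is_partition \<mu>'" "is_partition \<nu>'" "length \<mu>' + length \<nu>' \<le> N"
    using assms by (auto simp: valid_pair_def p q)
  have pos: "k < length \<mu> \<longleftrightarrow> hweight N (\<mu>, \<nu>) k > 0 \<and> k < N"
    if "is_partition \<mu>" "length \<mu> + length \<nu> \<le> N" for \<mu> \<nu> k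
  proof (cases "k < N")
    case True
    show ?thesis using that(2) True
      by (cases rule: hweight_cases) (use is_partition_pos[OF that(1)] that(2) True in auto)
  qed (use that in auto)
  have neg: "k < length \<nu> \<longleftrightarrow> hweight N (\<mu>, \<nu>) (N - 1 - k) < 0 \<and> k < N"
    if "is_partition \<nu>" "length \<mu> + length \<nu> \<le> N" for \<mu> \<nu> k
  proof (cases "k < N")
    case True
    then have k: "N - 1 - k < N" by simp
    show ?thesis using that(2) k
    proof (cases rule: hweight_cases)
      case (neg j)
      then have "j = k" using True that(2) by auto
      then show ?thesis using neg is_partition_pos[OF that(1), of j] True by simp
    qed (use that(2) True in auto)
  qed (use that in auto)
  have lm: "length \<mu> = length \<mu>'"
  proof -
    have "k < length \<mu> \<longleftrightarrow> k < length \<mu>'" for k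
      using pos[OF v(1,3), of k] pos[OF v(4,6), of k] assms(3) by (simp add: p q)
    then show ?thesis by (metis linorder_neqE_nat less_irrefl)
  qed
  have ln: "length \<nu> = length \<nu>'"
  proof -
    have "k < length \<nu> \<longleftrightarrow> k < length \<nu>'" for k
      using neg[OF v(2,3), of k] neg[OF v(5,6), of k] assms(3) by (simp add: p q)
    then show ?thesis by (metis linorder_neqE_nat less_irrefl)
  qed
  have "\<mu> = \<mu>'"
  proof (rule nth_equalityI[OF lm])
    fix k assume "k < length \<mu>"
    then show "\<mu> ! k = \<mu>' ! k"
      using hweight_pos[of k \<mu> N \<nu>] hweight_pos[of k \<mu>' N \<nu>'] lm assms(3) by (simp add: p q)
  qed
  moreover have "\<nu> = \<nu>'"
  proof (rule nth_equalityI[OF ln])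
    fix k assume "k < length \<nu>"
    then show "\<nu> ! k = \<nu>' ! k"
      using hweight_neg[OF v(3), of k] hweight_neg[OF v(6), of k] ln assms(3) by (simp add: p q)
  qed
  ultimately show ?thesis by (simp add: p q)
qed

section \<open>Contents, sizes and Casimir values of weights\<close>

lemma content_formula: "2 * Defs.content \<alpha> = (\<Sum>i<length \<alpha>. int (\<alpha> ! i) * int (\<alpha> ! i) - int (\<alpha> ! i) - 2 * int i * int (\<alpha> ! i))"
proof -
  have "2 * (\<Sum>j<a. int j - int i) = int a * int a - int a - 2 * int i * int a" for a i
    by (induction a) (auto simp: algebra_simps)
  then show ?thesis by (simp add: Defs.content_def sum_distrib_left)
qed

lemma int_sum_list: "int (sum_list \<alpha>) = (\<Sum>i<length \<alpha>. int (\<alpha> ! i))"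
  by (simp add: sum_list_sum_nth atLeast0LessThan)

definition cas_value :: "nat \<Rightarrow> (nat \<Rightarrow> int) \<Rightarrow> int" where
  "cas_value N \<alpha> = nsq N (plus_dl N \<alpha>) - nsq N (dl N)"

lemma cas_value_eq: "cas_value N \<alpha> = nsq N \<alpha> + 2 * ip N \<alpha> (dl N)"
  by (simp add: cas_value_def plus_dl_def nsq_add)

text \<open>A row of length a contributes a^2 - a - 2ia to twice the content. For \<mu> the
  remainder of a^2 + 2a(N-1-i) is (2N-1)a. For \<nu> the value of \<open>dl\<close> at N-1-j is j,
  and the remainder of a^2 - 2ja is a; the asymmetry comes from \<open>dl\<close> ending in
  0.\<close>

lemma cas_value_hweight:
  assumes "length \<mu> + length \<nu> \<le> N"
  shows "cas_value N (hweight N (\<mu>, \<nu>)) = 2 * Defs.content \<mu> + 2 * Defs.content \<nu> +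
    (2 * int N - 1) * int (sum_list \<mu>) + int (sum_list \<nu>)"
proof -
  have "cas_value N (hweight N (\<mu>, \<nu>)) =
      (\<Sum>k<N. hweight N (\<mu>, \<nu>) k * hweight N (\<mu>, \<nu>) k + 2 * (hweight N (\<mu>, \<nu>) k * dl N k))"
    by (simp add: cas_value_eq nsq_def ip_def sum.distrib sum_distrib_left)
  also have "\<dots> = (\<Sum>i<length \<mu>. int (\<mu> ! i) * int (\<mu> ! i) + 2 * (int (\<mu> ! i) * dl N i)) +
      (\<Sum>j<length \<nu>. - int (\<nu> ! j) * - int (\<nu> ! j) + 2 * (- int (\<nu> ! j) * dl N (N - 1 - j)))"
    by (rule sum_hweight[OF assms, of "\<lambda>k a. a * a + 2 * (a * dl N k)"]) simp
  also have "(\<Sum>i<length \<mu>. int (\<mu> ! i) * int (\<mu> ! i) + 2 * (int (\<mu> ! i) * dl N i)) =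
      (\<Sum>i<length \<mu>. (int (\<mu> ! i) * int (\<mu> ! i) - int (\<mu> ! i) - 2 * int i * int (\<mu> ! i)) + (2 * int N - 1) * int (\<mu> ! i))"
    by (rule sum.cong) (use assms in \<open>auto simp: dl_def of_nat_diff algebra_simps\<close>)
  also have "\<dots> = 2 * Defs.content \<mu> + (2 * int N - 1) * int (sum_list \<mu>)"
    by (simp only: sum.distrib content_formula int_sum_list sum_distrib_left)
  also have "(\<Sum>j<length \<nu>. - int (\<nu> ! j) * - int (\<nu> ! j) + 2 * (- int (\<nu> ! j) * dl N (N - 1 - j))) =
      (\<Sum>j<length \<nu>. (int (\<nu> ! j) * int (\<nu> ! j) - int (\<nu> ! j) - 2 * int j * int (\<nu> ! j)) + int (\<nu> ! j))"
    by (rule sum.cong) (use assms in \<open>auto simp: dl_def of_nat_diff algebra_simps\<close>)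
  also have "\<dots> = 2 * Defs.content \<nu> + int (sum_list \<nu>)"
    by (simp only: sum.distrib content_formula int_sum_list)
  finally show ?thesis by simp
qed

text \<open>Serves to recover |\<mu>|, and with it the number r of contractions, from a
  weight.\<close>

lemma sum_pos_hweight:
  assumes "length \<mu> + length \<nu> \<le> N"
  shows "(\<Sum>k<N. max 0 (hweight N (\<mu>, \<nu>) k)) = int (sum_list \<mu>)"
  using sum_hweight[OF assms, of "\<lambda>k a. max 0 a"] by (simp add: int_sum_list)

lemma sum_hweight_diff:
  assumes "length \<mu> + length \<nu> \<le> N"
  shows "(\<Sum>k<N. hweight N (\<mu>, \<nu>) k) = int (sum_list \<mu>) - int (sum_list \<nu>)"
  using sum_hweight[OF assms, of "\<lambda>k a. a"] by (simp add: int_sum_list sum_negf)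

lemma hweight_dual: "length \<sigma> \<le> N \<Longrightarrow> hweight N ([], \<sigma>) = dual_weight N (hweight N (\<sigma>, []))"
  by (auto simp: fun_eq_iff hweight_def dual_weight_def)

lemma poly_weight_hweight:
  assumes "is_partition \<rho>" "length \<rho> \<le> N"
  shows "poly_weight N (sum_list \<rho>) (hweight N (\<rho>, []))"
proof -
  have v: "valid_pair N (\<rho>, [])" using assms by (simp add: valid_pair_def is_partition_def)
  have "(\<Sum>k<N. hweight N (\<rho>, []) k) = int (sum_list \<rho>)"
    using sum_hweight_diff[of \<rho> "[]" N] assms by simp
  then show ?thesis
    using hweight_weights[OF v] hweight_dominant[OF v]
    by (auto simp: poly_weight_def plus_dl_def hweight_def)
qed

lemma poly_weight_partition:
  assumes "poly_weight N m \<alpha>"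
  shows "\<exists>\<rho>. is_partition \<rho> \<and> length \<rho> \<le> N \<and> sum_list \<rho> = m \<and> hweight N (\<rho>, []) = \<alpha>"
proof -
  have a: "\<alpha> \<in> weights N" "\<And>k. \<alpha> k \<ge> 0" "(\<Sum>k<N. \<alpha> k) = int m" "sdec N (plus_dl N \<alpha>)"
    using assms by (auto simp: poly_weight_def plus_dl_def)
  obtain p where p: "valid_pair N p" "hweight N p = \<alpha>" using hweight_surj[OF a(1,4)] by blast
  obtain \<mu> \<nu> where pq: "p = (\<mu>, \<nu>)" by (cases p)
  have v: "is_partition \<mu>" "is_partition \<nu>" "length \<mu> + length \<nu> \<le> N" using p pq by (auto simp: valid_pair_def)
  have "\<nu> = []"
  proof (rule ccontr)
    assume "\<nu> \<noteq> []"
    then have "hweight N (\<mu>, \<nu>) (N - 1 - 0) < 0"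
      using hweight_neg[OF v(3), of 0] is_partition_pos[OF v(2), of 0] by simp
    then show False using a(2)[of "N - 1 - 0"] p pq by simp
  qed
  moreover have "int (sum_list \<mu>) = int m"
    using sum_hweight_diff[OF v(3)] a(3) p(2) pq \<open>\<nu> = []\<close> by simp
  ultimately show ?thesis using v p pq by auto
qed

section \<open>Symmetric characters\<close>

lemma torus_reg_perm: "x \<in> torus_reg N \<Longrightarrow> s \<in> perms N \<Longrightarrow> x \<circ> s \<in> torus_reg N"
proof -
  assume x: "x \<in> torus_reg N" and s: "s \<in> perms N"
  have "inj s" using s permsD permutes_inj by blast
  then have "s i \<noteq> s j" if "i \<noteq> j" for i j using that by (auto dest: injD)
  then show ?thesis using x perms_less[OF s] by (simp add: torus_reg_def)
qed

context glrep
begin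

definition symmetric :: "'p fmat \<Rightarrow> bool" where
  "symmetric B \<longleftrightarrow> (\<forall>x\<in>torus_reg N. \<forall>s\<in>perms N. ch N I wt B (x \<circ> s) = ch N I wt B x)"

text \<open>The character is a quotient of two alternants, which change by the same sign.\<close>

lemma hw_symmetric:
  assumes "hw \<alpha> B"
  shows "symmetric B"
  unfolding symmetric_def
proof (intro ballI)
  fix x s assume x: "x \<in> torus_reg N" and s: "s \<in> perms N"
  let ?a = "alternant N (dl N)" and ?c = "ch N I wt B" and ?e = "alternant N (\<lambda>k. \<alpha> k + dl N k)"
  have h: "?a y * ?c y = ?e y" if "y \<in> torus_reg N" for y using assms that by (simp add: hw_def)
  have "of_int (sign s) * (?a x * ?c (x \<circ> s)) = of_int (sign s) * (?a x * ?c x)"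
    using h[OF torus_reg_perm[OF x s]] h[OF x] alternant_var_perm[OF s] by (simp add: mult.assoc)
  then show "?c (x \<circ> s) = ?c x"
    using alternant_dl_nz[OF x] by (simp add: sign_def split: if_splits)
qed

lemma phi_antisymmetric:
  assumes B: "symmetric B" and s: "s \<in> perms N"
  shows "phi B (\<kappa> \<circ> s) = of_int (sign s) * phi B \<kappa>"
proof -
  let ?S = "{\<kappa>. phi B \<kappa> \<noteq> 0}"
  have "complex_of_real (phi B (\<kappa> \<circ> s)) =
      lcoeff ?S (\<lambda>\<kappa>. \<kappa> \<circ> s) (\<lambda>\<kappa>. of_int (sign s) * of_real (phi B \<kappa>)) (\<kappa> \<circ> s)"
  proof (rule phi_eqI)
    show "(\<lambda>\<kappa>. \<kappa> \<circ> s) ` ?S \<subseteq> weights N" using phi_weights weights_comp s by auto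
    fix x assume x: "x \<in> torus_reg N"
    let ?y = "x \<circ> inv s"
    have y: "?y \<in> torus_reg N" by (rule torus_reg_perm[OF x perms_inv[OF s]])
    have xy: "?y \<circ> s = x" using perms_inverses[OF s] by (simp add: comp_assoc)
    have "alternant N (dl N) x * ch N I wt B x = of_int (sign s) * (alternant N (dl N) ?y * ch N I wt B ?y)"
      using alternant_var_perm[OF s, of "dl N" ?y] B y s unfolding xy symmetric_def
      by (metis mult.assoc xy)
    also have "\<dots> = (\<Sum>\<kappa>\<in>?S. of_int (sign s) * of_real (phi B \<kappa>) * lmono N x (\<kappa> \<circ> s))"
      unfolding den_ch_phi[OF y] sum_distrib_left
      using lmono_perm[OF s, of ?y] unfolding xy by (simp add: mult.assoc)
    finally show "alternant N (dl N) x * ch N I wt B x =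
        (\<Sum>\<kappa>\<in>?S. of_int (sign s) * of_real (phi B \<kappa>) * lmono N x (\<kappa> \<circ> s))" .
  qed (rule finite_phi)
  also have "{w \<in> ?S. w \<circ> s = \<kappa> \<circ> s} = (if phi B \<kappa> \<noteq> 0 then {\<kappa>} else {})"
  proof -
    have "w = \<kappa>" if "w \<circ> s = \<kappa> \<circ> s" for w
      using arg_cong[OF that, of "\<lambda>f. f \<circ> inv s"] perms_inverses[OF s] by (simp add: comp_assoc)
    then show ?thesis by auto
  qed
  then have "lcoeff ?S (\<lambda>\<kappa>. \<kappa> \<circ> s) (\<lambda>\<kappa>. of_int (sign s) * of_real (phi B \<kappa>)) (\<kappa> \<circ> s) =
      of_real (of_int (sign s) * phi B \<kappa>)"
    by (simp add: lcoeff_def)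
  finally show ?thesis by (simp only: of_real_eq_iff)
qed

lemma phi_perm_nonzero:
  "symmetric B \<Longrightarrow> s \<in> perms N \<Longrightarrow> phi B (\<kappa> \<circ> s) \<noteq> 0 \<longleftrightarrow> phi B \<kappa> \<noteq> 0"
  by (cases "evenperm s") (simp_all add: phi_antisymmetric sign_def)

text \<open>A repeated entry would make the exponent invariant under a transposition, where
  antisymmetry gives zero. Distinct entries can be sorted.\<close>

lemma phi_sorted:
  assumes B: "symmetric B" and nz: "phi B \<kappa> \<noteq> 0"
  shows "\<exists>s\<in>perms N. sdec N (\<kappa> \<circ> s) \<and> phi B (\<kappa> \<circ> s) \<noteq> 0"
proof -
  have "inj_on \<kappa> {..<N}"
  proof (rule inj_onI, rule ccontr)
    fix i j assume ij: "i \<in> {..<N}" "j \<in> {..<N}" "\<kappa> i = \<kappa> j" "i \<noteq> j"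
    have "\<kappa> \<circ> Transposition.transpose i j = \<kappa>" using ij(3) by (auto simp: fun_eq_iff transpose_def)
    then show False
      using phi_antisymmetric[OF B transpose_perms[of i N j], of \<kappa>] ij nz by (simp add: sign_swap_id)
  qed
  then obtain s where s: "s \<in> perms N" "sdec N (\<kappa> \<circ> s)" using exists_sorting_perm by blast
  then show ?thesis using phi_perm_nonzero[OF B s(1), of \<kappa>] nz by blast
qed

text \<open>The exponents with nonzero coefficient form free orbits under permutation, each with one
  strictly decreasing representative; by antisymmetry each orbit sums to a multiple of an
  alternant.\<close>

lemma den_ch_alternants:
  assumes B: "symmetric B" and x: "x \<in> torus_reg N"
  shows "alternant N (dl N) x * ch N I wt B x =
    (\<Sum>\<kappa> | phi B \<kappa> \<noteq> 0 \<and> sdec N \<kappa>. of_real (phi B \<kappa>) * alternant N \<kappa> x)"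
proof -
  let ?D = "{\<kappa>. phi B \<kappa> \<noteq> 0 \<and> sdec N \<kappa>}" and ?S = "{\<kappa>. phi B \<kappa> \<noteq> 0}" and ?g = "\<lambda>(\<kappa>, s). \<kappa> \<circ> s"
  have bij: "bij_betw ?g (?D \<times> perms N) ?S"
  proof (rule bij_betwI')
    fix a b assume "a \<in> ?D \<times> perms N" "b \<in> ?D \<times> perms N"
    then obtain \<kappa> s \<kappa>' s' where a: "a = (\<kappa>, s)" "sdec N \<kappa>" "s \<in> perms N"
      and b: "b = (\<kappa>', s')" "sdec N \<kappa>'" "s' \<in> perms N" by auto
    have "\<kappa> = \<kappa>' \<and> s = s'" if eq: "\<kappa> \<circ> s = \<kappa>' \<circ> s'"
    proof -
      have "\<kappa> \<circ> (s \<circ> inv s') = \<kappa>' \<circ> (s' \<circ> inv s')"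
        using arg_cong[OF eq, of "\<lambda>f. f \<circ> inv s'"] by (simp only: comp_assoc)
      then have *: "\<kappa> \<circ> (s \<circ> inv s') = \<kappa>'" by (simp only: perms_inverses[OF b(3)] comp_id)
      then have "s \<circ> inv s' = id"
        using sdec_perm_unique[OF perms_comp[OF a(3) perms_inv[OF b(3)]] a(2) b(2)] by blast
      moreover have "s = (s \<circ> inv s') \<circ> s'" by (simp only: comp_assoc perms_inverses[OF b(3)] comp_id)
      ultimately show ?thesis using * by simp
    qed
    then show "(?g a = ?g b) = (a = b)" using a b by auto
  next
    fix a assume "a \<in> ?D \<times> perms N"
    then show "?g a \<in> ?S" using phi_perm_nonzero[OF B] by auto
  next
    fix \<kappa> assume "\<kappa> \<in> ?S"
    then obtain s where s: "s \<in> perms N" "sdec N (\<kappa> \<circ> s)" "phi B (\<kappa> \<circ> s) \<noteq> 0"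
      using phi_sorted[OF B] by blast
    have "\<kappa> = ?g (\<kappa> \<circ> s, inv s)" using perms_inverses[OF s(1)] by (simp add: comp_assoc)
    then show "\<exists>a\<in>?D \<times> perms N. \<kappa> = ?g a" using s perms_inv by blast
  qed
  have "alternant N (dl N) x * ch N I wt B x = (\<Sum>\<kappa>\<in>?S. of_real (phi B \<kappa>) * lmono N x \<kappa>)"
    by (rule den_ch_phi[OF x])
  also have "\<dots> = (\<Sum>(\<kappa>, s)\<in>?D \<times> perms N. of_real (phi B (\<kappa> \<circ> s)) * lmono N x (\<kappa> \<circ> s))"
    by (subst sum.reindex_bij_betw[OF bij, symmetric]) (simp add: case_prod_unfold)
  also have "\<dots> = (\<Sum>(\<kappa>, s)\<in>?D \<times> perms N. of_real (phi B \<kappa>) * (of_int (sign s) * lmono N x (\<kappa> \<circ> s)))"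
    by (rule sum.cong) (auto simp: phi_antisymmetric[OF B])
  also have "\<dots> = (\<Sum>\<kappa>\<in>?D. of_real (phi B \<kappa>) * alternant N \<kappa> x)"
    by (simp add: alternant_eq sum_distrib_left sum.cartesian_product)
  finally show ?thesis .
qed

end

section \<open>Mixed tensors\<close>

text \<open>The two cross terms agree after exchanging i and j, whence the factor 2.\<close>

lemma casimir_tensor:
  assumes "glrep N I E wt" "glrep N J E' wt'"
  shows "casimir N (tensor_E I J E E') =
    tns (casimir N E) (one_on J) + tns (one_on I) (casimir N E') +
      2 *\<^sub>R (\<Sum>i<N. \<Sum>j<N. tns (E i j) (E' j i))"
proof -
  interpret V: glrep N I E wt by fact
  interpret W: glrep N J E' wt' by fact
  note fin = V.finI W.finI
  note ones = one_on_times[OF fin(1) V.msupp_E] times_one_on[OF fin(1) V.msupp_E]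
    one_on_times[OF fin(2) W.msupp_E] times_one_on[OF fin(2) W.msupp_E]
    one_on_times[OF fin(1) msupp_dg[OF fin(1)]] one_on_times[OF fin(2) msupp_dg[OF fin(2)]]
  have "(\<Sum>i<N. \<Sum>j<N. tensor_E I J E E' i j * tensor_E I J E E' j i) =
    (\<Sum>i<N. \<Sum>j<N. tns (E i j * E j i) (one_on J) + tns (one_on I) (E' i j * E' j i) + tns (E i j) (E' j i) + tns (E j i) (E' i j))"
    by (intro sum.cong refl) (simp add: distrib_left distrib_right tns_times ones)
  also have "\<dots> = tns (\<Sum>i<N. \<Sum>j<N. E i j * E j i) (one_on J) + tns (one_on I) (\<Sum>i<N. \<Sum>j<N. E' i j * E' j i)
      + (\<Sum>i<N. \<Sum>j<N. tns (E i j) (E' j i)) + (\<Sum>i<N. \<Sum>j<N. tns (E j i) (E' i j))"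
    by (simp add: sum.distrib tns_sum)
  also have "(\<Sum>i<N. \<Sum>j<N. tns (E j i) (E' i j)) = (\<Sum>i<N. \<Sum>j<N. tns (E i j) (E' j i))"
    by (rule sum.swap)
  finally show ?thesis
    by (simp add: casimir_def tns_simps tns_sum sum.distrib scaleR_add_right scaleR_2 add_ac)
qed

definition mixed_E :: "nat \<Rightarrow> nat \<Rightarrow> nat \<Rightarrow> nat \<Rightarrow> nat \<Rightarrow> ((nat \<Rightarrow> nat) \<times> (nat \<Rightarrow> nat)) fmat" where
  "mixed_E N m n = (\<lambda>i j. tns (word_E N m i j) (one_on (idx N n)) + tns (one_on (idx N m)) (- word_E N n j i))"

definition mixed_wt :: "nat \<Rightarrow> nat \<Rightarrow> (nat \<Rightarrow> nat) \<times> (nat \<Rightarrow> nat) \<Rightarrow> nat \<Rightarrow> int" where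
  "mixed_wt m n = (\<lambda>x k. word_wt m (fst x) k + - word_wt n (snd x) k)"

text \<open>For one position in each word, the sum replaces a pair of equal letters by every other
  such pair: contraction followed by insertion.\<close>

definition contr :: "nat \<Rightarrow> nat \<Rightarrow> nat \<Rightarrow> ((nat \<Rightarrow> nat) \<times> (nat \<Rightarrow> nat)) fmat" where
  "contr N m n = (\<Sum>i<N. \<Sum>j<N. tns (word_E N m i j) (word_E N n i j))"

text \<open>One block of the mixed tensor space: the image of \<open>tns P Q\<close> has the
  character of the product of U^(\<rho>,0) and U^(0,\<sigma>) when \<alpha> and \<beta> are the
  weights of \<rho> and \<sigma>. The weight \<beta> is the one before dualising.\<close>

locale mixed =
  fixes N m n :: nat and \<alpha> \<beta> :: "nat \<Rightarrow> int" and P Q :: "(nat \<Rightarrow> nat) fmat"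
  assumes \<alpha>: "poly_weight N m \<alpha>" and \<beta>: "poly_weight N n \<beta>"
    and P: "word_hw N m \<alpha> P" and Q: "word_hw N n \<beta> Q"
begin

sublocale V: glrep N "idx N m" "word_E N m" "word_wt m"
  by (rule glrep_words)

sublocale W: glrep N "idx N n" "\<lambda>i j. - word_E N n j i" "\<lambda>p k. - word_wt n p k"
  by (rule glrep_dual[OF glrep_words])

sublocale T: glrep N "idx N m \<times> idx N n" "mixed_E N m n" "mixed_wt m n"
  unfolding mixed_E_def mixed_wt_def by (rule glrep_tensor[OF glrep_words glrep_dual[OF glrep_words]])

abbreviation "\<beta>' \<equiv> dual_weight N \<beta>"
abbreviation "M \<equiv> tns P Q"
abbreviation "IJ \<equiv> idx N m \<times> idx N n"
abbreviation "chM \<equiv> ch N IJ (mixed_wt m n) M"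
abbreviation "chP \<equiv> ch N (idx N m) (word_wt m) P"
abbreviation "chQ \<equiv> ch N (idx N n) (\<lambda>p k. - word_wt n p k) Q"

lemma VP: "V.hw \<alpha> P"
  using P by (simp add: word_hw_def)

lemma WQ: "W.hw \<beta>' Q"
  using hw_dual[OF glrep_words] Q by (simp add: word_hw_def)

lemma M_invproj: "T.invproj M"
  unfolding mixed_E_def
  using invproj_tensor[OF glrep_words glrep_dual[OF glrep_words]] VP WQ by (simp add: V.hw_def W.hw_def)

lemma ch_M:
  "x \<in> torus_reg N \<Longrightarrow> chM x =
    chP x * chQ x"
  unfolding mixed_wt_def by (rule ch_tensor)

lemma M_symmetric: "T.symmetric M"
  using V.hw_symmetric[OF VP] W.hw_symmetric[OF WQ]
  unfolding T.symmetric_def V.symmetric_def W.symmetric_def by (simp add: ch_M torus_reg_perm)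

lemma M_contr: "M * contr N m n = contr N m n * M"
proof -
  have "P * word_E N m i j = word_E N m i j * P" "Q * word_E N n i j = word_E N n i j * Q"
    if "i < N" "j < N" for i j
    using VP WQ that unfolding V.hw_def W.hw_def V.invproj_def W.invproj_def V.invariant_def W.invariant_def
    by (simp_all add: minus_equation_iff)
  then show ?thesis
    unfolding contr_def sum_distrib_left sum_distrib_right
    by (intro sum.cong refl) (simp add: tns_times)
qed

text \<open>The dual action is minus the transpose, so the cross term of
  \<open>casimir_tensor\<close> is -2 times \<open>contr\<close>; on the block \<open>M\<close> both
  single Casimir operators are scalars.\<close>

lemma M_Cas:
  "M * T.Cas = of_int (cas_value N \<alpha> + cas_value N \<beta>') *\<^sub>R M - 2 *\<^sub>R (M * contr N m n)"
proof -
  have c: "T.Cas = tns V.Cas (one_on (idx N n)) + tns (one_on (idx N m)) W.Cas - 2 *\<^sub>R contr N m n"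
    unfolding mixed_E_def casimir_tensor[OF glrep_words glrep_dual[OF glrep_words]]
    by (simp add: contr_def tns_simps sum_negf)
  have "msupp P \<subseteq> idx N m" "msupp Q \<subseteq> idx N n"
    using VP WQ by (auto simp: V.hw_def V.invproj_def V.invariant_def W.hw_def W.invproj_def W.invariant_def)
  then have one: "P * one_on (idx N m) = P" "Q * one_on (idx N n) = Q"
    by (simp_all add: times_one_on)
  have "V.cval (\<lambda>k. \<alpha> k + dl N k) = cas_value N \<alpha>" "W.cval (\<lambda>k. \<beta>' k + dl N k) = cas_value N \<beta>'"
    by (simp_all add: V.cval_def W.cval_def cas_value_def plus_dl_def)
  then have "P * V.Cas = of_int (cas_value N \<alpha>) *\<^sub>R P" "Q * W.Cas = of_int (cas_value N \<beta>') *\<^sub>R Q"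
    using V.hw_Cas[OF VP] W.hw_Cas[OF WQ] by simp_all
  then show ?thesis
    unfolding c by (simp add: distrib_left right_diff_distrib tns_times one tns_simps scaleR_add_left)
qed

definition aval :: "(nat \<Rightarrow> int) \<Rightarrow> real" where
  "aval \<kappa> = of_int (cas_value N \<alpha> + cas_value N \<beta>' - T.cval \<kappa>) / 2"

text \<open>The Casimir eigenprojection R lies below \<open>M\<close>, so multiplying
  \<open>M_Cas\<close> by R solves for \<open>contr\<close>. The basis vector p of known weight is
  kept for the later estimates.\<close>

lemma eigenprojection_exists:
  assumes "T.phi M \<kappa> \<noteq> 0" "sdec N \<kappa>"
  shows "\<exists>R. T.invproj R \<and> R * M = R \<and> R * contr N m n = aval \<kappa> *\<^sub>R R \<and>
    (\<exists>p\<in>IJ. entry R p p \<noteq> 0 \<and> mixed_wt m n p = (\<lambda>k. \<kappa> k - dl N k))"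
proof -
  obtain R where R: "T.invproj R" "R * M = R" "R * T.Cas = of_int (T.cval \<kappa>) *\<^sub>R R"
    "\<exists>p\<in>IJ. entry R p p \<noteq> 0 \<and> mixed_wt m n p = (\<lambda>k. \<kappa> k - dl N k)"
    using T.phi_sdec(2)[OF M_invproj assms(2,1)] by blast
  have "R * T.Cas = R * (M * T.Cas)" by (simp add: R(2) mult.assoc[symmetric])
  also have "\<dots> = of_int (cas_value N \<alpha> + cas_value N \<beta>') *\<^sub>R R - 2 *\<^sub>R (R * contr N m n)"
    unfolding M_Cas by (simp add: right_diff_distrib mult.assoc[symmetric] R(2))
  finally have "2 *\<^sub>R (R * contr N m n) = of_int (cas_value N \<alpha> + cas_value N \<beta>' - T.cval \<kappa>) *\<^sub>R R"
    unfolding R(3) by (simp add: algebra_simps)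
  then have "(1 / 2) *\<^sub>R (2 *\<^sub>R (R * contr N m n)) = (1 / 2) *\<^sub>R (of_int (cas_value N \<alpha> + cas_value N \<beta>' - T.cval \<kappa>) *\<^sub>R R)"
    by simp
  then have "R * contr N m n = aval \<kappa> *\<^sub>R R" by (simp add: aval_def)
  then show ?thesis using R by blast
qed

text \<open>The projected vector stays an eigenvector of \<open>contr\<close>, and by
  \<open>M_Cas\<close> it is a Casimir eigenvector with value ?C - 2c. The polynomial whose roots
  are all occurring \<open>cval\<close> annihilates \<open>M\<close>, so this value is one of them;
  symmetry of the character yields a sorted exponent.\<close>

lemma eigenvalue_phi:
  assumes v: "rv v (contr N m n) = (\<lambda>q. c * v q)" and nz: "rv v M q \<noteq> 0"
  shows "\<exists>\<kappa>. T.phi M \<kappa> \<noteq> 0 \<and> sdec N \<kappa> \<and> c = of_real (aval \<kappa>)"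
proof -
  let ?v = "rv v M" and ?C = "cas_value N \<alpha> + cas_value N \<beta>'"
  let ?d = "of_int ?C - 2 * c" and ?Z = "(\<lambda>\<kappa>. real_of_int (T.cval \<kappa>)) ` {\<kappa>. T.phi M \<kappa> \<noteq> 0}"
  have MM: "M * M = M" using M_invproj by (simp add: T.invproj_def)
  have vM: "rv ?v M = ?v" by (simp add: rv_times[symmetric] MM)
  have "rv ?v (contr N m n) = rv (rv v (contr N m n)) M"
    by (simp add: rv_times[symmetric] M_contr)
  then have vc: "rv ?v (contr N m n) q = c * ?v q" for q
    unfolding v by (simp add: rv_vec_scale)
  have "rv ?v T.Cas = rv ?v (M * T.Cas)" by (simp only: rv_times vM)
  then have "rv ?v T.Cas q = ?d * ?v q" for q
  proof -
    have "rv ?v (M * contr N m n) = rv ?v (contr N m n)" by (simp only: rv_times vM)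
    then show ?thesis
      unfolding \<open>rv ?v T.Cas = rv ?v (M * T.Cas)\<close> M_Cas
      by (simp add: rv_minus rv_plus rv_scaleR vM vc algebra_simps)
  qed
  then have vC: "rv ?v T.Cas = (\<lambda>q. ?d * ?v q)" by blast
  have fin: "finite ?Z" by (rule finite_imageI[OF T.finite_phi])
  have "pact T.Cas (\<Prod>z\<in>?Z. [:- z, 1:]) M = 0"
  proof (rule T.pact_eq_0[OF M_invproj])
    fix \<kappa> assume "T.phi M \<kappa> \<noteq> 0"
    then show "poly (\<Prod>z\<in>?Z. [:- z, 1:]) (of_int (T.cval \<kappa>)) = 0"
      unfolding poly_prod using fin by (intro prod_zero) auto
  qed
  then have "(\<Prod>z\<in>?Z. ?d - of_real z) * ?v q = 0"
    using rv_pact_roots[OF fin vC vM] by (metis rv_zero)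
  then have "\<exists>z\<in>?Z. ?d - of_real z = 0" using nz fin by (simp only: mult_eq_0_iff prod_zero_iff) blast
  then obtain \<kappa> where \<kappa>: "T.phi M \<kappa> \<noteq> 0" "?d = of_real (of_int (T.cval \<kappa>))" by auto
  obtain s where s: "s \<in> perms N" "sdec N (\<kappa> \<circ> s)" "T.phi M (\<kappa> \<circ> s) \<noteq> 0"
    using T.phi_sorted[OF M_symmetric \<kappa>(1)] by blast
  have "T.cval (\<kappa> \<circ> s) = T.cval \<kappa>" by (simp add: T.cval_def nsq_perm[OF s(1)])
  moreover have "c = (of_int ?C - of_real (of_int (T.cval \<kappa>))) / 2"
    unfolding \<kappa>(2)[symmetric] by simp
  ultimately have "c = of_real (aval (\<kappa> \<circ> s))" by (simp add: aval_def)
  then show ?thesis using s by blast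
qed

text \<open>The denominator is absorbed by the character of \<open>P\<close>, leaving an alternant
  times the character of \<open>Q\<close>. This is the Brauer-Klimyk formula: a signed sum of weight
  multiplicities, which are integers by \<open>mult_integral\<close>.\<close>

lemma phi_M_integral: "T.phi M \<kappa> \<in> \<int>"
proof -
  have mi: "W.mult Q \<xi> \<in> \<int>" for \<xi> by (rule W.mult_integral[OF W.hw_phi(1)[OF WQ]])
  have "complex_of_real (T.phi M \<kappa>) =
      lcoeff (perms N \<times> idx N n) (\<lambda>(s, p) k. plus_dl N \<alpha> (s k) + - word_wt n p k)
        (\<lambda>(s, p). of_int (sign s) * of_real (entry Q p p)) \<kappa>"
  proof (rule T.phi_eqI)
    show "(\<lambda>(s, p) k. plus_dl N \<alpha> (s k) + - word_wt n p k) ` (perms N \<times> idx N n) \<subseteq> weights N"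
    proof -
      have pa: "plus_dl N \<alpha> \<in> weights N" using \<alpha> by (auto simp: poly_weight_def weights_def plus_dl_def dl_def)
      have "(\<lambda>k. plus_dl N \<alpha> (s k) + - word_wt n p k) \<in> weights N" if "s \<in> perms N" "p \<in> idx N n" for s p
        using weights_comp[OF pa that(1)] W.wt_weights[OF that(2)] by (simp add: weights_def)
      then show ?thesis by auto
    qed
    fix x assume x: "x \<in> torus_reg N"
    have "alternant N (dl N) x * chM x =
        alternant N (plus_dl N \<alpha>) x * chQ x"
      using VP x by (simp add: ch_M V.hw_def plus_dl_def mult.assoc[symmetric])
    also have "\<dots> = (\<Sum>w\<in>perms N \<times> idx N n. (case w of (s, p) \<Rightarrow> of_int (sign s) * of_real (entry Q p p)) *
        lmono N x (case w of (s, p) \<Rightarrow> \<lambda>k. plus_dl N \<alpha> (s k) + - word_wt n p k))"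
      unfolding alternant_eq ch_def sum_product sum.cartesian_product
    proof (rule sum.cong)
      fix w assume "w \<in> perms N \<times> idx N n"
      have "lmono N x (\<lambda>k. plus_dl N \<alpha> (s k) + - word_wt n p k) =
          lmono N x (plus_dl N \<alpha> \<circ> s) * lmono N x (\<lambda>k. - word_wt n p k)" for s p
        using lmono_add[OF x, of "plus_dl N \<alpha> \<circ> s" "\<lambda>k. - word_wt n p k"] by (simp only: o_def)
      then show "(case w of (s, p) \<Rightarrow> of_int (sign s) * lmono N x (plus_dl N \<alpha> \<circ> s) *
          (of_real (entry Q p p) * lmono N x (\<lambda>k. - word_wt n p k))) =
        (case w of (s, p) \<Rightarrow> of_int (sign s) * of_real (entry Q p p)) *
        lmono N x (case w of (s, p) \<Rightarrow> \<lambda>k. plus_dl N \<alpha> (s k) + - word_wt n p k)"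
        by (cases w) (simp only: prod.case mult_ac)
    qed simp
    finally show "alternant N (dl N) x * chM x =
        (\<Sum>w\<in>perms N \<times> idx N n. (case w of (s, p) \<Rightarrow> of_int (sign s) * of_real (entry Q p p)) *
        lmono N x (case w of (s, p) \<Rightarrow> \<lambda>k. plus_dl N \<alpha> (s k) + - word_wt n p k))" .
  qed simp
  also have "\<dots> = of_real (\<Sum>s\<in>perms N. of_int (sign s) * W.mult Q (\<lambda>k. \<kappa> k - plus_dl N \<alpha> (s k)))"
    by (rule W.lcoeff_shifted_ch)
  finally have "T.phi M \<kappa> = (\<Sum>s\<in>perms N. of_int (sign s) * W.mult Q (\<lambda>k. \<kappa> k - plus_dl N \<alpha> (s k)))"
    by (simp only: of_real_eq_iff)
  also have "\<dots> \<in> \<int>" using mi by (intro Ints_sum) auto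
  finally show ?thesis .
qed

end

section \<open>Letter counts and the vanishing of the eigenvalue\<close>

lemma sum_word_wt:
  assumes "f \<in> idx N m"
  shows "(\<Sum>k<N. word_wt m f k) = int m"
proof -
  have "(\<Sum>k<N. word_wt m f k) = (\<Sum>a<m. \<Sum>k<N. eps (f a) k)"
    unfolding word_wt_def by (rule sum.swap)
  also have "\<dots> = (\<Sum>a<m. 1)"
    by (rule sum.cong) (use assms in \<open>auto simp: eps_def idx_def\<close>)
  finally show ?thesis by simp
qed

lemma word_wt_nonneg: "word_wt m f k \<ge> 0"
  by (simp add: word_wt_def eps_def sum_nonneg)

lemma entry_word_E_zero:
  assumes "f \<in> idx N m" "g \<in> idx N m" "i < N" "word_wt m g j = 0"
  shows "entry (word_E N m i j) f g = 0"
proof -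
  have "g a \<noteq> j" if "a < m" for a
  proof -
    have "\<forall>a\<in>{..<m}. eps (g a) j = 0"
      using assms(4) by (subst sum_nonneg_eq_0_iff[symmetric]) (auto simp: word_wt_def eps_def)
    then show ?thesis using that by (auto simp: eps_def split: if_splits)
  qed
  then show ?thesis unfolding entry_word_E[OF assms(1-3)] by (intro sum.neutral) auto
qed

context mixed
begin

text \<open>Transposing R M = R gives M R = R. A zero diagonal entry of the projection
  \<open>M\<close> would make its row zero, and hence that of R.\<close>

lemma entry_M_nonzero:
  assumes "T.invproj R" "R * M = R" "entry R p p \<noteq> 0"
  shows "entry P (fst p) (fst p) \<noteq> 0" "entry Q (snd p) (snd p) \<noteq> 0"
proof -
  have "tp (R * M) = M * R"
    using assms(1) M_invproj by (simp add: tp_times T.invproj_def)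
  then have MR: "M * R = R" using assms(1,2) by (simp add: T.invproj_def)
  have "entry M p p \<noteq> 0"
  proof
    assume "entry M p p = 0"
    then have "entry M p r = 0" for r using T.invproj_entry_zero_row[OF M_invproj] by blast
    then have "entry (M * R) p p = 0"
      unfolding entry_times0 by (intro sum.neutral) (simp del: entry_tns)
    then show False using assms(3) MR by simp
  qed
  then show "entry P (fst p) (fst p) \<noteq> 0" "entry Q (snd p) (snd p) \<noteq> 0" by simp_all
qed

text \<open>\<kappa> - \<delta> is the weight of a basis tensor, hence a difference of the letter
  counts of two words of lengths m and n.\<close>

lemma weight_sums:
  assumes "T.phi M \<kappa> \<noteq> 0" "sdec N \<kappa>"
  shows "(\<Sum>k<N. \<kappa> k - dl N k) = int m - int n"
    and "(\<Sum>k<N. max 0 (\<kappa> k - dl N k)) \<le> int m"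
proof -
  obtain R p where p: "p \<in> IJ" "mixed_wt m n p = (\<lambda>k. \<kappa> k - dl N k)"
    using eigenprojection_exists[OF assms] by blast
  then have k: "\<kappa> k - dl N k = word_wt m (fst p) k - word_wt n (snd p) k" for k
    by (simp add: mixed_wt_def fun_eq_iff)
  show "(\<Sum>k<N. \<kappa> k - dl N k) = int m - int n"
    unfolding k sum_subtractf using p(1) by (auto simp: sum_word_wt)
  have "(\<Sum>k<N. max 0 (\<kappa> k - dl N k)) \<le> (\<Sum>k<N. word_wt m (fst p) k)"
    unfolding k by (rule sum_mono) (simp add: word_wt_nonneg)
  then show "(\<Sum>k<N. max 0 (\<kappa> k - dl N k)) \<le> int m"
    using p(1) by (auto simp: sum_word_wt)
qed

text \<open>If the positive part of the weight has full size, no letter occurs in both tensor factors, so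
  every contraction vanishes. Conversely the weights of the two factors are dominated by \<open>\<alpha>\<close> and
  \<open>\<beta>'\<close>, which makes the eigenvalue a sum of nonnegative terms.\<close>
lemma aval_zero_iff:
  assumes \<kappa>: "T.phi M \<kappa> \<noteq> 0" "sdec N \<kappa>"
  shows "aval \<kappa> = 0 \<longleftrightarrow> (\<Sum>k<N. max 0 (\<kappa> k - dl N k)) = int m"
proof -
  obtain R p where R: "T.invproj R" "R * M = R" "R * contr N m n = aval \<kappa> *\<^sub>R R"
    and p: "p \<in> IJ" "entry R p p \<noteq> 0" "mixed_wt m n p = (\<lambda>k. \<kappa> k - dl N k)"
    using eigenprojection_exists[OF \<kappa>] by blast
  let ?\<xi> = "word_wt m (fst p)" and ?\<eta> = "word_wt n (snd p)"
  have p1: "fst p \<in> idx N m" and p2: "snd p \<in> idx N n" using p(1) by auto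
  have wt: "\<kappa> k - dl N k = ?\<xi> k - ?\<eta> k" for k
    using p(3) by (simp add: mixed_wt_def fun_eq_iff)
  show ?thesis
  proof
    assume "(\<Sum>k<N. max 0 (\<kappa> k - dl N k)) = int m"
    \<comment> \<open>The summand is the minimum of the two letter counts, so the equation says that
      no letter occurs in both words.\<close>
    then have "(\<Sum>k<N. ?\<xi> k - max 0 (?\<xi> k - ?\<eta> k)) = 0"
      unfolding sum_subtractf wt by (simp add: sum_word_wt[OF p1])
    then have "\<forall>k\<in>{..<N}. ?\<xi> k - max 0 (?\<xi> k - ?\<eta> k) = 0"
      by (subst sum_nonneg_eq_0_iff[symmetric]) (auto simp: word_wt_nonneg)
    then have disj: "?\<xi> k = 0 \<or> ?\<eta> k = 0" if "k < N" for k
      using that word_wt_nonneg[of m "fst p" k] word_wt_nonneg[of n "snd p" k]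
      by (auto simp: max_def split: if_splits)
    have "entry (contr N m n) q p = 0" if q: "q \<in> IJ" for q
    proof -
      have "entry (word_E N m i j) (fst q) (fst p) * entry (word_E N n i j) (snd q) (snd p) = 0"
        if "i < N" "j < N" for i j
        using disj[OF that(2)] entry_word_E_zero[OF _ p1 that(1), of "fst q" j]
          entry_word_E_zero[OF _ p2 that(1), of "snd q" j] q by auto
      then show ?thesis
        unfolding contr_def entry_sum
        by (intro sum.neutral ballI) (simp only: entry_tns lessThan_iff)
    qed
    moreover have "entry (R * contr N m n) p p = (\<Sum>q\<in>IJ. entry R p q * entry (contr N m n) q p)"
      by (rule entry_times) (use R(1) in \<open>auto simp: T.invproj_def T.invariant_def\<close>)
    ultimately show "aval \<kappa> = 0" using R(3) p(2) by simp
  next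
    assume a0: "aval \<kappa> = 0"
    let ?\<gamma> = "\<lambda>k. \<alpha> k + \<beta>' k"
    have hwV: "V.invproj P" "sdec N (\<lambda>k. \<alpha> k + dl N k)" using VP by (auto simp: V.hw_def)
    have hwW: "W.invproj Q" "sdec N (\<lambda>k. \<beta>' k + dl N k)" using WQ by (auto simp: W.hw_def)
    \<comment> \<open>\<kappa> itself is strictly decreasing and serves as the direction in which
      both highest weights dominate.\<close>
    have "ip N \<kappa> ?\<xi> \<le> ip N \<kappa> (\<lambda>k. \<alpha> k + dl N k) - ip N \<kappa> (dl N)"
      by (rule V.weight_bound[OF hwV(1,2) \<kappa>(2) V.hw_phi(2)[OF VP] p1 entry_M_nonzero(1)[OF R(1,2) p(2)]])
    moreover have "ip N \<kappa> (\<lambda>k. - ?\<eta> k) \<le> ip N \<kappa> (\<lambda>k. \<beta>' k + dl N k) - ip N \<kappa> (dl N)"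
      by (rule W.weight_bound[OF hwW(1,2) \<kappa>(2) W.hw_phi(2)[OF WQ] p2 entry_M_nonzero(2)[OF R(1,2) p(2)]])
    ultimately have bound: "ip N \<kappa> ?\<xi> + ip N \<kappa> (\<lambda>k. - ?\<eta> k) \<le> ip N \<kappa> \<alpha> + ip N \<kappa> \<beta>'"
      by (simp add: ip_add_right)
    \<comment> \<open>Distance of \<kappa> - \<delta> from \<alpha> + \<beta>', the highest weight
      that the product could have.\<close>
    define d where "d = (\<lambda>k. ?\<gamma> k - (\<kappa> k - dl N k))"
    have d0: "ip N \<kappa> d \<ge> 0"
    proof -
      have "ip N \<kappa> d = ip N \<kappa> \<alpha> + ip N \<kappa> \<beta>' - (ip N \<kappa> ?\<xi> + ip N \<kappa> (\<lambda>k. - ?\<eta> k))"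
        by (simp add: d_def wt ip_def sum.distrib sum_subtractf algebra_simps sum_negf)
      then show ?thesis using bound by simp
    qed
    have prod_le: "\<alpha> k * \<beta>' k \<le> 0" for k
      using \<alpha> \<beta> by (auto simp: poly_weight_def dual_weight_def intro!: mult_nonneg_nonpos)
    \<comment> \<open>Two evaluations of the Casimir value at \<alpha> + \<beta>' give 2
      \<open>aval \<kappa>\<close> = 2<\<kappa>, d> + |d|^2 - 2<\<alpha>, \<beta>'>. All three terms
      are nonnegative, so each vanishes.\<close>
    have "cas_value N ?\<gamma> = cas_value N \<alpha> + cas_value N \<beta>' + 2 * ip N \<alpha> \<beta>'"
      by (simp add: cas_value_eq nsq_add ip_add)
    moreover have "cas_value N ?\<gamma> = T.cval \<kappa> + 2 * ip N \<kappa> d + nsq N d"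
    proof -
      have "plus_dl N ?\<gamma> = (\<lambda>k. \<kappa> k + d k)" by (simp add: plus_dl_def d_def fun_eq_iff)
      then show ?thesis by (simp add: cas_value_def T.cval_def nsq_add)
    qed
    moreover have "cas_value N \<alpha> + cas_value N \<beta>' = T.cval \<kappa>"
    proof -
      have "real_of_int (cas_value N \<alpha> + cas_value N \<beta>' - T.cval \<kappa>) = 0"
        using a0 by (simp add: aval_def)
      then show ?thesis by linarith
    qed
    moreover have ab: "ip N \<alpha> \<beta>' \<le> 0" unfolding ip_def by (rule sum_nonpos) (rule prod_le)
    ultimately have z: "nsq N d = 0" "ip N \<alpha> \<beta>' = 0"
      using d0 nsq_nonneg[of N d] by linarith+
    have "(\<Sum>k<N. - (\<alpha> k * \<beta>' k)) = 0" using z(2) by (simp add: ip_def sum_negf)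
    then have "\<forall>k\<in>{..<N}. - (\<alpha> k * \<beta>' k) = 0"
      by (subst sum_nonneg_eq_0_iff[symmetric]) (use prod_le in auto)
    then have disj: "\<alpha> k = 0 \<or> \<beta>' k = 0" if "k < N" for k using that by auto
    have "max 0 (\<kappa> k - dl N k) = \<alpha> k" if k: "k < N" for k
    proof -
      have "\<kappa> k - dl N k = \<alpha> k + \<beta>' k" using nsq_eq_0[OF z(1) k] by (simp add: d_def)
      moreover have "\<alpha> k \<ge> 0" "\<beta>' k \<le> 0" using \<alpha> \<beta> by (auto simp: poly_weight_def dual_weight_def)
      ultimately show ?thesis using disj[OF k] by auto
    qed
    then show "(\<Sum>k<N. max 0 (\<kappa> k - dl N k)) = int m"
      using \<alpha> by (simp add: poly_weight_def)
  qed
qed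

text \<open>The sizes of \<mu> and \<nu> are smaller by r, which leaves (2N-1)r + r = 2Nr besides
  twice the differences of contents.\<close>

lemma aval_eig_value:
  assumes "\<alpha> = hweight N (\<rho>, [])" "\<beta> = hweight N (\<sigma>, [])" "length \<rho> \<le> N" "length \<sigma> \<le> N"
    and "sum_list \<rho> = m" "sum_list \<sigma> = n" "sum_list \<mu> + r = m" "sum_list \<nu> + r = n"
    and "length \<mu> + length \<nu> \<le> N"
  shows "aval (plus_dl N (hweight N (\<mu>, \<nu>))) = of_int (eig_value N r \<rho> \<sigma> \<mu> \<nu>)"
proof -
  have c: "Defs.content [] = 0" by (simp add: Defs.content_def)
  have "cas_value N \<alpha> = 2 * Defs.content \<rho> + (2 * int N - 1) * int m"
    using cas_value_hweight[of \<rho> "[]" N] assms(1,3,5) c by simp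
  moreover have "cas_value N \<beta>' = 2 * Defs.content \<sigma> + int n"
    using cas_value_hweight[of "[]" \<sigma> N] assms(2,4,6) c by (simp add: hweight_dual)
  moreover have "T.cval (plus_dl N (hweight N (\<mu>, \<nu>))) =
      2 * Defs.content \<mu> + 2 * Defs.content \<nu> + (2 * int N - 1) * (int m - int r) + (int n - int r)"
  proof -
    have "int (sum_list \<mu>) = int m - int r" "int (sum_list \<nu>) = int n - int r" using assms(7,8) by linarith+
    then show ?thesis
      using cas_value_hweight[OF assms(9)] by (simp add: T.cval_def cas_value_def)
  qed
  ultimately have "cas_value N \<alpha> + cas_value N \<beta>' - T.cval (plus_dl N (hweight N (\<mu>, \<nu>))) =
      2 * eig_value N r \<rho> \<sigma> \<mu> \<nu>"
    by (simp add: eig_value_def algebra_simps)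
  then show ?thesis by (simp add: aval_def)
qed

text \<open>\<open>den_ch_alternants\<close> supplies an expansion with coefficients
  \<open>phi\<close>, natural numbers by \<open>phi_sdec\<close> and \<open>phi_M_integral\<close>.
  Independence of alternants makes it the only one, so the definite description picks it.\<close>

lemma LRc_phi:
  assumes \<alpha>\<rho>: "\<alpha> = hweight N (\<rho>, [])" and \<beta>\<sigma>: "\<beta> = hweight N (\<sigma>, [])" and \<sigma>: "length \<sigma> \<le> N"
    and valid: "valid_pair N (\<mu>, \<nu>)"
  shows "real (LRc N \<rho> \<sigma> \<mu> \<nu>) = T.phi M (plus_dl N (hweight N (\<mu>, \<nu>)))"
proof -
  define h where "h = (\<lambda>p. plus_dl N (hweight N p))"
  define c0 where "c0 = (\<lambda>p. if valid_pair N p then nat \<lfloor>T.phi M (h p)\<rfloor> else 0)"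
  let ?a = "alternant N (dl N)" and ?D = "{\<kappa>. T.phi M \<kappa> \<noteq> 0 \<and> sdec N \<kappa>}"
  have rat: "rat_schur N p x = alternant N (h p) x / ?a x" for p x
    by (simp add: rat_schur_def h_def plus_dl_def dl_def)
  have sd: "sdec N (h p)" if "valid_pair N p" for p
    unfolding h_def by (rule hweight_dominant[OF that])
  have hw: "h p \<in> weights N" if "valid_pair N p" for p
    using hweight_weights[OF that] by (auto simp: h_def plus_dl_def weights_def dl_def)
  have inj: "p = q" if "valid_pair N p" "valid_pair N q" "h p = h q" for p q
    using that hweight_inj by (simp add: h_def plus_dl_def fun_eq_iff)
  have c0: "real (c0 p) = T.phi M (h p)" if "valid_pair N p" for p
  proof -
    have "T.phi M (h p) \<ge> 0" by (rule T.phi_sdec(1)[OF M_invproj sd[OF that]])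
    moreover obtain z where "T.phi M (h p) = of_int z" using phi_M_integral Ints_cases by metis
    ultimately show ?thesis using that by (simp add: c0_def)
  qed
  have c0_valid: "valid_pair N p" if "c0 p \<noteq> 0" for p using that by (auto simp: c0_def split: if_splits)
  have bij: "bij_betw h {p. c0 p \<noteq> 0} ?D"
  proof (rule bij_betwI')
    fix p q assume "p \<in> {p. c0 p \<noteq> 0}" "q \<in> {p. c0 p \<noteq> 0}"
    then show "(h p = h q) = (p = q)" using inj c0_valid by blast
  next
    fix p assume "p \<in> {p. c0 p \<noteq> 0}"
    then have p: "c0 p \<noteq> 0" "valid_pair N p" using c0_valid by auto
    then show "h p \<in> ?D" using c0[OF p(2)] sd[OF p(2)] by auto
  next
    fix \<kappa> assume \<kappa>: "\<kappa> \<in> ?D"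
    then have "\<kappa> \<in> weights N" using T.phi_weights by blast
    then have "(\<lambda>k. \<kappa> k - dl N k) \<in> weights N" by (auto simp: weights_def dl_def)
    moreover have e: "plus_dl N (\<lambda>k. \<kappa> k - dl N k) = \<kappa>" by (simp add: plus_dl_def)
    ultimately obtain p where p: "valid_pair N p" "hweight N p = (\<lambda>k. \<kappa> k - dl N k)"
      using hweight_surj[of "\<lambda>k. \<kappa> k - dl N k" N] \<kappa> by auto
    have hp: "h p = \<kappa>" unfolding h_def p(2) e ..
    have "c0 p \<noteq> 0" using c0[OF p(1)] hp \<kappa> by auto
    then show "\<exists>p\<in>{p. c0 p \<noteq> 0}. \<kappa> = h p" using hp by blast
  qed
  have fin: "finite {p. c0 p \<noteq> 0}"
  proof -
    have "finite ?D" by (rule finite_subset[OF _ T.finite_phi]) auto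
    then show ?thesis using bij_betw_finite[OF bij] by blast
  qed
  have eq: "rat_schur N (\<rho>, []) x * rat_schur N ([], \<sigma>) x = (\<Sum>p | c0 p \<noteq> 0. of_nat (c0 p) * rat_schur N p x)"
    if x: "x \<in> torus_reg N" for x
  proof -
    have a: "?a x \<noteq> 0" by (rule alternant_dl_nz[OF x])
    have "?a x * chP x = alternant N (h (\<rho>, [])) x"
      using VP x by (simp add: V.hw_def h_def plus_dl_def \<alpha>\<rho>)
    moreover have "?a x * chQ x = alternant N (h ([], \<sigma>)) x"
      using WQ x by (simp add: W.hw_def h_def plus_dl_def \<beta>\<sigma> hweight_dual[OF \<sigma>])
    ultimately have "rat_schur N (\<rho>, []) x = chP x"
      "rat_schur N ([], \<sigma>) x = chQ x"
      unfolding rat using a by (metis nonzero_mult_div_cancel_left)+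
    then have "rat_schur N (\<rho>, []) x * rat_schur N ([], \<sigma>) x = (?a x * chM x) / ?a x"
      using a by (simp add: ch_M[OF x])
    also have "\<dots> = (\<Sum>\<kappa>\<in>?D. of_real (T.phi M \<kappa>) * alternant N \<kappa> x) / ?a x"
      unfolding T.den_ch_alternants[OF M_symmetric x] ..
    also have "(\<Sum>\<kappa>\<in>?D. of_real (T.phi M \<kappa>) * alternant N \<kappa> x) =
        (\<Sum>p | c0 p \<noteq> 0. of_real (T.phi M (h p)) * alternant N (h p) x)"
      by (rule sum.reindex_bij_betw[OF bij, symmetric])
    also have "\<dots> = (\<Sum>p | c0 p \<noteq> 0. of_nat (c0 p) * alternant N (h p) x)"
      by (rule sum.cong) (auto simp: c0[OF c0_valid, symmetric])
    finally show ?thesis by (simp add: rat sum_divide_distrib)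
  qed
  have "(THE c. finite {p. c p \<noteq> 0} \<and> (\<forall>p. c p \<noteq> 0 \<longrightarrow> valid_pair N p) \<and>
        (\<forall>x \<in> torus_reg N. rat_schur N (\<rho>, []) x * rat_schur N ([], \<sigma>) x =
            (\<Sum>p | c p \<noteq> 0. of_nat (c p) * rat_schur N p x))) = c0"
  proof (rule the_equality)
    show "finite {p. c0 p \<noteq> 0} \<and> (\<forall>p. c0 p \<noteq> 0 \<longrightarrow> valid_pair N p) \<and>
        (\<forall>x \<in> torus_reg N. rat_schur N (\<rho>, []) x * rat_schur N ([], \<sigma>) x =
            (\<Sum>p | c0 p \<noteq> 0. of_nat (c0 p) * rat_schur N p x))"
      using fin c0_valid eq by blast
  next
    fix c :: "nat list \<times> nat list \<Rightarrow> nat"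
    assume c: "finite {p. c p \<noteq> 0} \<and> (\<forall>p. c p \<noteq> 0 \<longrightarrow> valid_pair N p) \<and>
        (\<forall>x \<in> torus_reg N. rat_schur N (\<rho>, []) x * rat_schur N ([], \<sigma>) x =
            (\<Sum>p | c p \<noteq> 0. of_nat (c p) * rat_schur N p x))"
    then have cfin: "finite {p. c p \<noteq> 0}" and cvalid: "\<And>p. c p \<noteq> 0 \<Longrightarrow> valid_pair N p"
      and ceq: "\<And>x. x \<in> torus_reg N \<Longrightarrow> rat_schur N (\<rho>, []) x * rat_schur N ([], \<sigma>) x =
            (\<Sum>p | c p \<noteq> 0. of_nat (c p) * rat_schur N p x)"
      by blast+
    define S where "S = {p. c p \<noteq> 0} \<union> {p. c0 p \<noteq> 0}"
    define f where "f = (\<lambda>p. of_nat (c p) - of_nat (c0 p) :: complex)"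
    have finS: "finite S" using cfin fin by (simp add: S_def)
    have vS: "valid_pair N p" if "p \<in> S" for p using that cvalid c0_valid unfolding S_def by blast
    have injS: "inj_on h S" using inj vS by (meson inj_onI)
    have "c p = c0 p" for p
    proof (cases "p \<in> S")
      case True
      \<comment> \<open>\<open>alternants_independent\<close> is indexed by exponents, so the
        coefficients are transported along the injection \<open>h\<close>.\<close>
      have "f (inv_into S h (h p)) = 0"
      proof (rule alternants_independent[of "h ` S" N])
        fix x assume x: "x \<in> torus_reg N"
        have "(\<Sum>p | c p \<noteq> 0. of_nat (c p) * rat_schur N p x) = (\<Sum>p | c0 p \<noteq> 0. of_nat (c0 p) * rat_schur N p x)"
          using ceq[OF x] eq[OF x] by (simp only:)
        moreover have "(\<Sum>p | c p \<noteq> 0. of_nat (c p) * rat_schur N p x) = (\<Sum>p\<in>S. of_nat (c p) * rat_schur N p x)"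
          by (rule sum.mono_neutral_left) (use finS in \<open>auto simp: S_def\<close>)
        moreover have "(\<Sum>p | c0 p \<noteq> 0. of_nat (c0 p) * rat_schur N p x) = (\<Sum>p\<in>S. of_nat (c0 p) * rat_schur N p x)"
          by (rule sum.mono_neutral_left) (use finS in \<open>auto simp: S_def\<close>)
        ultimately have "(\<Sum>p\<in>S. f p * rat_schur N p x) = 0"
          by (simp add: f_def left_diff_distrib sum_subtractf)
        then have "(\<Sum>p\<in>S. f p * alternant N (h p) x) / ?a x = 0"
          by (simp add: rat sum_divide_distrib)
        then have "(\<Sum>p\<in>S. f p * alternant N (h p) x) = 0"
          using alternant_dl_nz[OF x] by simp
        moreover have "(\<Sum>\<kappa>\<in>h ` S. f (inv_into S h \<kappa>) * alternant N \<kappa> x) = (\<Sum>p\<in>S. f p * alternant N (h p) x)"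
          unfolding sum.reindex[OF injS] by (rule sum.cong) (simp_all add: inv_into_f_f[OF injS])
        ultimately show "(\<Sum>\<kappa>\<in>h ` S. f (inv_into S h \<kappa>) * alternant N \<kappa> x) = 0" by simp
      qed (use finS vS hw sd True in auto)
      then have "f p = 0" using True injS by (simp only: inv_into_f_f)
      then show ?thesis by (simp add: f_def)
    qed (simp add: S_def)
    then show "c = c0" by blast
  qed
  then have "LRc N \<rho> \<sigma> \<mu> \<nu> = c0 (\<mu>, \<nu>)" by (simp add: LRc_def)
  then show ?thesis using c0[OF valid] by (simp add: h_def)
qed

end

section \<open>The contraction operator\<close>

lemma rv_tns_word_E:
  assumes f: "f \<in> idx N m" and g: "g \<in> idx N n" and k: "k < N" and l: "l < N"
  shows "rv T (tns (word_E N m k l) (word_E N n k l)) (f, g) =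
  (\<Sum>a<m. \<Sum>b<n. if f a = l \<and> g b = l then T (f(a := k), g(b := k)) else 0)"
proof -
  have upd: "f(a := k) \<in> idx N m" if "a < m" for a using f k that by (auto simp: idx_def)
  have upd': "g(b := k) \<in> idx N n" if "b < n" for b using g k that by (auto simp: idx_def)
  have sw: "entry (word_E N r k l) p q = (\<Sum>a<r. if q a = l \<and> p = q(a := k) then 1 else 0)"
  if "p \<in> idx N r" "q \<in> idx N r" for r p q
  by (rule entry_word_E[OF that k])
  have sE: "msupp (word_E N r k l) \<subseteq> idx N r" for r
  by (rule glrep.msupp_E[OF glrep_words k l])
  have "rv T (tns (word_E N m k l) (word_E N n k l)) (f, g) =
      (\<Sum>x\<in>idx N m \<times> idx N n. T x * of_real (entry (tns (word_E N m k l) (word_E N n k l)) x (f, g)))"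
    by (rule rv_eq[OF _ msupp_tns[OF sE sE]]) simp
  also have "\<dots> = (\<Sum>p\<in>idx N m. \<Sum>q\<in>idx N n. T (p, q) *
        of_real (entry (word_E N m k l) p f * entry (word_E N n k l) q g))"
    unfolding sum.cartesian_product by (rule sum.cong) auto
  also have "\<dots> = (\<Sum>p\<in>idx N m. \<Sum>q\<in>idx N n. \<Sum>a<m. \<Sum>b<n.
      (if p = f(a := k) then (if q = g(b := k) then (if f a = l \<and> g b = l then T (p, q) else 0) else 0) else 0))"
  proof (intro sum.cong refl)
    fix p q assume pq: "p \<in> idx N m" "q \<in> idx N n"
    show "T (p, q) * of_real (entry (word_E N m k l) p f * entry (word_E N n k l) q g) = (\<Sum>a<m. \<Sum>b<n.
      (if p = f(a := k) then (if q = g(b := k) then (if f a = l \<and> g b = l then T (p, q) else 0) else 0) else 0))"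
      unfolding sw[OF pq(1) f] sw[OF pq(2) g] sum_product
      unfolding of_real_sum sum_distrib_left
      by (intro sum.cong refl) auto
  qed
  also have "\<dots> = (\<Sum>p\<in>idx N m. \<Sum>a<m. \<Sum>b<n. \<Sum>q\<in>idx N n.
      (if p = f(a := k) then (if q = g(b := k) then (if f a = l \<and> g b = l then T (p, q) else 0) else 0) else 0))"
    by (intro sum.cong refl) (subst sum.swap, intro sum.cong refl, rule sum.swap)
  also have "\<dots> = (\<Sum>a<m. \<Sum>b<n. \<Sum>p\<in>idx N m. \<Sum>q\<in>idx N n.
      (if p = f(a := k) then (if q = g(b := k) then (if f a = l \<and> g b = l then T (p, q) else 0) else 0) else 0))"
    by (subst sum.swap, intro sum.cong refl, rule sum.swap)
  also have "\<dots> = (\<Sum>a<m. \<Sum>b<n. if f a = l \<and> g b = l then T (f(a := k), g(b := k)) else 0)"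
  proof (intro sum.cong refl)
    fix a b assume ab: "a \<in> {..<m}" "b \<in> {..<n}"
    let ?t = "\<lambda>p q. if f a = l \<and> g b = l then T (p, q) else 0"
    have "(\<Sum>p\<in>idx N m. \<Sum>q\<in>idx N n. if p = f(a := k) then (if q = g(b := k) then ?t p q else 0) else 0) =
        (\<Sum>p\<in>idx N m. if p = f(a := k) then (\<Sum>q\<in>idx N n. if q = g(b := k) then ?t p q else 0) else 0)"
      by (intro sum.cong refl) auto
    also have "\<dots> = ?t (f(a := k)) (g(b := k))"
      using ab upd upd' by (simp only: sum.delta finite_idx lessThan_iff if_True)
    finally show "(\<Sum>p\<in>idx N m. \<Sum>q\<in>idx N n. if p = f(a := k) then (if q = g(b := k) then ?t p q else 0) else 0) =
        ?t (f(a := k)) (g(b := k))" .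
  qed
  finally show ?thesis .
qed

lemma msupp_contr: "msupp (contr N m n) \<subseteq> idx N m \<times> idx N n"
  unfolding contr_def
  by (intro msupp_sum msupp_tns glrep.msupp_E[OF glrep_words]) auto

text \<open>By the Leibniz formula each pair of positions contributes one \<open>tau\<close>; off
  the index set both sides are zero.\<close>

lemma opA_eq_rv: "opA N m n T = rv T (contr N m n)"
proof
  fix x :: "(nat \<Rightarrow> nat) \<times> (nat \<Rightarrow> nat)"
  obtain f g where x: "x = (f, g)" by (cases x)
  show "opA N m n T x = rv T (contr N m n) x"
  proof (cases "f \<in> idx N m \<and> g \<in> idx N n")
    case True
    then have f: "f \<in> idx N m" and g: "g \<in> idx N n" by auto
    let ?t = "\<lambda>a b k. T (f(a := k), g(b := k))"
    have "rv T (contr N m n) (f, g) =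
        (\<Sum>k<N. \<Sum>l<N. \<Sum>a<m. \<Sum>b<n. if f a = l \<and> g b = l then ?t a b k else 0)"
      unfolding contr_def rv_sum by (intro sum.cong refl rv_tns_word_E[OF f g]) auto
    also have "\<dots> = (\<Sum>k<N. \<Sum>a<m. \<Sum>b<n. \<Sum>l<N. if f a = l \<and> g b = l then ?t a b k else 0)"
    proof (rule sum.cong[OF refl])
      fix k
      have "(\<Sum>l<N. \<Sum>a<m. \<Sum>b<n. if f a = l \<and> g b = l then ?t a b k else 0) =
          (\<Sum>a<m. \<Sum>l<N. \<Sum>b<n. if f a = l \<and> g b = l then ?t a b k else 0)"
        by (rule sum.swap)
      also have "\<dots> = (\<Sum>a<m. \<Sum>b<n. \<Sum>l<N. if f a = l \<and> g b = l then ?t a b k else 0)"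
        by (rule sum.cong[OF refl]) (rule sum.swap)
      finally show "(\<Sum>l<N. \<Sum>a<m. \<Sum>b<n. if f a = l \<and> g b = l then ?t a b k else 0) =
          (\<Sum>a<m. \<Sum>b<n. \<Sum>l<N. if f a = l \<and> g b = l then ?t a b k else 0)" .
    qed
    \<comment> \<open>The sum over l collapses to l = f a and leaves the condition that the two
      contracted letters agree.\<close>
    also have "\<dots> = (\<Sum>k<N. \<Sum>a<m. \<Sum>b<n. if f a = g b then ?t a b k else 0)"
    proof (intro sum.cong refl)
      fix k a b assume "a \<in> {..<m}"
      then have "f a < N" using f by (auto simp: idx_def)
      have "(\<Sum>l<N. if f a = l \<and> g b = l then ?t a b k else 0) =
          (\<Sum>l<N. if l = f a then (if f a = g b then ?t a b k else 0) else 0)"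
        by (rule sum.cong) auto
      then show "(\<Sum>l<N. if f a = l \<and> g b = l then ?t a b k else 0) = (if f a = g b then ?t a b k else 0)"
        using \<open>f a < N\<close> by (simp only: sum.delta finite_lessThan lessThan_iff if_True)
    qed
    also have "\<dots> = (\<Sum>a<m. \<Sum>k<N. \<Sum>b<n. if f a = g b then ?t a b k else 0)"
      by (rule sum.swap)
    also have "\<dots> = (\<Sum>a<m. \<Sum>b<n. \<Sum>k<N. if f a = g b then ?t a b k else 0)"
      by (rule sum.cong[OF refl]) (rule sum.swap)
    also have "\<dots> = opA N m n T (f, g)"
      using f g unfolding opA_def tau_def by (intro sum.cong refl) simp
    finally show ?thesis by (simp add: x)
  next
    case False
    then have "entry (contr N m n) p x = 0" for p
      using msupp_contr[of N m n] x by (intro entry_eq_0) auto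
    then have "rv T (contr N m n) x = 0" by (simp add: rv_def)
    moreover have "opA N m n T x = 0" using False unfolding opA_def tau_def x by (intro sum.neutral ballI) auto
    ultimately show ?thesis by simp
  qed
qed

text \<open>\<open>word_hw_span\<close> is applied once in each tensor factor, the other argument
  being held fixed.\<close>

lemma mixed_span:
  assumes zero: "\<And>\<alpha> \<beta> P Q q. mixed N m n \<alpha> \<beta> P Q \<Longrightarrow> rv v (tns P Q) q = 0"
    and p: "p \<in> idx N m \<times> idx N n"
  shows "v p = 0"
proof -
  have "rv (\<lambda>b. v (a, b)) Q y = 0"
    if Q: "poly_weight N n \<beta>" "word_hw N n \<beta> Q" and a: "a \<in> idx N m" for \<beta> Q y a
  proof (rule word_hw_span[OF _ a, of "\<lambda>a. rv (\<lambda>b. v (a, b)) Q y"])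
    fix \<alpha> P z assume P: "poly_weight N m \<alpha>" "word_hw N m \<alpha> P"
    have sP: "msupp P \<subseteq> idx N m" and sQ: "msupp Q \<subseteq> idx N n"
      using word_hw_msupp P Q by blast+
    have "rv (\<lambda>a. rv (\<lambda>b. v (a, b)) Q y) P z =
        (\<Sum>a\<in>idx N m. (\<Sum>b\<in>idx N n. v (a, b) * of_real (entry Q b y)) * of_real (entry P a z))"
      by (simp only: rv_eq[OF finite_idx sP] rv_eq[OF finite_idx sQ])
    also have "\<dots> = (\<Sum>x\<in>idx N m \<times> idx N n. v x * of_real (entry (tns P Q) x (z, y)))"
      unfolding sum_distrib_right sum.cartesian_product by (rule sum.cong) auto
    also have "\<dots> = rv v (tns P Q) (z, y)"
      by (rule rv_eq[symmetric]) (auto intro!: msupp_tns[OF sP sQ, THEN subsetD])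
    also have "\<dots> = 0" by (rule zero) (use P Q in \<open>simp add: mixed_def\<close>)
    finally show "rv (\<lambda>a. rv (\<lambda>b. v (a, b)) Q y) P z = 0" .
  qed
  then have "(\<lambda>b. v (fst p, b)) (snd p) = 0"
    using word_hw_span[of N n "\<lambda>b. v (fst p, b)" "snd p"] p by (auto simp: mem_Times_iff)
  then show ?thesis by simp
qed

section \<open>Eigenvalues and admissible data\<close>

lemma admissible_mixed:
  assumes "admissible N m n r \<rho> \<sigma> \<mu> \<nu>"
  obtains P Q where "mixed N m n (hweight N (\<rho>, [])) (hweight N (\<sigma>, [])) P Q"
proof -
  have "poly_weight N m (hweight N (\<rho>, []))" "poly_weight N n (hweight N (\<sigma>, []))"
    using assms poly_weight_hweight by (auto simp: admissible_def)
  then show ?thesis using word_hw_exists that by (metis mixed.intro)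
qed

lemma admissible_phi:
  assumes adm: "admissible N m n r \<rho> \<sigma> \<mu> \<nu>"
    and mx: "mixed N m n (hweight N (\<rho>, [])) (hweight N (\<sigma>, [])) P Q"
  defines "\<kappa> \<equiv> plus_dl N (hweight N (\<mu>, \<nu>))"
  shows "glrep.phi N (idx N m \<times> idx N n) (mixed_wt m n) (tns P Q) \<kappa> \<noteq> 0" and "sdec N \<kappa>"
    and "mixed.aval N (hweight N (\<rho>, [])) (hweight N (\<sigma>, [])) \<kappa> = of_int (eig_value N r \<rho> \<sigma> \<mu> \<nu>)"
proof -
  interpret mixed N m n "hweight N (\<rho>, [])" "hweight N (\<sigma>, [])" P Q by fact
  have a: "valid_pair N (\<mu>, \<nu>)" "length \<sigma> \<le> N" "length \<rho> \<le> N" "LRc N \<rho> \<sigma> \<mu> \<nu> \<noteq> 0"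
    "sum_list \<rho> = m" "sum_list \<sigma> = n" "sum_list \<mu> + r = m" "sum_list \<nu> + r = n" "length \<mu> + length \<nu> \<le> N"
    using adm by (auto simp: admissible_def valid_pair_def)
  show "T.phi M \<kappa> \<noteq> 0" using LRc_phi[OF refl refl a(2,1)] a(4) by (simp add: \<kappa>_def)
  show "sdec N \<kappa>" unfolding \<kappa>_def by (rule hweight_dominant[OF a(1)])
  show "aval \<kappa> = of_int (eig_value N r \<rho> \<sigma> \<mu> \<nu>)"
    unfolding \<kappa>_def by (rule aval_eig_value[OF refl refl a(3,2,5-9)])
qed

text \<open>A row of the eigenprojection through a nonzero diagonal entry is a row eigenvector of
  \<open>contr\<close>.\<close>

lemma admissible_eigenvalue:
  assumes adm: "admissible N m n r \<rho> \<sigma> \<mu> \<nu>"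
  shows "of_int (eig_value N r \<rho> \<sigma> \<mu> \<nu>) \<in> eigenvalues_A N m n"
proof -
  obtain P Q where mx: "mixed N m n (hweight N (\<rho>, [])) (hweight N (\<sigma>, [])) P Q"
    using admissible_mixed[OF adm] .
  interpret mixed N m n "hweight N (\<rho>, [])" "hweight N (\<sigma>, [])" P Q by fact
  let ?e = "eig_value N r \<rho> \<sigma> \<mu> \<nu>"
  note ph = admissible_phi[OF adm mx]
  obtain R p where R: "T.invproj R" "R * contr N m n = of_int ?e *\<^sub>R R" "entry R p p \<noteq> 0"
    using eigenprojection_exists[OF ph(1,2)] unfolding ph(3) by blast
  have sR: "msupp R \<subseteq> idx N m \<times> idx N n" using R(1) by (simp add: T.invproj_def T.invariant_def)
  define v where "v = (\<lambda>q. complex_of_real (entry R p q))"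
  have "v \<in> tensors N m n"
    unfolding tensors_def v_def using sR by (auto intro!: entry_eq_0)
  moreover have "v \<noteq> (\<lambda>_. 0)" using R(3) unfolding v_def by (metis of_real_eq_0_iff)
  moreover have "opA N m n v = (\<lambda>q. of_int ?e * v q)"
  proof
    fix q
    have fin: "finite (idx N m \<times> idx N n)" by simp
    have "opA N m n v q = of_real (entry (R * contr N m n) p q)"
      unfolding opA_eq_rv rv_eq[OF fin msupp_contr] entry_times[OF fin disjI1[OF sR]] by (simp add: v_def)
    also have "\<dots> = of_int ?e * v q" by (simp add: R(2) v_def)
    finally show "opA N m n v q = of_int ?e * v q" .
  qed
  ultimately show ?thesis unfolding eigenvalues_A_def by blast
qed

lemma eigenvalue_admissible:
  assumes "c \<in> eigenvalues_A N m n"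
  shows "\<exists>r \<rho> \<sigma> \<mu> \<nu>. admissible N m n r \<rho> \<sigma> \<mu> \<nu> \<and> c = of_int (eig_value N r \<rho> \<sigma> \<mu> \<nu>)"
proof -
  obtain v where v: "v \<in> tensors N m n" "v \<noteq> (\<lambda>_. 0)" "rv v (contr N m n) = (\<lambda>p. c * v p)"
    using assms by (auto simp: eigenvalues_A_def opA_eq_rv)
  obtain p where p: "v p \<noteq> 0" using v(2) by (meson ext)
  then have "p \<in> idx N m \<times> idx N n" using v(1) by (cases p) (auto simp: tensors_def)
  then obtain \<alpha> \<beta> P Q q where mx: "mixed N m n \<alpha> \<beta> P Q" and q: "rv v (tns P Q) q \<noteq> 0"
    using mixed_span p by metis
  interpret mixed N m n \<alpha> \<beta> P Q by fact
  obtain \<kappa> where \<kappa>: "T.phi M \<kappa> \<noteq> 0" "sdec N \<kappa>" "c = of_real (aval \<kappa>)"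
    using eigenvalue_phi[OF v(3) q] by blast
  have e: "plus_dl N (\<lambda>k. \<kappa> k - dl N k) = \<kappa>" by (simp add: plus_dl_def)
  have "(\<lambda>k. \<kappa> k - dl N k) \<in> weights N" using T.phi_weights[OF \<kappa>(1)] by (auto simp: weights_def dl_def)
  then obtain \<mu> \<nu> where mn: "valid_pair N (\<mu>, \<nu>)" "hweight N (\<mu>, \<nu>) = (\<lambda>k. \<kappa> k - dl N k)"
    using hweight_surj[of "\<lambda>k. \<kappa> k - dl N k" N] \<kappa>(2) e by auto
  have len: "length \<mu> + length \<nu> \<le> N" "is_partition \<mu>" "is_partition \<nu>" using mn(1) by (auto simp: valid_pair_def)
  obtain \<rho> where \<rho>: "is_partition \<rho>" "length \<rho> \<le> N" "sum_list \<rho> = m" "hweight N (\<rho>, []) = \<alpha>"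
    using poly_weight_partition[OF \<alpha>] by blast
  obtain \<sigma> where \<sigma>: "is_partition \<sigma>" "length \<sigma> \<le> N" "sum_list \<sigma> = n" "hweight N (\<sigma>, []) = \<beta>"
    using poly_weight_partition[OF \<beta>] by blast
  have mu: "sum_list \<mu> \<le> m"
    using weight_sums(2)[OF \<kappa>(1,2)] sum_pos_hweight[OF len(1)] by (simp add: mn(2))
  have diff: "int (sum_list \<mu>) - int (sum_list \<nu>) = int m - int n"
    using weight_sums(1)[OF \<kappa>(1,2)] sum_hweight_diff[OF len(1)] by (simp add: mn(2))
  \<comment> \<open>The positive part of the weight has size at most m, so nothing is truncated; the
    difference of the sizes then gives the same r for \<nu>.\<close>
  define r where "r = m - sum_list \<mu>"
  have r: "sum_list \<mu> + r = m" "sum_list \<nu> + r = n" using mu diff by (simp_all add: r_def)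
  have "real (LRc N \<rho> \<sigma> \<mu> \<nu>) \<noteq> 0"
    using LRc_phi[OF \<rho>(4)[symmetric] \<sigma>(4)[symmetric] \<sigma>(2) mn(1)] \<kappa>(1) by (simp add: mn(2) e)
  then have "admissible N m n r \<rho> \<sigma> \<mu> \<nu>"
    unfolding admissible_def using \<rho> \<sigma> len r by auto
  moreover have "aval \<kappa> = of_int (eig_value N r \<rho> \<sigma> \<mu> \<nu>)"
    using aval_eig_value[OF \<rho>(4)[symmetric] \<sigma>(4)[symmetric] \<rho>(2) \<sigma>(2) \<rho>(3) \<sigma>(3) r len(1)]
    by (simp add: mn(2) e)
  ultimately show ?thesis using \<kappa>(3) by (metis of_real_of_int_eq)
qed

lemma admissible_zero_iff:
  assumes adm: "admissible N m n r \<rho> \<sigma> \<mu> \<nu>"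
  shows "eig_value N r \<rho> \<sigma> \<mu> \<nu> = 0 \<longleftrightarrow> r = 0"
proof -
  obtain P Q where mx: "mixed N m n (hweight N (\<rho>, [])) (hweight N (\<sigma>, [])) P Q"
    using admissible_mixed[OF adm] .
  interpret mixed N m n "hweight N (\<rho>, [])" "hweight N (\<sigma>, [])" P Q by fact
  let ?\<kappa> = "plus_dl N (hweight N (\<mu>, \<nu>))"
  note ph = admissible_phi[OF adm mx]
  have a: "sum_list \<mu> + r = m" "length \<mu> + length \<nu> \<le> N" using adm by (auto simp: admissible_def)
  have "(\<Sum>k<N. max 0 (?\<kappa> k - dl N k)) = int (sum_list \<mu>)"
    using sum_pos_hweight[OF a(2)] by (simp add: plus_dl_def)
  then show ?thesis using aval_zero_iff[OF ph(1,2)] ph(3) a(1) by auto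
qed

theorem theorem2p8:
  fixes m n N :: nat
  assumes "m \<ge> 1" and "n \<ge> 1" and "N \<ge> 1"
  shows "eigenvalues_A N m n =
           {of_int (eig_value N r \<rho> \<sigma> \<mu> \<nu>) | r \<rho> \<sigma> \<mu> \<nu>. admissible N m n r \<rho> \<sigma> \<mu> \<nu>}
         \<and> (\<forall>r \<rho> \<sigma> \<mu> \<nu>. admissible N m n r \<rho> \<sigma> \<mu> \<nu> \<longrightarrow>
               (eig_value N r \<rho> \<sigma> \<mu> \<nu> = 0 \<longleftrightarrow> r = 0))"
  using eigenvalue_admissible admissible_eigenvalue admissible_zero_iff by blast

end
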